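(* Let $d>0$ and let $\Omega$ be the open ball of $\mathbb{R}^n$ of radius $d/2$ centered at $0$. There is a constant $C_1$ depending on $\Omega$ such that the following holds. Assume $f,g\in L^2_r(\Omega)$, $f\ge0$ and $g\ge0$ a.e. in $\Omega$, $a\in W^{1,\infty}(\mathbb{R})$ and $\inf_{\mathbb{R}}a>0$. Assume that there is a solution $\mu_d$ of the equation $\mu\,a(\mu)=l_d(\phi)$ such that $$a(\mu_d)=\min_{[0,\mu_d]}a\qquad\text{and}\qquad a(0)=\max_{[0,\mu_d]}a .$$ Let $u^1_d$ be the smallest solution of $(P_d)$, and assume $0\le l_d(u_d^1)\le\mu_d$. Assume in addition that for some $\epsilon>0$ $$C_1\,|g|_2\,|f|_2\,|a'|_{\infty,[-\epsilon,\mu_d+\epsilon]}\,\frac{1}{a(\mu_d)^2}<1.$$ Then $\{(r,u_r): r\in[0,d]\}$ is the only global branch of solutions starting at $u^1_d$ (that is, taking the value $u_d^1$ at $r=d$).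
   Context: $L^2_r(\Omega)$ denotes the set of radial functions $u\in L^2(\Omega)$, i.e. those for which there is $\tilde u\in L^2(]0,d/2[)$ with $u(x)=\tilde u(\|x\|)$ (the subscript stands for "radial"). For $r\in[0,d]$ and $v\in L^2(\Omega)$, $l_r(v)(x)=\int_{\Omega\cap B(x,r)}g(y)v(y)\,dy$, with $B(x,r)$ the closed ball of center $x$ and radius $r$ (so $l_0(v)=0$ and $l_d(v)=\int_\Omega gv$ is a constant). $(P_r)$ is the problem $-\mathrm{div}(a(l_r(u))\nabla u)=f$ in $\Omega$, $u\in H^1_0(\Omega)$, understood weakly. $\phi\in H^1_0(\Omega)$ is the weak solution of $-\Delta\phi=f$ in $\Omega$. The solutions of $(P_d)$ correspond to the real solutions $\mu$ of $\mu\,a(\mu)=l_d(\phi)$ through $\mu=l_d(u)$, i.e. $u=\phi/a(\mu)$. $|\cdot|_2$ is the $L^2(\Omega)$ norm and $|a'|_{\infty,J}$ the $L^\infty$ norm of $a'$ on the interval $J$. Denote by $u_0$ the solution of $(P_0)$ and by $u_d$ the solution of $(P_d)$ associated with $\mu_d$. For $r\in[0,d]$, $u_r$ denotes the unique radial solution of $(P_r)$ in the order interval $[u_0,u_d]$ (its existence and uniqueness are known from earlier work), satisfying $0\le l_r(u_r)\le\mu_d$ a.e. in $\Omega$. A global branch of solutions is (the graph of) a map $u\in C([0,d],H^1_0(\Omega))$ such that $u(r)$ is a solution of $(P_r)$ for every $r\in[0,d]$. *)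

theory Defs
  imports "HOL-Analysis.Analysis" "HOL-Probability.Essential_Supremum"
begin

text \<open>
  Elements of \<open>L\<^sup>2\<close>, \<open>L\<^sup>\<infinity>\<close> and of the Sobolev spaces are represented by functions rather than
  by classes modulo null sets; equality and order of such elements are always meant almost
  everywhere.
\<close>

definition L2 :: "'a measure \<Rightarrow> ('a \<Rightarrow> 'b::euclidean_space) set" where
  "L2 M = {u \<in> borel_measurable M. integrable M (\<lambda>x. (norm (u x))\<^sup>2)}"

definition L2_norm :: "'a measure \<Rightarrow> ('a \<Rightarrow> 'b::euclidean_space) \<Rightarrow> real" where
  "L2_norm M u = sqrt (LINT x|M. (norm (u x))\<^sup>2)"

definition Linf :: "'a measure \<Rightarrow> ('a \<Rightarrow> real) set" where
  "Linf M = {u \<in> borel_measurable M. esssup M (\<lambda>x. ereal \<bar>u x\<bar>) < \<infinity>}"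

definition Linf_norm :: "'a measure \<Rightarrow> ('a \<Rightarrow> real) \<Rightarrow> real" where
  "Linf_norm M u = real_of_ereal (esssup M (\<lambda>x. ereal \<bar>u x\<bar>))"

text \<open>The radial profile is square integrable for the unweighted Lebesgue measure on
  \<open>]0, d/2[\<close>.\<close>

definition L2_radial :: "real \<Rightarrow> ('a::euclidean_space \<Rightarrow> real) set" where
  "L2_radial d = {u \<in> L2 (lebesgue_on (ball 0 (d/2))).
     \<exists>h \<in> L2 (lebesgue_on {0<..<d/2}).
       AE x in lebesgue_on (ball 0 (d/2)). u x = (h :: real \<Rightarrow> real) (norm x)}"

primrec cont_diff :: "nat \<Rightarrow> ('a::euclidean_space \<Rightarrow> real) \<Rightarrow> bool" where
  "cont_diff 0 = (\<lambda>f. continuous_on UNIV f)"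
| "cont_diff (Suc k) = (\<lambda>f. (\<forall>x. f differentiable (at x)) \<and>
     (\<forall>b\<in>Basis. cont_diff k (\<lambda>x. frechet_derivative f (at x) b)))"

definition test_functions :: "'a::euclidean_space set \<Rightarrow> ('a \<Rightarrow> real) set" where
  "test_functions S = {\<psi>. (\<forall>k. cont_diff k \<psi>) \<and>
     compact (closure {x. \<psi> x \<noteq> 0}) \<and> closure {x. \<psi> x \<noteq> 0} \<subseteq> S}"

text \<open>For \<open>'a = real\<close> the weak gradient is the weak derivative. Where it exists it is unique
  almost everywhere, so the choice made in \<open>weak_gradient\<close> is immaterial.\<close>

definition is_weak_gradient ::
    "'a::euclidean_space set \<Rightarrow> ('a \<Rightarrow> real) \<Rightarrow> ('a \<Rightarrow> 'a) \<Rightarrow> bool" where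
  "is_weak_gradient S u w \<longleftrightarrow>
     (\<forall>K. compact K \<and> K \<subseteq> S \<longrightarrow> u absolutely_integrable_on K \<and> w absolutely_integrable_on K) \<and>
     (\<forall>\<psi>\<in>test_functions S. \<forall>b\<in>Basis.
        (LINT x|lebesgue_on S. u x * frechet_derivative \<psi> (at x) b)
          = - (LINT x|lebesgue_on S. (w x \<bullet> b) * \<psi> x))"

definition weak_gradient :: "'a::euclidean_space set \<Rightarrow> ('a \<Rightarrow> real) \<Rightarrow> 'a \<Rightarrow> 'a" where
  "weak_gradient S u = (SOME w. is_weak_gradient S u w)"

definition H1 :: "'a::euclidean_space set \<Rightarrow> ('a \<Rightarrow> real) set" where
  "H1 S = {u \<in> L2 (lebesgue_on S). \<exists>w \<in> L2 (lebesgue_on S). is_weak_gradient S u w}"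

definition H1_norm :: "'a::euclidean_space set \<Rightarrow> ('a \<Rightarrow> real) \<Rightarrow> real" where
  "H1_norm S u = sqrt ((L2_norm (lebesgue_on S) u)\<^sup>2
                      + (L2_norm (lebesgue_on S) (weak_gradient S u))\<^sup>2)"

definition H10 :: "'a::euclidean_space set \<Rightarrow> ('a \<Rightarrow> real) set" where
  "H10 S = {u \<in> H1 S. \<exists>\<psi>. (\<forall>k::nat. \<psi> k \<in> test_functions S) \<and>
     (\<lambda>k. H1_norm S (\<lambda>x. u x - \<psi> k x)) \<longlonglongrightarrow> 0}"

text \<open>Since pointwise values of \<open>a \<in> W\<^sup>1\<^sup>,\<^sup>\<infinity>(\<real>)\<close> are used, \<open>a\<close> is its continuous
  representative.\<close>

definition W1inf_real :: "(real \<Rightarrow> real) set" where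
  "W1inf_real = {a. continuous_on UNIV a \<and> a \<in> Linf (lebesgue_on UNIV) \<and>
     (\<exists>b \<in> Linf (lebesgue_on UNIV). is_weak_gradient UNIV a b)}"

definition is_poisson_solution ::
    "'a::euclidean_space set \<Rightarrow> ('a \<Rightarrow> real) \<Rightarrow> ('a \<Rightarrow> real) \<Rightarrow> bool" where
  "is_poisson_solution S f \<phi> \<longleftrightarrow> \<phi> \<in> H10 S \<and>
     (\<forall>v\<in>H10 S. (LINT x|lebesgue_on S. weak_gradient S \<phi> x \<bullet> weak_gradient S v x)
               = (LINT x|lebesgue_on S. f x * v x))"

definition nonlocal ::
    "'a::euclidean_space set \<Rightarrow> ('a \<Rightarrow> real) \<Rightarrow> real \<Rightarrow> ('a \<Rightarrow> real) \<Rightarrow> 'a \<Rightarrow> real" where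
  "nonlocal S g r v x = (LINT y|lebesgue_on (S \<inter> cball x r). g y * v y)"

text \<open>Weak solutions of \<open>- div (a(l\<^sub>r(u)) \<nabla>u) = f\<close> in \<open>S\<close>, \<open>u \<in> H\<^sup>1\<^sub>0(S)\<close>, where
  \<open>l\<^sub>r(u)\<close> is \<open>nonlocal S g r u\<close>.\<close>

definition is_solution ::
    "'a::euclidean_space set \<Rightarrow> (real \<Rightarrow> real) \<Rightarrow> ('a \<Rightarrow> real) \<Rightarrow> ('a \<Rightarrow> real) \<Rightarrow> real
      \<Rightarrow> ('a \<Rightarrow> real) \<Rightarrow> bool" where
  "is_solution S a f g r u \<longleftrightarrow> u \<in> H10 S \<and>
     (\<forall>v\<in>H10 S.
        (LINT x|lebesgue_on S. a (nonlocal S g r u x) * (weak_gradient S u x \<bullet> weak_gradient S v x))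
          = (LINT x|lebesgue_on S. f x * v x))"

definition is_smallest_solution ::
    "'a::euclidean_space set \<Rightarrow> (real \<Rightarrow> real) \<Rightarrow> ('a \<Rightarrow> real) \<Rightarrow> ('a \<Rightarrow> real) \<Rightarrow> real
      \<Rightarrow> ('a \<Rightarrow> real) \<Rightarrow> bool" where
  "is_smallest_solution S a f g r u \<longleftrightarrow> is_solution S a f g r u \<and>
     (\<forall>w. is_solution S a f g r w \<longrightarrow> (AE x in lebesgue_on S. u x \<le> w x))"

text \<open>Continuity on \<open>[0, d]\<close> is with respect to the \<open>H\<^sup>1\<close> norm.\<close>

definition is_global_branch ::
    "'a::euclidean_space set \<Rightarrow> real \<Rightarrow> (real \<Rightarrow> real) \<Rightarrow> ('a \<Rightarrow> real) \<Rightarrow> ('a \<Rightarrow> real)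
      \<Rightarrow> (real \<Rightarrow> 'a \<Rightarrow> real) \<Rightarrow> bool" where
  "is_global_branch S d a f g v \<longleftrightarrow>
     (\<forall>r\<in>{0..d}. is_solution S a f g r (v r)) \<and>
     (\<forall>s\<in>{0..d}. ((\<lambda>r. H1_norm S (\<lambda>x. v r x - v s x)) \<longlongrightarrow> 0) (at s within {0..d}))"

end

theory Submission
  imports Defs
begin

text \<open>
  Poincare's inequality holds on the ball of radius \<open>d/2\<close> with constant \<open>d\<close>. If \<open>u\<close> and \<open>v\<close> solve
  \<open>(P\<^sub>r)\<close> and \<open>l\<^sub>r(u)\<close>, \<open>l\<^sub>r(v)\<close> take values close to \<open>[0, \<mu>\<^sub>d]\<close>, then testing the difference of
  the two equations with \<open>u - v\<close> gives
  \<open>a(\<mu>\<^sub>d)\<^sup>2 |\<nabla>(u - v)|\<^sub>2 \<le> d\<^sup>2 |a'|\<^sub>\<infinity> |g|\<^sub>2 |f|\<^sub>2 |\<nabla>(u - v)|\<^sub>2\<close> up to a small error, so that \<open>u = v\<close> under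
  the smallness condition with \<open>C\<^sub>1 = d\<^sup>2\<close>. The same estimate for \<open>u\<^sub>r\<close> and \<open>u\<^sub>s\<close> bounds their
  distance by \<open>sup |l\<^sub>r(u\<^sub>s) - l\<^sub>s(u\<^sub>s)|\<close>, which gives continuity in \<open>r\<close>; here
  \<open>0 \<le> l\<^sub>r(u\<^sub>r) \<le> \<mu>\<^sub>d\<close> because \<open>u\<^sub>0 \<ge> 0\<close> by the maximum principle. For another branch \<open>v\<close>
  starting at \<open>u\<^sub>d\<^sup>1\<close>, the continuous function \<open>r \<mapsto> |v\<^sub>r - u\<^sub>r|\<^sub>2\<close> vanishes wherever it is small,
  and it vanishes at \<open>r = d\<close>; hence it is zero.
\<close>

section \<open>Smooth functions\<close>

text \<open>Nothing is known in advance about the range of \<open>l_r(v_r)\<close> for an arbitrary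
  solution, while the smallness condition controls \<open>a\<close> only on an interval around
  \<open>[0, \<mu>d]\<close>. So the estimate does not give uniqueness for all solutions of
  \<open>(P_r)\<close>: it merely isolates \<open>u_r\<close> among the solutions close to it in L2,
  and the connectedness of \<open>[0, d]\<close> has to do the rest. The strict inequality in the
  smallness condition pays for this: the lower bound \<open>a(\<mu>d)\<close> for the coefficient of
  a nearby \<open>v_r\<close> may drop a little without spoiling the estimate. Of the two factors
  \<open>a(\<mu>d)\<close>, one is the coercivity of the equation for \<open>u\<close>, the other
  comes from the energy bound for \<open>v\<close>. Likewise one Poincare constant \<open>d\<close>
  turns the norm of \<open>u - v\<close> into that of its gradient inside the nonlocal term, and the
  other sits in the energy bound.\<close>

lemma cont_diff_SucI:
  assumes "\<And>x. (f has_derivative f' x) (at x)"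
    and "\<And>b. b \<in> Basis \<Longrightarrow> cont_diff k (\<lambda>x. f' x b)"
  shows "cont_diff (Suc k) f"
proof -
  have eq: "frechet_derivative f (at x) = f' x" for x
    using frechet_derivative_at[OF assms(1)] by (rule sym)
  have "f differentiable (at x)" for x
    using assms(1) unfolding differentiable_def by blast
  then show ?thesis
    unfolding cont_diff.simps eq using assms(2) by blast
qed

lemma cont_diff_SucD: "cont_diff (Suc k) f \<Longrightarrow> cont_diff k f"
proof (induction k arbitrary: f)
  case 0
  then show ?case
    by (auto simp: continuous_on_eq_continuous_at differentiable_imp_continuous_within)
next
  case (Suc k)
  have "\<forall>x. f differentiable (at x)" "\<forall>b\<in>Basis. cont_diff (Suc k) (\<lambda>x. frechet_derivative f (at x) b)"
    using Suc.prems unfolding cont_diff.simps(2)[of "Suc k"] by blast+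
  then have "(\<forall>x. f differentiable (at x)) \<and> (\<forall>b\<in>Basis. cont_diff k (\<lambda>x. frechet_derivative f (at x) b))"
    using Suc.IH by blast
  then show ?case
    unfolding cont_diff.simps(2) .
qed

lemma cont_diff_continuous: "cont_diff k f \<Longrightarrow> continuous_on S f"
proof (induction k)
  case 0
  then show ?case by (auto intro: continuous_on_subset)
qed (use cont_diff_SucD in blast)

lemma cont_diff_Suc_has_derivative:
  "cont_diff (Suc k) f \<Longrightarrow> (f has_derivative frechet_derivative f (at x)) (at x)"
  using frechet_derivative_works by auto

lemma cont_diff_const: "cont_diff k (\<lambda>x. c)"
proof (induction k arbitrary: c)
  case (Suc k)
  show ?case
    by (rule cont_diff_SucI[where f' = "\<lambda>x h. 0"]) (auto simp: Suc)
qed auto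

lemma cont_diff_inner_right: "cont_diff k (\<lambda>x. x \<bullet> c)"
proof (cases k)
  case 0
  then show ?thesis by (auto intro!: continuous_intros)
next
  case (Suc m)
  have "cont_diff (Suc m) (\<lambda>x::'a. x \<bullet> c)"
    by (rule cont_diff_SucI[where f' = "\<lambda>x h. h \<bullet> c"])
      (auto intro!: derivative_eq_intros cont_diff_const)
  then show ?thesis using Suc by simp
qed

lemma cont_diff_add:
  "cont_diff k f \<Longrightarrow> cont_diff k g \<Longrightarrow> cont_diff k (\<lambda>x. f x + g x)"
proof (induction k arbitrary: f g)
  case 0
  then show ?case by (auto intro!: continuous_intros)
next
  case (Suc k)
  show ?case
  proof (rule cont_diff_SucI)
    show "((\<lambda>x. f x + g x) has_derivative
        (\<lambda>h. frechet_derivative f (at x) h + frechet_derivative g (at x) h)) (at x)" for x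
      using Suc.prems[THEN cont_diff_Suc_has_derivative] by (rule has_derivative_add)
  qed (use Suc in auto)
qed

lemma cont_diff_mult:
  "cont_diff k f \<Longrightarrow> cont_diff k g \<Longrightarrow> cont_diff k (\<lambda>x. f x * g x)"
proof (induction k arbitrary: f g)
  case 0
  then show ?case by (auto intro!: continuous_intros)
next
  case (Suc k)
  show ?case
  proof (rule cont_diff_SucI)
    show "((\<lambda>x. f x * g x) has_derivative
        (\<lambda>h. f x * frechet_derivative g (at x) h + frechet_derivative f (at x) h * g x)) (at x)" for x
      using Suc.prems[THEN cont_diff_Suc_has_derivative] by (rule has_derivative_mult)
    show "cont_diff k (\<lambda>x. f x * frechet_derivative g (at x) b + frechet_derivative f (at x) b * g x)"
      if "b \<in> Basis" for b
      using that Suc.prems Suc.prems[THEN cont_diff_SucD] by (intro cont_diff_add Suc.IH) auto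
  qed
qed

lemma cont_diff_prod:
  "finite I \<Longrightarrow> (\<And>i. i \<in> I \<Longrightarrow> cont_diff k (f i)) \<Longrightarrow> cont_diff k (\<lambda>x. \<Prod>i\<in>I. f i x)"
  by (induction I rule: finite_induct) (auto intro: cont_diff_const cont_diff_mult)

text \<open>Differentiation lowers the exponent by one and stays within powers of \<open>f\<close>,
  so the induction runs over all \<open>p\<close> at once. The case \<open>p = 1/2\<close> makes the
  smoothed absolute value smooth.\<close>

lemma cont_diff_powr:
  assumes "\<And>k. cont_diff k f" and pos: "\<And>x. f x > 0"
  shows "cont_diff k (\<lambda>x. f x powr p)"
proof (induction k arbitrary: p)
  case 0
  show ?case
    using cont_diff_continuous[OF assms(1)] pos
    by (auto intro!: continuous_intros simp: less_imp_neq[symmetric])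
next
  case (Suc k)
  show ?case
  proof (rule cont_diff_SucI)
    show "((\<lambda>x. f x powr p) has_derivative
        (\<lambda>h. p * f x powr (p - 1) * frechet_derivative f (at x) h)) (at x)" for x
      by (rule has_derivative_eq_rhs,
          rule has_derivative_compose[OF cont_diff_Suc_has_derivative[OF assms(1)],
            of "\<lambda>y. y powr p" "\<lambda>h. p * f x powr (p - 1) * h"])
        (use pos[of x] in \<open>auto simp: has_field_derivative_def[symmetric]
           intro!: derivative_eq_intros\<close>)
    show "cont_diff k (\<lambda>x. p * f x powr (p - 1) * frechet_derivative f (at x) b)"
      if "b \<in> Basis" for b
      using that assms(1)[of "Suc k"] by (auto intro!: cont_diff_mult cont_diff_const Suc)
  qed
qed

text \<open>The family \<open>flat p\<close> is closed under differentiation, so its members are smooth.\<close>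

definition flat :: "real poly \<Rightarrow> real \<Rightarrow> real" where
  "flat p t = (if t > 0 then poly p (1/t) * exp (- (1/t)) else 0)"

lemma tendsto_poly_exp_minus: "((\<lambda>s. poly p s * exp (- s)) \<longlongrightarrow> (0::real)) at_top"
proof -
  have "((\<lambda>s. \<Sum>i\<le>degree p. coeff p i * (s ^ i / exp s)) \<longlongrightarrow> (\<Sum>i\<le>degree p. coeff p i * 0)) at_top"
    by (intro tendsto_intros tendsto_power_div_exp_0)
  then show ?thesis
    by (simp add: poly_altdef sum_distrib_right exp_minus divide_inverse mult.assoc)
qed

lemma flat_tendsto_0: "(flat p \<longlongrightarrow> 0) (at 0)"
proof -
  have "((\<lambda>t. poly p (1/t) * exp (- (1/t))) \<longlongrightarrow> 0) (at_right 0)"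
    using filterlim_compose[OF tendsto_poly_exp_minus[of p] filterlim_inverse_at_top_right]
    by (simp add: inverse_eq_divide)
  moreover have "\<forall>\<^sub>F t in at_right 0. poly p (1/t) * exp (- (1/t)) = flat p t"
    by (simp add: flat_def eventually_at_filter)
  ultimately have r: "(flat p \<longlongrightarrow> 0) (at_right 0)"
    by (rule Lim_transform_eventually)
  have "\<forall>\<^sub>F t in at_left 0. 0 = flat p t"
    by (simp add: flat_def eventually_at_filter)
  then have "(flat p \<longlongrightarrow> 0) (at_left 0)"
    by (rule Lim_transform_eventually[OF tendsto_const])
  with r show ?thesis
    by (simp add: filterlim_split_at)
qed

text \<open>For \<open>t > 0\<close> the derivative of \<open>p(1/t) exp(-1/t)\<close> is
  \<open>(p - p')(1/t) exp(-1/t) / t^2\<close>; the polynomial \<open>[:0, 0, 1:]\<close> is the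
  factor \<open>1/t^2\<close> as a function of \<open>1/t\<close>.\<close>

lemma flat_has_derivative:
  "(flat p has_real_derivative flat ([:0, 0, 1:] * (p - pderiv p)) t) (at t)"
proof (cases t "0::real" rule: linorder_cases)
  case less
  have "((\<lambda>t. 0) has_real_derivative flat ([:0, 0, 1:] * (p - pderiv p)) t) (at t)"
    using less by (simp add: flat_def)
  then show ?thesis
    by (rule has_field_derivative_transform_within_open[where S = "{..<0}"])
      (use less in \<open>auto simp: flat_def\<close>)
next
  case equal
  \<comment> \<open>Dividing by \<open>y\<close> only adds one more factor \<open>1/y\<close>, so
    the difference quotient at 0 is again a flat function, namely that of
    \<open>[:0, 1:] * p\<close>.\<close>
  have "((\<lambda>y. (flat p y - flat p 0) / (y - 0)) \<longlongrightarrow> 0) (at 0)"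
    using flat_tendsto_0[of "[:0, 1:] * p"] by (rule Lim_transform_eventually)
      (auto simp: flat_def eventually_at_filter)
  then show ?thesis
    using equal by (simp add: has_field_derivative_iff flat_def)
next
  case greater
  have "((\<lambda>t. poly p (1/t) * exp (- (1/t))) has_real_derivative
      flat ([:0, 0, 1:] * (p - pderiv p)) t) (at t)"
  proof -
    have "((\<lambda>t. poly p (1/t)) has_real_derivative poly (pderiv p) (1/t) * - (1/t\<^sup>2)) (at t)"
      by (rule DERIV_chain2[OF poly_DERIV])
        (use greater in \<open>auto intro!: derivative_eq_intros simp: power2_eq_square\<close>)
    moreover have "((\<lambda>t. exp (- (1/t))) has_real_derivative exp (- (1/t)) * (1/t\<^sup>2)) (at t)"
      using greater by (auto intro!: derivative_eq_intros simp: power2_eq_square)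
    ultimately have "((\<lambda>t. poly p (1/t) * exp (- (1/t))) has_real_derivative
        poly (pderiv p) (1/t) * - (1/t\<^sup>2) * exp (- (1/t)) + exp (- (1/t)) * (1/t\<^sup>2) * poly p (1/t)) (at t)"
      by (rule DERIV_mult)
    moreover have "flat ([:0, 0, 1:] * (p - pderiv p)) t =
        poly (pderiv p) (1/t) * - (1/t\<^sup>2) * exp (- (1/t)) + exp (- (1/t)) * (1/t\<^sup>2) * poly p (1/t)"
      using greater by (simp add: flat_def power2_eq_square algebra_simps)
    ultimately show ?thesis by simp
  qed
  then show ?thesis
    by (rule has_field_derivative_transform_within_open[where S = "{0<..}"])
      (use greater in \<open>auto simp: flat_def\<close>)
qed

text \<open>The affine argument covers all later uses: the cut-offs at the faces of a box and the
  shifted bumps on the line.\<close>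

lemma cont_diff_flat: "cont_diff k (\<lambda>x. flat p (c * (x \<bullet> b) + e))"
proof (induction k arbitrary: p)
  case 0
  have "continuous_on UNIV (flat p)"
    using flat_has_derivative by (intro DERIV_continuous_on) (blast intro: has_field_derivative_at_within)
  then show ?case
    by (auto intro!: continuous_on_compose2[of UNIV "flat p"] continuous_intros)
next
  case (Suc k)
  show ?case
  proof (rule cont_diff_SucI)
    show "((\<lambda>x. flat p (c * (x \<bullet> b) + e)) has_derivative
        (\<lambda>h. flat ([:0, 0, 1:] * (p - pderiv p)) (c * (x \<bullet> b) + e) * (c * (h \<bullet> b)))) (at x)" for x
      by (rule has_derivative_compose[OF _ flat_has_derivative[unfolded has_field_derivative_def]])
        (auto intro!: derivative_eq_intros)
    show "cont_diff k (\<lambda>x. flat ([:0, 0, 1:] * (p - pderiv p)) (c * (x \<bullet> b) + e) * (c * (i \<bullet> b)))" for i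
      by (intro cont_diff_mult Suc cont_diff_const)
  qed
qed

section \<open>Test functions\<close>

text \<open>A compact set is closed, so it contains the closure of the support as soon as it
  contains the support. Supports are handled only through such a \<open>K\<close> from here
  on.\<close>

lemma test_functionI:
  assumes "\<And>k. cont_diff k \<psi>" "compact K" "K \<subseteq> S" "\<And>x. x \<notin> K \<Longrightarrow> \<psi> x = 0"
  shows "\<psi> \<in> test_functions S"
proof -
  have "closure {x. \<psi> x \<noteq> 0} \<subseteq> K"
    using assms by (intro closure_minimal) (auto intro: compact_imp_closed)
  moreover from this have "compact (closure {x. \<psi> x \<noteq> 0})"
    using \<open>compact K\<close> by (meson bounded_subset closed_closure compact_eq_bounded_closed)
  ultimately show ?thesis
    using assms unfolding test_functions_def by auto
qed

lemma test_functionE: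
  assumes "\<psi> \<in> test_functions S"
  obtains K where "compact K" "K \<subseteq> S" "\<And>x. x \<notin> K \<Longrightarrow> \<psi> x = 0"
proof (rule that[of "closure {x. \<psi> x \<noteq> 0}"])
  show "\<psi> x = 0" if "x \<notin> closure {x. \<psi> x \<noteq> 0}" for x
    using that closure_subset[of "{x. \<psi> x \<noteq> 0}"] by blast
qed (use assms in \<open>simp_all add: test_functions_def\<close>)

lemma test_function_cont_diff: "\<psi> \<in> test_functions S \<Longrightarrow> cont_diff k \<psi>"
  unfolding test_functions_def by auto

lemma test_function_continuous: "\<psi> \<in> test_functions S \<Longrightarrow> continuous_on T \<psi>"
  by (rule cont_diff_continuous[OF test_function_cont_diff])

lemma test_function_has_derivative:
  "\<psi> \<in> test_functions S \<Longrightarrow> (\<psi> has_derivative frechet_derivative \<psi> (at x)) (at x)"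
  by (rule cont_diff_Suc_has_derivative[OF test_function_cont_diff])

lemma test_functions_mono: "S \<subseteq> T \<Longrightarrow> test_functions S \<subseteq> test_functions T"
  unfolding test_functions_def by auto

lemma test_function_partial:
  assumes "\<psi> \<in> test_functions S" "b \<in> Basis"
  shows "(\<lambda>x. frechet_derivative \<psi> (at x) b) \<in> test_functions S"
proof -
  obtain K where K: "compact K" "K \<subseteq> S" "\<And>x. x \<notin> K \<Longrightarrow> \<psi> x = 0"
    using test_functionE[OF assms(1)] by blast
  show ?thesis
  proof (rule test_functionI[OF _ K(1,2)])
    show "cont_diff k (\<lambda>x. frechet_derivative \<psi> (at x) b)" for k
      using test_function_cont_diff[OF assms(1), of "Suc k"] assms(2)
      unfolding cont_diff.simps(2) by blast
    fix x assume "x \<notin> K"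
    \<comment> \<open>The complement of \<open>K\<close> is open, so near \<open>x\<close> the
      function coincides with the constant 0.\<close>
    have "((\<lambda>x. 0) has_derivative (\<lambda>h. 0)) (at x)"
      by simp
    then have "(\<psi> has_derivative (\<lambda>h. 0)) (at x)"
      using open_Compl[OF compact_imp_closed[OF K(1)]] _ K(3)[symmetric]
      by (rule has_derivative_transform_within_open) (use \<open>x \<notin> K\<close> in auto)
    then have "(\<lambda>h. 0) = frechet_derivative \<psi> (at x)"
      by (rule frechet_derivative_at)
    from fun_cong[OF this, of b] show "frechet_derivative \<psi> (at x) b = 0"
      by simp
  qed
qed

lemma test_function_add:
  assumes "\<phi> \<in> test_functions S" "\<psi> \<in> test_functions S"
  shows "(\<lambda>x. \<phi> x + \<psi> x) \<in> test_functions S"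
proof -
  obtain K where K: "compact K" "K \<subseteq> S" "\<And>x. x \<notin> K \<Longrightarrow> \<phi> x = 0"
    using test_functionE[OF assms(1)] by blast
  obtain L where L: "compact L" "L \<subseteq> S" "\<And>x. x \<notin> L \<Longrightarrow> \<psi> x = 0"
    using test_functionE[OF assms(2)] by blast
  show ?thesis
    using K L by (intro test_functionI[where K = "K \<union> L"]
        cont_diff_add assms[THEN test_function_cont_diff]) auto
qed

lemma test_function_mult:
  assumes "\<And>k. cont_diff k \<phi>" "\<psi> \<in> test_functions S"
  shows "(\<lambda>x. \<phi> x * \<psi> x) \<in> test_functions S"
proof -
  obtain K where "compact K" "K \<subseteq> S" "\<And>x. x \<notin> K \<Longrightarrow> \<psi> x = 0"
    using test_functionE[OF assms(2)] by blast
  then show ?thesis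
    by (intro test_functionI[where K = K] cont_diff_mult assms(1)
        test_function_cont_diff[OF assms(2)]) auto
qed

lemma test_function_cmult: "\<psi> \<in> test_functions S \<Longrightarrow> (\<lambda>x. c * \<psi> x) \<in> test_functions S"
  by (rule test_function_mult[OF cont_diff_const])

lemma test_function_bounded:
  assumes "\<psi> \<in> test_functions S"
  obtains B where "B > 0" "\<And>x. \<bar>\<psi> x\<bar> \<le> B"
proof -
  obtain K where K: "compact K" "K \<subseteq> S" "\<And>x. x \<notin> K \<Longrightarrow> \<psi> x = 0"
    using test_functionE[OF assms] by blast
  have "bounded (\<psi> ` K)"
    by (rule compact_imp_bounded[OF compact_continuous_image[OF test_function_continuous[OF assms] K(1)]])
  then obtain B where "B > 0" "\<forall>x\<in>K. \<bar>\<psi> x\<bar> \<le> B"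
    unfolding bounded_pos by auto
  then have "\<bar>\<psi> x\<bar> \<le> B" for x
    using K(3) by (cases "x \<in> K") auto
  with \<open>B > 0\<close> show thesis
    by (rule that)
qed

lemma test_function_integrable:
  assumes "\<psi> \<in> test_functions S"
  shows "integrable lborel \<psi>"
proof -
  obtain K where K: "compact K" "K \<subseteq> S" "\<And>x. x \<notin> K \<Longrightarrow> \<psi> x = 0"
    using test_functionE[OF assms] by blast
  have "integrable lborel (\<lambda>x. indicator K x *\<^sub>R \<psi> x)"
    by (rule borel_integrable_compact[OF K(1) test_function_continuous[OF assms]])
  moreover have "(\<lambda>x. indicator K x *\<^sub>R \<psi> x) = \<psi>"
    using K by (auto simp: fun_eq_iff indicator_def)
  ultimately show ?thesis by simp
qed

text \<open>Passes from the domain to the whole space, where Lebesgue measure is translation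
  invariant and boundary terms cannot arise.\<close>

lemma integral_test_function_lebesgue_on:
  fixes S :: "'a::euclidean_space set"
  assumes S: "open S" and \<psi>: "\<psi> \<in> test_functions S"
  shows "(LINT x|lebesgue_on S. \<psi> x) = (LINT x|lborel. \<psi> x)"
proof -
  have "(LINT x|lebesgue_on S. \<psi> x) = (LINT x|lebesgue. (if x \<in> S then \<psi> x else 0))"
    by (rule Lebesgue_Measure.integral_restrict_UNIV[symmetric]) (use S in auto)
  also have "(\<lambda>x. if x \<in> S then \<psi> x else 0) = \<psi>"
  proof
    obtain K where "K \<subseteq> S" "\<And>x. x \<notin> K \<Longrightarrow> \<psi> x = 0"
      using test_functionE[OF \<psi>] by blast
    then show "(if x \<in> S then \<psi> x else 0) = \<psi> x" for x
      by auto
  qed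
  also have "integral\<^sup>L lebesgue \<psi> = integral\<^sup>L lborel \<psi>"
    by (intro integral_completion)
      (simp add: borel_measurable_continuous_onI test_function_continuous[OF \<psi>])
  finally show ?thesis .
qed

text \<open>The integral of a partial derivative is the limit of the integrals of difference
  quotients, which vanish by translation invariance.\<close>

lemma integral_partial_test_function:
  fixes F :: "'a::euclidean_space \<Rightarrow> real"
  assumes F: "F \<in> test_functions UNIV" and b: "b \<in> Basis"
  shows "(LINT x|lborel. frechet_derivative F (at x) b) = 0"
proof -
  obtain K where K: "compact K" "K \<subseteq> UNIV" "\<And>x. x \<notin> K \<Longrightarrow> F x = 0"
    using test_functionE[OF F] by blast
  obtain R where R: "\<And>x. x \<in> K \<Longrightarrow> norm x \<le> R"
    using compact_imp_bounded[OF K(1)] unfolding bounded_iff by blast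
  obtain B where B: "B > 0" "\<And>x. \<bar>frechet_derivative F (at x) b\<bar> \<le> B"
    using test_function_bounded[OF test_function_partial[OF F b]] by blast
  define t where "t n = 1 / real (Suc n)" for n
  have t: "0 < t n" "t n \<le> 1" for n
    by (auto simp: t_def)
  have t0: "t \<longlonglongrightarrow> 0"
    unfolding t_def by (rule LIMSEQ_Suc[OF lim_1_over_n])
  define q where "q n x = (F (x + t n *\<^sub>R b) - F x) / t n" for n x
  have der: "((\<lambda>s. F (x + s *\<^sub>R b)) has_real_derivative frechet_derivative F (at (x + s *\<^sub>R b)) b) (at s)" for x s
  proof -
    have "((\<lambda>s. F (x + s *\<^sub>R b)) has_derivative (\<lambda>h. frechet_derivative F (at (x + s *\<^sub>R b)) (h *\<^sub>R b))) (at s)"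
    proof (rule has_derivative_compose[OF _ test_function_has_derivative[OF F]])
      show "((\<lambda>s. x + s *\<^sub>R b) has_derivative (\<lambda>h. h *\<^sub>R b)) (at s)"
        by (rule has_derivative_eq_rhs, rule has_derivative_add[OF has_derivative_const
              has_derivative_scaleR_left[OF has_derivative_ident]]) simp
    qed
    moreover have "frechet_derivative F (at y) (h *\<^sub>R b) = frechet_derivative F (at y) b * h" for y h
      by (simp add: linear_cmul[OF has_derivative_linear[OF test_function_has_derivative[OF F]]])
    ultimately show ?thesis
      by (simp add: has_field_derivative_def)
  qed
  have lim: "(\<lambda>n. q n x) \<longlonglongrightarrow> frechet_derivative F (at x) b" for x
  proof -
    have "((\<lambda>s. (F (x + s *\<^sub>R b) - F x) / s) \<longlongrightarrow> frechet_derivative F (at x) b) (at 0)"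
      using der[of x 0] by (simp add: has_field_derivative_iff)
    moreover have "filterlim t (at 0) sequentially"
      using t0 by (rule filterlim_atI) (simp add: t_def)
    ultimately show ?thesis
      unfolding q_def by (rule filterlim_compose)
  qed
  \<comment> \<open>Inside the ball the quotient is a value of the partial derivative, by the mean
    value theorem. Outside it, the steps \<open>t n \<le> 1\<close> are too short to reach
    \<open>K\<close>, so both terms of the quotient vanish; this is why the radius is
    \<open>R + 1\<close>.\<close>
  have bound: "norm (q n x) \<le> indicator (cball 0 (R + 1)) x *\<^sub>R B" for n x
  proof (cases "x \<in> cball 0 (R + 1)")
    case True
    obtain z where "F (x + t n *\<^sub>R b) - F (x + 0 *\<^sub>R b) = (t n - 0) * frechet_derivative F (at (x + z *\<^sub>R b)) b"
      using MVT2[OF t(1)[of n], of "\<lambda>s. F (x + s *\<^sub>R b)" "\<lambda>s. frechet_derivative F (at (x + s *\<^sub>R b)) b"] der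
      by blast
    then have "q n x = frechet_derivative F (at (x + z *\<^sub>R b)) b"
      using t(1)[of n] by (simp add: q_def)
    then show ?thesis
      using B True by simp
  next
    case False
    then have "norm x > R + 1"
      by simp
    moreover have "norm x \<le> norm (x + t n *\<^sub>R b) + norm (t n *\<^sub>R b)"
      by (metis add_diff_cancel_right' norm_triangle_ineq4)
    moreover have "norm (t n *\<^sub>R b) \<le> 1"
      using t[of n] b by simp
    ultimately have "x \<notin> K" "x + t n *\<^sub>R b \<notin> K"
      using R[of x] R[of "x + t n *\<^sub>R b"] by linarith+
    then show ?thesis
      using K(3) B(1) by (simp add: q_def)
  qed
  have meas: "F \<in> borel_measurable borel" "(\<lambda>x. frechet_derivative F (at x) b) \<in> borel_measurable borel"
    using test_function_continuous[OF F] test_function_continuous[OF test_function_partial[OF F b]]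
    by (auto intro!: borel_measurable_continuous_onI)
  \<comment> \<open>Lebesgue measure is its own image under translation, hence both terms of a
    difference quotient have the same integral.\<close>
  have int: "integrable lborel (\<lambda>x. F (x + c))" "(LINT x|lborel. F (x + c)) = (LINT x|lborel. F x)" for c
  proof -
    have "integrable (distr lborel borel ((+) c)) F"
      unfolding lborel_distr_plus by (rule test_function_integrable[OF F])
    then show "integrable lborel (\<lambda>x. F (x + c))"
      by (subst (asm) integrable_distr_eq) (auto simp: meas add.commute)
    have "(LINT x|distr lborel borel ((+) c). F x) = (LINT x|lborel. F (x + c))"
      by (subst integral_distr) (auto simp: meas add.commute)
    then show "(LINT x|lborel. F (x + c)) = (LINT x|lborel. F x)"
      unfolding lborel_distr_plus by simp
  qed
  have "(\<lambda>n. LINT x|lborel. q n x) \<longlonglongrightarrow> (LINT x|lborel. frechet_derivative F (at x) b)"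
  proof (rule integral_dominated_convergence[where w = "\<lambda>x. indicator (cball 0 (R + 1)) x *\<^sub>R B"])
    show "integrable lborel (\<lambda>x. indicator (cball 0 (R + 1)) x *\<^sub>R B :: real)"
      by (rule borel_integrable_compact) auto
    show "q n \<in> borel_measurable lborel" for n
      unfolding q_def using int(1)[of "t n *\<^sub>R b"] meas(1)
      by (intro borel_measurable_divide borel_measurable_diff borel_measurable_const) auto
  qed (use lim bound meas in auto)
  moreover have "(LINT x|lborel. q n x) = 0" for n
    unfolding q_def using int[of "t n *\<^sub>R b"] test_function_integrable[OF F]
    by (simp add: integral_diff)
  ultimately show ?thesis
    by (simp add: LIMSEQ_const_iff)
qed

section \<open>Weak gradients\<close>

text \<open>Since \<open>c\<close> vanishes off \<open>K\<close>, replacing \<open>w\<close> by its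
  truncation to \<open>K\<close> does not change the product, and the truncation is integrable by
  assumption. No integrability of \<open>w\<close> on all of \<open>S\<close> is required.\<close>

lemma integrable_mult_compact_support:
  fixes w c :: "'a::euclidean_space \<Rightarrow> real"
  assumes w: "w absolutely_integrable_on K" and K: "K \<subseteq> S" and S: "S \<in> sets lebesgue"
    and c: "c \<in> borel_measurable borel" "\<And>x. \<bar>c x\<bar> \<le> B" "\<And>x. x \<notin> K \<Longrightarrow> c x = 0"
  shows "integrable (lebesgue_on S) (\<lambda>x. w x * c x)"
proof -
  have i: "integrable lebesgue (\<lambda>x. indicator K x *\<^sub>R w x)"
    using w unfolding set_integrable_def .
  have "c \<in> borel_measurable lebesgue"
    using c(1) by (simp add: measurable_completion)
  moreover have "norm ((indicator K x *\<^sub>R w x) * c x) \<le> norm (B * (indicator K x *\<^sub>R w x))" for x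
  proof -
    have "\<bar>indicator K x *\<^sub>R w x\<bar> * \<bar>c x\<bar> \<le> \<bar>indicator K x *\<^sub>R w x\<bar> * \<bar>B\<bar>"
      using c(2)[of x] by (intro mult_left_mono) auto
    then show ?thesis
      by (simp add: abs_mult mult.commute)
  qed
  ultimately have "integrable lebesgue (\<lambda>x. (indicator K x *\<^sub>R w x) * c x)"
    using i by (intro Bochner_Integration.integrable_bound[OF integrable_mult_right[OF i, of B]]
        borel_measurable_times borel_measurable_integrable[OF i]) auto
  moreover have "(\<lambda>x. (indicator K x *\<^sub>R w x) * c x) = (\<lambda>x. indicator S x *\<^sub>R (w x * c x))"
  proof
    show "(indicator K x *\<^sub>R w x) * c x = indicator S x *\<^sub>R (w x * c x)" for x
      using K c(3)[of x] by (cases "x \<in> K") (auto simp: indicator_def)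
  qed
  ultimately have "integrable lebesgue (\<lambda>x. indicator S x *\<^sub>R (w x * c x))"
    by (simp only:)
  then show ?thesis
    by (subst integrable_restrict_space) (use S in simp_all)
qed

section \<open>The fundamental lemma of the calculus of variations\<close>

lemma flat_1_bounds: "0 \<le> flat 1 t" "flat 1 t \<le> 1"
  by (auto simp: flat_def)

text \<open>As \<open>flat 1\<close> vanishes on the nonpositive numbers, its dilations increase to
  the indicator of the positive half-line.\<close>

lemma flat_1_tendsto:
  assumes "t > 0"
  shows "(\<lambda>k. flat 1 (real (Suc k) * t)) \<longlonglongrightarrow> 1"
proof -
  have "(\<lambda>k. exp (- (1 / real (Suc k) * (1 / t)))) \<longlonglongrightarrow> exp (- (0 * (1 / t)))"
    by (intro tendsto_intros LIMSEQ_Suc[OF lim_1_over_n])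
  then show ?thesis
    using assms by (simp add: flat_def)
qed

text \<open>The indicator of an open box is a pointwise limit of test functions with values in
  \<open>[0, 1]\<close> that vanish off the box, so dominated convergence carries the hypothesis
  over to it. Passing to the closed box only adds a null set.\<close>

lemma integral_box_eq_0:
  fixes w :: "'a::euclidean_space \<Rightarrow> real"
  assumes S: "open S" and w: "\<And>K. compact K \<Longrightarrow> K \<subseteq> S \<Longrightarrow> w absolutely_integrable_on K"
    and 0: "\<And>\<psi>. \<psi> \<in> test_functions S \<Longrightarrow> (LINT x|lebesgue_on S. w x * \<psi> x) = 0"
    and ab: "cbox a b \<subseteq> S"
  shows "integral (cbox a b) w = 0"
proof -
  have SL: "S \<in> sets lebesgue"
    using S by auto
  \<comment> \<open>Two factors per coordinate, one for each face of the box. The arguments are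
    spelled out as affine functions to fit \<open>cont_diff_flat\<close>; \<open>\<psi>_eq\<close>
    is the readable form.\<close>
  define \<psi> where "\<psi> k x = (\<Prod>i\<in>Basis. flat 1 (real (Suc k) * (x \<bullet> i) + - (real (Suc k) * (a \<bullet> i)))
      * flat 1 (- real (Suc k) * (x \<bullet> i) + real (Suc k) * (b \<bullet> i)))" for k x
  have \<psi>_eq: "\<psi> k x = (\<Prod>i\<in>Basis. flat 1 (real (Suc k) * (x \<bullet> i - a \<bullet> i))
      * flat 1 (real (Suc k) * (b \<bullet> i - x \<bullet> i)))" for k x
    unfolding \<psi>_def by (simp add: algebra_simps)
  have zero: "\<psi> k x = 0" if x: "x \<notin> box a b" for k x
  proof -
    obtain i where i: "i \<in> Basis" "\<not> (a \<bullet> i < x \<bullet> i \<and> x \<bullet> i < b \<bullet> i)"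
      using x unfolding mem_box by blast
    then have "flat 1 (real (Suc k) * (x \<bullet> i - a \<bullet> i)) * flat 1 (real (Suc k) * (b \<bullet> i - x \<bullet> i)) = 0"
      by (auto simp: flat_def zero_less_mult_iff)
    then show ?thesis
      unfolding \<psi>_eq using i(1) by (intro prod_zero) auto
  qed
  have bnd: "0 \<le> \<psi> k x \<and> \<psi> k x \<le> 1" for k x
    unfolding \<psi>_eq using flat_1_bounds by (auto intro!: prod_nonneg prod_le_1 mult_le_one)
  have smooth: "cont_diff m (\<psi> k)" for k m
    unfolding \<psi>_def by (intro cont_diff_prod cont_diff_mult cont_diff_flat) auto
  have T: "\<psi> k \<in> test_functions S" for k
    by (rule test_functionI[OF smooth compact_cbox ab]) (use zero box_subset_cbox in blast)
  have lim: "(\<lambda>k. \<psi> k x) \<longlonglongrightarrow> indicator (box a b) x" for x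
  proof (cases "x \<in> box a b")
    case True
    then have "(\<lambda>k. \<psi> k x) \<longlonglongrightarrow> (\<Prod>i\<in>(Basis::'a set). 1 * 1)"
      unfolding \<psi>_eq by (intro tendsto_prod tendsto_mult flat_1_tendsto) (auto simp: mem_box)
    then show ?thesis
      using True by simp
  next
    case False
    then show ?thesis
      by (simp add: zero)
  qed
  have wc: "w absolutely_integrable_on cbox a b"
    using w[OF compact_cbox ab] .
  have int: "integrable (lebesgue_on S) (\<lambda>x. w x * \<psi> k x)" for k
  proof (rule integrable_mult_compact_support[OF wc ab SL, where B = 1])
    show "\<psi> k \<in> borel_measurable borel"
      by (intro borel_measurable_continuous_onI test_function_continuous[OF T])
    show "\<psi> k x = 0" if "x \<notin> cbox a b" for x
      using zero that box_subset_cbox by blast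
  qed (use bnd in \<open>auto simp: abs_le_iff order_trans\<close>)
  have box: "integrable (lebesgue_on S) (\<lambda>x. w x * indicator (box a b) x)"
    "integrable (lebesgue_on S) (\<lambda>x. w x * indicator (cbox a b) x)"
    using box_subset_cbox[of a b]
    by (intro integrable_mult_compact_support[OF wc ab SL, where B = 1]; auto simp: indicator_def)+
  have "(\<lambda>k. LINT x|lebesgue_on S. w x * \<psi> k x) \<longlonglongrightarrow> (LINT x|lebesgue_on S. w x * indicator (box a b) x)"
  proof (rule integral_dominated_convergence[where w = "\<lambda>x. norm (w x * indicator (cbox a b) x)"])
    show "AE x in lebesgue_on S. (\<lambda>k. w x * \<psi> k x) \<longlonglongrightarrow> w x * indicator (box a b) x"
      by (intro AE_I2 tendsto_mult tendsto_const lim)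
    show "AE x in lebesgue_on S. norm (w x * \<psi> k x) \<le> norm (w x * indicator (cbox a b) x)" for k
    proof (intro AE_I2)
      fix x
      show "norm (w x * \<psi> k x) \<le> norm (w x * indicator (cbox a b) x)"
      proof (cases "x \<in> cbox a b")
        case True
        then show ?thesis
          using bnd[of k x] by (simp add: abs_mult mult_left_le)
      next
        case False
        then show ?thesis
          using zero box_subset_cbox[of a b] by auto
      qed
    qed
  qed (use int box in auto)
  then have "(LINT x|lebesgue_on S. w x * indicator (box a b) x) = 0"
    unfolding 0[OF T] by (simp add: LIMSEQ_const_iff)
  then have "(LINT x|lebesgue. indicator S x *\<^sub>R (w x * indicator (box a b) x)) = 0"
    using SL by (simp add: integral_restrict_space)
  moreover have "(\<lambda>x. indicator S x *\<^sub>R (w x * indicator (box a b) x)) = (\<lambda>x. indicator (box a b) x *\<^sub>R w x)"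
    using ab box_subset_cbox[of a b] by (auto simp: fun_eq_iff indicator_def)
  ultimately have "(LINT x:box a b|lebesgue. w x) = 0"
    unfolding set_lebesgue_integral_def by (simp only:)
  moreover have "set_integrable lebesgue (box a b) w"
    by (rule set_integrable_subset[OF wc]) (auto simp: box_subset_cbox)
  ultimately have "integral (box a b) w = 0"
    by (simp add: set_lebesgue_integral_eq_integral(2))
  then show ?thesis
    by (simp add: integral_open_interval)
qed

text \<open>The mean of \<open>w\<close> over every small cube is zero, and by Lebesgue
  differentiation these means converge to \<open>w\<close> almost everywhere. Working in one box at
  a time is enough, because countably many closed boxes cover \<open>S\<close>.\<close>

lemma fundamental_lemma_calculus_of_variations:
  fixes w :: "'a::euclidean_space \<Rightarrow> real"
  assumes S: "open S" and w: "\<And>K. compact K \<Longrightarrow> K \<subseteq> S \<Longrightarrow> w absolutely_integrable_on K"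
    and 0: "\<And>\<psi>. \<psi> \<in> test_functions S \<Longrightarrow> (LINT x|lebesgue_on S. w x * \<psi> x) = 0"
  shows "AE x in lebesgue_on S. w x = 0"
proof -
  have box: "negligible {x \<in> cbox a b. w x \<noteq> 0}" if ab: "cbox a b \<subseteq> S" for a b
  proof -
    \<comment> \<open>The differentiation theorem wants a function integrable on every box, whereas
      \<open>w\<close> is controlled only inside \<open>S\<close>; hence the truncation.\<close>
    define W where "W x = (if x \<in> cbox a b then w x else 0)" for x
    have "W integrable_on cbox c d" for c d
    proof -
      have "w integrable_on cbox a b"
        using w[OF compact_cbox ab] by (rule set_lebesgue_integral_eq_integral(1))
      then have "w integrable_on (cbox a b \<inter> cbox c d)"
        unfolding Int_interval by (rule integrable_on_subcbox) (auto simp: Int_interval[symmetric])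
      then show ?thesis
        unfolding W_def by (simp only: integrable_restrict_Int)
    qed
    then obtain N where N: "negligible N" "\<And>x e. \<lbrakk>x \<notin> N; 0 < e\<rbrakk> \<Longrightarrow> \<exists>d>0. \<forall>h. 0 < h \<and> h < d \<longrightarrow>
        norm (integral (cbox x (x + h *\<^sub>R One)) W /\<^sub>R h ^ DIM('a) - W x) < e"
      using integrable_ccontinuous_explicit[of W] by blast
    have "w x = 0" if x: "x \<in> box a b" "x \<notin> N" for x
    proof (rule ccontr)
      assume "w x \<noteq> 0"
      then obtain d where d: "d > 0" "\<And>h. 0 < h \<Longrightarrow> h < d \<Longrightarrow>
          norm (integral (cbox x (x + h *\<^sub>R One)) W /\<^sub>R h ^ DIM('a) - W x) < \<bar>w x\<bar>"
        using N(2)[OF x(2), of "\<bar>w x\<bar>"] by auto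
      \<comment> \<open>For \<open>x\<close> in the open box the cubes with corner \<open>x\<close>
        eventually stay inside, where \<open>W\<close> and \<open>w\<close> agree. Points on the
        faces form a negligible set.\<close>
      have "((\<lambda>h. x + h *\<^sub>R One) \<longlongrightarrow> x + 0 *\<^sub>R One) (at_right 0)"
        by (intro tendsto_intros)
      then have "\<forall>\<^sub>F h in at_right 0. x + h *\<^sub>R One \<in> box a b"
        using x(1) by (intro topological_tendstoD) (auto simp: open_box)
      then have "\<forall>\<^sub>F h in at_right 0. x + h *\<^sub>R One \<in> box a b \<and> h < d \<and> 0 < h"
        using eventually_at_right_real[OF d(1)] by eventually_elim auto
      then obtain h where h: "x + h *\<^sub>R One \<in> box a b" "0 < h" "h < d"
        using eventually_happens'[OF trivial_limit_at_right_real] by blast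
      have sub: "cbox x (x + h *\<^sub>R One) \<subseteq> box a b"
        using x(1) h(1) unfolding subset_iff mem_box by (meson le_less_trans less_le_trans)
      then have "cbox x (x + h *\<^sub>R One) \<subseteq> cbox a b"
        using box_subset_cbox by blast
      then have "integral (cbox x (x + h *\<^sub>R One)) W = integral (cbox x (x + h *\<^sub>R One)) w"
        by (intro integral_cong) (auto simp: W_def)
      also have "\<dots> = 0"
        using \<open>cbox x (x + h *\<^sub>R One) \<subseteq> cbox a b\<close> ab
        by (intro integral_box_eq_0[OF S w 0]) auto
      finally have "norm (W x) < \<bar>w x\<bar>"
        using d(2)[OF h(2,3)] by simp
      moreover have "W x = w x"
        using x(1) box_subset_cbox[of a b] by (auto simp: W_def)
      ultimately show False
        by simp
    qed
    then have "{x \<in> cbox a b. w x \<noteq> 0} \<subseteq> N \<union> (cbox a b - box a b)"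
      by blast
    then show ?thesis
      using negligible_Un[OF N(1) negligible_frontier_interval] by (rule negligible_subset[rotated])
  qed
  obtain \<D> where D: "countable \<D>" "\<D> \<subseteq> Pow S" "\<And>X. X \<in> \<D> \<Longrightarrow> \<exists>a b. X = cbox a b" "\<Union>\<D> = S"
    using open_countable_Union_open_cbox[OF S] by blast
  have "negligible (\<Union>X\<in>\<D>. {x \<in> X. w x \<noteq> 0})"
  proof (rule negligible_countable_Union)
    show "countable ((\<lambda>X. {x \<in> X. w x \<noteq> 0}) ` \<D>)"
      using D(1) by simp
    fix T assume "T \<in> (\<lambda>X. {x \<in> X. w x \<noteq> 0}) ` \<D>"
    then obtain X where X: "X \<in> \<D>" "T = {x \<in> X. w x \<noteq> 0}"
      by blast
    then obtain a b where "X = cbox a b"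
      using D(3) by blast
    then show "negligible T"
      using X D(2) box[of a b] by auto
  qed
  moreover have "(\<Union>X\<in>\<D>. {x \<in> X. w x \<noteq> 0}) = {x \<in> S. w x \<noteq> 0}"
    using D(4) by blast
  ultimately have "{x \<in> S. w x \<noteq> 0} \<in> null_sets lebesgue"
    by (simp add: negligible_iff_null_sets)
  then have "AE x in lebesgue. x \<in> S \<longrightarrow> w x = 0"
    by (rule AE_I') auto
  then show ?thesis
    using S by (subst AE_restrict_space_iff) auto
qed

text \<open>Splitting an integral of a sum requires both parts to be integrable, and a weak gradient
  is by definition integrable only on compact sets; the support of the test function supplies such a
  set.\<close>

lemma weak_gradient_integrable:
  fixes S :: "'a::euclidean_space set"
  assumes "open S" "is_weak_gradient S u w" "\<psi> \<in> test_functions S" "b \<in> Basis"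
  shows "integrable (lebesgue_on S) (\<lambda>x. u x * frechet_derivative \<psi> (at x) b)"
    and "integrable (lebesgue_on S) (\<lambda>x. (w x \<bullet> b) * \<psi> x)"
proof -
  have *: "integrable (lebesgue_on S) (\<lambda>x. h x * \<zeta> x)"
    if \<zeta>: "\<zeta> \<in> test_functions S" and h: "\<And>K. compact K \<Longrightarrow> K \<subseteq> S \<Longrightarrow> h absolutely_integrable_on K"
    for h \<zeta> :: "'a \<Rightarrow> real"
  proof -
    obtain K where K: "compact K" "K \<subseteq> S" "\<And>x. x \<notin> K \<Longrightarrow> \<zeta> x = 0"
      using test_functionE[OF \<zeta>] by blast
    obtain B where B: "B > 0" "\<And>x. \<bar>\<zeta> x\<bar> \<le> B"
      using test_function_bounded[OF \<zeta>] by blast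
    show ?thesis
      using assms(1) by (intro integrable_mult_compact_support[OF h[OF K(1,2)] K(2) _ _ B(2) K(3)]
          borel_measurable_continuous_onI test_function_continuous[OF \<zeta>]) auto
  qed
  show "integrable (lebesgue_on S) (\<lambda>x. u x * frechet_derivative \<psi> (at x) b)"
    using assms(2) by (intro * test_function_partial assms(3,4)) (auto simp: is_weak_gradient_def)
  show "integrable (lebesgue_on S) (\<lambda>x. (w x \<bullet> b) * \<psi> x)"
    using assms(2) by (intro * assms(3) absolutely_integrable_component) (auto simp: is_weak_gradient_def)
qed

lemma is_weak_gradient_add:
  fixes S :: "'a::euclidean_space set"
  assumes "open S" "is_weak_gradient S u w" "is_weak_gradient S u' w'"
  shows "is_weak_gradient S (\<lambda>x. u x + u' x) (\<lambda>x. w x + w' x)"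
  unfolding is_weak_gradient_def
proof (intro conjI allI impI ballI)
  fix \<psi> :: "'a \<Rightarrow> real" and b :: 'a
  assume \<psi>: "\<psi> \<in> test_functions S" "b \<in> Basis"
  note int = weak_gradient_integrable[OF assms(1) _ \<psi>]
  show "(LINT x|lebesgue_on S. (u x + u' x) * frechet_derivative \<psi> (at x) b)
      = - (LINT x|lebesgue_on S. ((w x + w' x) \<bullet> b) * \<psi> x)"
    using int[OF assms(2)] int[OF assms(3)] assms(2,3) \<psi>
    by (simp add: inner_add_left distrib_right is_weak_gradient_def)
qed (use assms in \<open>auto simp: is_weak_gradient_def intro!: set_integral_add\<close>)

lemma is_weak_gradient_cmult:
  assumes "is_weak_gradient S u w"
  shows "is_weak_gradient S (\<lambda>x. c * u x) (\<lambda>x. c *\<^sub>R w x)"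
  unfolding is_weak_gradient_def
proof (intro conjI allI impI ballI)
  show "(LINT x|lebesgue_on S. c * u x * frechet_derivative \<psi> (at x) b)
      = - (LINT x|lebesgue_on S. ((c *\<^sub>R w x) \<bullet> b) * \<psi> x)"
    if "\<psi> \<in> test_functions S" "b \<in> Basis" for \<psi> b
    using assms that by (simp add: mult.assoc is_weak_gradient_def)
  show "(\<lambda>x. c * u x) absolutely_integrable_on K" "(\<lambda>x. c *\<^sub>R w x) absolutely_integrable_on K"
    if "compact K \<and> K \<subseteq> S" for K
    using assms that unfolding is_weak_gradient_def
    by (intro set_integrable_mult_right set_integrable_scaleR_right; blast)+
qed

text \<open>Every component of the difference integrates to zero against all test functions, so the
  fundamental lemma applies to each component.\<close>

lemma is_weak_gradient_unique:
  assumes S: "open S" and w: "is_weak_gradient S u w" "is_weak_gradient S u w'"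
  shows "AE x in lebesgue_on S. w x = w' x"
proof -
  have "AE x in lebesgue_on S. (w x - w' x) \<bullet> b = 0" if b: "b \<in> Basis" for b
  proof (rule fundamental_lemma_calculus_of_variations[OF S])
    show "(\<lambda>x. (w x - w' x) \<bullet> b) absolutely_integrable_on K" if "compact K" "K \<subseteq> S" for K
      using w that unfolding is_weak_gradient_def
      by (intro absolutely_integrable_component set_integral_diff) auto
    show "(LINT x|lebesgue_on S. (w x - w' x) \<bullet> b * \<psi> x) = 0" if \<psi>: "\<psi> \<in> test_functions S" for \<psi>
    proof -
      have "(LINT x|lebesgue_on S. (w x \<bullet> b) * \<psi> x) = (LINT x|lebesgue_on S. (w' x \<bullet> b) * \<psi> x)"
        using w[unfolded is_weak_gradient_def, THEN conjunct2, rule_format, OF \<psi> b] by simp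
      then show ?thesis
        using weak_gradient_integrable(2)[OF S w(1) \<psi> b] weak_gradient_integrable(2)[OF S w(2) \<psi> b]
        by (simp add: inner_diff_left left_diff_distrib)
    qed
  qed
  then have "AE x in lebesgue_on S. \<forall>b\<in>Basis. (w x - w' x) \<bullet> b = 0"
    by (intro AE_finite_allI) auto
  then show ?thesis
    by eventually_elim (rule euclidean_eqI, simp add: inner_diff_left)
qed

text \<open>The classical gradient. On test functions it is a continuous representative of
  \<open>weak_gradient\<close>, which is itself only an arbitrary choice.\<close>

definition grad :: "('a::euclidean_space \<Rightarrow> real) \<Rightarrow> 'a \<Rightarrow> 'a" where
  "grad \<psi> x = (\<Sum>b\<in>Basis. frechet_derivative \<psi> (at x) b *\<^sub>R b)"

lemma grad_inner: "b \<in> Basis \<Longrightarrow> grad \<psi> x \<bullet> b = frechet_derivative \<psi> (at x) b"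
  unfolding grad_def by (rule inner_sum_left_Basis)

lemma continuous_absolutely_integrable_compact:
  fixes h :: "'a::euclidean_space \<Rightarrow> 'b::euclidean_space"
  assumes "compact K" "continuous_on K h"
  shows "h absolutely_integrable_on K"
proof -
  have "integrable lborel (\<lambda>x. indicator K x *\<^sub>R h x)"
    using assms by (rule borel_integrable_compact)
  then show ?thesis
    unfolding set_integrable_def
    by (subst integrable_completion) (auto dest: borel_measurable_integrable)
qed

lemma continuous_on_grad:
  "\<psi> \<in> test_functions S \<Longrightarrow> continuous_on T (grad \<psi>)"
  unfolding grad_def
  by (intro continuous_intros test_function_continuous[OF test_function_partial])

text \<open>Integration by parts without boundary: the product \<open>\<psi> \<zeta>\<close> has
  compact support, so its partial derivative \<open>P + Q\<close> integrates to zero.\<close>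

lemma is_weak_gradient_test_function:
  fixes S :: "'a::euclidean_space set"
  assumes "open S" "\<psi> \<in> test_functions S"
  shows "is_weak_gradient S \<psi> (grad \<psi>)"
  unfolding is_weak_gradient_def
proof (intro conjI allI impI ballI)
  fix \<zeta> :: "'a \<Rightarrow> real" and b :: 'a
  assume \<zeta>: "\<zeta> \<in> test_functions S" and b: "b \<in> Basis"
  define P where "P x = \<psi> x * frechet_derivative \<zeta> (at x) b" for x
  define Q where "Q x = frechet_derivative \<psi> (at x) b * \<zeta> x" for x
  have PQ: "P \<in> test_functions S" "Q \<in> test_functions S"
    unfolding P_def Q_def
    by (rule test_function_mult[OF test_function_cont_diff[OF assms(2)] test_function_partial[OF \<zeta> b]]
        test_function_mult[OF test_function_cont_diff[OF test_function_partial[OF assms(2) b]] \<zeta>])+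
  have F: "(\<lambda>x. \<psi> x * \<zeta> x) \<in> test_functions UNIV"
    using test_functions_mono[of S UNIV] test_function_mult[OF test_function_cont_diff[OF assms(2)] \<zeta>]
    by blast
  have "frechet_derivative (\<lambda>x. \<psi> x * \<zeta> x) (at x) b = P x + Q x" for x
    using frechet_derivative_at[OF has_derivative_mult[OF test_function_has_derivative[OF assms(2)]
          test_function_has_derivative[OF \<zeta>]], of x, symmetric]
    by (simp add: P_def Q_def)
  then have "(LINT x|lborel. P x + Q x) = 0"
    using integral_partial_test_function[OF F b] by simp
  then have "(LINT x|lborel. P x) = - (LINT x|lborel. Q x)"
    using PQ by (simp add: test_function_integrable)
  moreover note integral_test_function_lebesgue_on[OF assms(1) PQ(1)]
    integral_test_function_lebesgue_on[OF assms(1) PQ(2)]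
  ultimately show "(LINT x|lebesgue_on S. \<psi> x * frechet_derivative \<zeta> (at x) b)
      = - (LINT x|lebesgue_on S. (grad \<psi> x \<bullet> b) * \<zeta> x)"
    by (simp add: grad_inner[OF b] flip: P_def Q_def)
qed (use assms in \<open>auto intro!: continuous_absolutely_integrable_compact test_function_continuous
        continuous_on_grad\<close>)

section \<open>Square integrable functions\<close>

lemma L2D:
  assumes "u \<in> L2 M"
  shows "u \<in> borel_measurable M" "integrable M (\<lambda>x. (norm (u x))\<^sup>2)"
  using assms by (simp_all add: L2_def)

lemma L2_norm_nonneg: "0 \<le> L2_norm M u"
  by (simp add: L2_norm_def)

lemma L2_norm_power2: "(L2_norm M u)\<^sup>2 = (LINT x|M. (norm (u x))\<^sup>2)"
  by (simp add: L2_norm_def)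

lemma L2_bound:
  assumes "u \<in> borel_measurable M" "integrable M h" "AE x in M. (norm (u x))\<^sup>2 \<le> h x"
  shows "u \<in> L2 M"
proof -
  have "integrable M (\<lambda>x. (norm (u x))\<^sup>2)"
    by (rule Bochner_Integration.integrable_bound[OF assms(2)])
      (use assms in \<open>auto elim!: eventually_mono\<close>)
  then show ?thesis
    using assms(1) by (simp add: L2_def)
qed

lemma L2_add:
  assumes "u \<in> L2 M" "v \<in> L2 M"
  shows "(\<lambda>x. u x + v x) \<in> L2 M"
proof (rule L2_bound)
  show "integrable M (\<lambda>x. 2 * (norm (u x))\<^sup>2 + 2 * (norm (v x))\<^sup>2)"
    using assms[THEN L2D(2)] by simp
  show "AE x in M. (norm (u x + v x))\<^sup>2 \<le> 2 * (norm (u x))\<^sup>2 + 2 * (norm (v x))\<^sup>2"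
  proof (rule AE_I2)
    fix x
    have "(norm (u x + v x))\<^sup>2 \<le> (norm (u x) + norm (v x))\<^sup>2"
      by (intro power_mono norm_triangle_ineq) auto
    also have "\<dots> \<le> 2 * (norm (u x))\<^sup>2 + 2 * (norm (v x))\<^sup>2"
      using sum_squares_bound[of "norm (u x)" "norm (v x)"] by (simp add: power2_sum)
    finally show "(norm (u x + v x))\<^sup>2 \<le> 2 * (norm (u x))\<^sup>2 + 2 * (norm (v x))\<^sup>2" .
  qed
qed (use assms[THEN L2D(1)] in simp)

lemma L2_mult_bounded:
  assumes "u \<in> L2 M" "c \<in> borel_measurable M" "AE x in M. \<bar>c x\<bar> \<le> B"
  shows "(\<lambda>x. c x *\<^sub>R u x) \<in> L2 M"
proof (rule L2_bound)
  show "integrable M (\<lambda>x. B\<^sup>2 * (norm (u x))\<^sup>2)"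
    using L2D(2)[OF assms(1)] by simp
  show "AE x in M. (norm (c x *\<^sub>R u x))\<^sup>2 \<le> B\<^sup>2 * (norm (u x))\<^sup>2"
    using assms(3)
  proof eventually_elim
    case (elim x)
    then have "(c x)\<^sup>2 \<le> B\<^sup>2"
      by (intro abs_le_square_iff[THEN iffD1]) auto
    then show ?case
      by (simp add: power_mult_distrib mult_right_mono)
  qed
qed (use L2D(1)[OF assms(1)] assms(2) in simp)

lemma L2_scaleR: "u \<in> L2 M \<Longrightarrow> (\<lambda>x. c *\<^sub>R u x) \<in> L2 M"
  by (rule L2_mult_bounded[where B = "\<bar>c\<bar>"]) auto

lemma L2_cmult: "u \<in> L2 M \<Longrightarrow> (\<lambda>x. c * u x :: real) \<in> L2 M"
  using L2_scaleR[of u M c] by simp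

lemma L2_diff: "u \<in> L2 M \<Longrightarrow> v \<in> L2 M \<Longrightarrow> (\<lambda>x. u x - v x) \<in> L2 M"
  using L2_add[of u M "\<lambda>x. - 1 *\<^sub>R v x"] L2_scaleR[of v M "- 1"] by simp

lemma L2_abs: "u \<in> L2 M \<Longrightarrow> (\<lambda>x. \<bar>u x\<bar> :: real) \<in> L2 M"
  unfolding L2_def by auto

lemma L2_norm_cong_AE:
  assumes "u \<in> borel_measurable M" "v \<in> borel_measurable M" "AE x in M. u x = v x"
  shows "L2_norm M u = L2_norm M v"
  unfolding L2_norm_def using assms
  by (intro arg_cong[where f = sqrt] integral_cong_AE) (auto elim!: eventually_mono)

lemma L2_norm_mono_AE:
  assumes "u \<in> borel_measurable M" "v \<in> L2 M" "AE x in M. norm (u x) \<le> norm (v x)"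
  shows "L2_norm M u \<le> L2_norm M v"
proof -
  have le: "AE x in M. (norm (u x))\<^sup>2 \<le> (norm (v x))\<^sup>2"
    using assms(3) by eventually_elim (simp add: power_mono)
  have "u \<in> L2 M"
    by (rule L2_bound[OF assms(1) L2D(2)[OF assms(2)] le])
  then show ?thesis
    unfolding L2_norm_def
    by (intro real_sqrt_le_mono integral_mono_AE L2D(2) assms(2) le)
qed

lemma L2_norm_scaleR: "L2_norm M (\<lambda>x. c *\<^sub>R u x) = \<bar>c\<bar> * L2_norm M u"
  by (simp add: L2_norm_def power_mult_distrib real_sqrt_mult)

lemma L2_norm_minus_commute: "L2_norm M (\<lambda>x. u x - v x) = L2_norm M (\<lambda>x. v x - u x)"
  by (simp add: L2_norm_def norm_minus_commute)

lemma L2_integrable_norm_mult: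
  assumes "u \<in> L2 M" "v \<in> L2 M"
  shows "integrable M (\<lambda>x. norm (u x) * norm (v x))"
proof (rule Bochner_Integration.integrable_bound)
  show "integrable M (\<lambda>x. (norm (u x))\<^sup>2 + (norm (v x))\<^sup>2)"
    using assms[THEN L2D(2)] by simp
  show "AE x in M. norm (norm (u x) * norm (v x)) \<le> norm ((norm (u x))\<^sup>2 + (norm (v x))\<^sup>2)"
  proof (rule AE_I2)
    fix x
    have "2 * (norm (u x) * norm (v x)) \<le> (norm (u x))\<^sup>2 + (norm (v x))\<^sup>2"
      using sum_squares_bound[of "norm (u x)" "norm (v x)"] by (simp add: mult.assoc)
    moreover have "0 \<le> norm (u x) * norm (v x)"
      by simp
    ultimately have "norm (u x) * norm (v x) \<le> (norm (u x))\<^sup>2 + (norm (v x))\<^sup>2"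
      by linarith
    then show "norm (norm (u x) * norm (v x)) \<le> norm ((norm (u x))\<^sup>2 + (norm (v x))\<^sup>2)"
      by simp
  qed
qed (use assms[THEN L2D(1)] in simp)

text \<open>Integrate the weighted inequality \<open>2 s t \<le> (B/A) s^2 + (A/B) t^2\<close> with
  \<open>A\<close> and \<open>B\<close> slightly above the two norms. The excess \<open>e\<close>
  avoids dividing by a vanishing norm and is then sent to zero.\<close>

lemma L2_Cauchy_Schwarz:
  assumes "u \<in> L2 M" "v \<in> L2 M"
  shows "(LINT x|M. norm (u x) * norm (v x)) \<le> L2_norm M u * L2_norm M v"
proof -
  have le: "(LINT x|M. norm (u x) * norm (v x)) \<le> (L2_norm M u + e) * (L2_norm M v + e)" if "e > 0" for e
  proof -
    define A B where "A = L2_norm M u + e" and "B = L2_norm M v + e"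
    have pos: "A > 0" "B > 0"
      using that L2_norm_nonneg[of M u] L2_norm_nonneg[of M v] by (auto simp: A_def B_def)
    have sq: "(L2_norm M u)\<^sup>2 \<le> A\<^sup>2" "(L2_norm M v)\<^sup>2 \<le> B\<^sup>2"
      using that L2_norm_nonneg by (auto simp: A_def B_def intro!: power_mono)
    have "2 * (norm (u x) * norm (v x)) \<le> B / A * (norm (u x))\<^sup>2 + A / B * (norm (v x))\<^sup>2" for x
    proof -
      have "0 \<le> (B * norm (u x) - A * norm (v x))\<^sup>2 / (A * B)"
        using pos by simp
      then show ?thesis
        using pos by (simp add: power2_eq_square field_simps)
    qed
    then have "(LINT x|M. 2 * (norm (u x) * norm (v x)))
        \<le> (LINT x|M. B / A * (norm (u x))\<^sup>2 + A / B * (norm (v x))\<^sup>2)"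
      using L2_integrable_norm_mult[OF assms] assms[THEN L2D(2)]
      by (intro integral_mono) auto
    also have "\<dots> = B / A * (L2_norm M u)\<^sup>2 + A / B * (L2_norm M v)\<^sup>2"
      using assms[THEN L2D(2)] by (simp add: L2_norm_power2)
    also have "\<dots> \<le> B / A * A\<^sup>2 + A / B * B\<^sup>2"
      using pos sq by (intro add_mono mult_left_mono) auto
    also have "\<dots> = 2 * (A * B)"
      using pos by (simp add: power2_eq_square)
    finally show ?thesis
      by (simp add: A_def B_def)
  qed
  have "((\<lambda>e. (L2_norm M u + e) * (L2_norm M v + e)) \<longlongrightarrow> (L2_norm M u + 0) * (L2_norm M v + 0)) (at_right 0)"
    by (intro tendsto_intros)
  then show ?thesis
    by (intro tendsto_lowerbound[where F = "at_right (0::real)"])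
      (use le in \<open>auto simp: eventually_at_filter\<close>)
qed

lemma L2_inner:
  assumes "u \<in> L2 M" "v \<in> L2 M"
  shows "integrable M (\<lambda>x. u x \<bullet> v x)" "\<bar>LINT x|M. u x \<bullet> v x\<bar> \<le> L2_norm M u * L2_norm M v"
proof -
  show i: "integrable M (\<lambda>x. u x \<bullet> v x)"
    by (rule Bochner_Integration.integrable_bound[OF L2_integrable_norm_mult[OF assms]])
      (use assms[THEN L2D(1)] Cauchy_Schwarz_ineq2 in \<open>auto simp: abs_mult\<close>)
  have "norm (LINT x|M. u x \<bullet> v x) \<le> (LINT x|M. norm (u x) * norm (v x))"
    by (rule order_trans[OF integral_norm_bound integral_mono])
      (use i L2_integrable_norm_mult[OF assms] Cauchy_Schwarz_ineq2 in auto)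
  then show "\<bar>LINT x|M. u x \<bullet> v x\<bar> \<le> L2_norm M u * L2_norm M v"
    using L2_Cauchy_Schwarz[OF assms] by simp
qed

lemma L2_mult:
  fixes u v :: "'a \<Rightarrow> real"
  assumes "u \<in> L2 M" "v \<in> L2 M"
  shows "integrable M (\<lambda>x. u x * v x)" "\<bar>LINT x|M. u x * v x\<bar> \<le> L2_norm M u * L2_norm M v"
  using L2_inner[OF assms] by simp_all

lemma L2_norm_triangle:
  assumes "u \<in> L2 M" "v \<in> L2 M"
  shows "L2_norm M (\<lambda>x. u x + v x) \<le> L2_norm M u + L2_norm M v"
proof (rule power2_le_imp_le)
  have "(L2_norm M (\<lambda>x. u x + v x))\<^sup>2
      = (LINT x|M. (norm (u x))\<^sup>2 + 2 * (u x \<bullet> v x) + (norm (v x))\<^sup>2)"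
    unfolding L2_norm_power2
    by (simp add: power2_norm_eq_inner inner_add_left inner_add_right inner_commute algebra_simps)
  also have "\<dots> = (L2_norm M u)\<^sup>2 + 2 * (LINT x|M. u x \<bullet> v x) + (L2_norm M v)\<^sup>2"
    using assms[THEN L2D(2)] L2_inner(1)[OF assms] by (simp add: L2_norm_power2)
  also have "\<dots> \<le> (L2_norm M u + L2_norm M v)\<^sup>2"
    using L2_inner(2)[OF assms] by (simp add: power2_sum)
  finally show "(L2_norm M (\<lambda>x. u x + v x))\<^sup>2 \<le> (L2_norm M u + L2_norm M v)\<^sup>2" .
qed (simp add: L2_norm_nonneg)

lemma L2_norm_triangle_diff:
  assumes "u \<in> L2 M" "v \<in> L2 M" "w \<in> L2 M"
  shows "L2_norm M (\<lambda>x. u x - w x) \<le> L2_norm M (\<lambda>x. u x - v x) + L2_norm M (\<lambda>x. v x - w x)"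
  using L2_norm_triangle[OF L2_diff[OF assms(1,2)] L2_diff[OF assms(2,3)]] by simp

lemma L2_norm_le_diff:
  assumes "u \<in> L2 M" "v \<in> L2 M"
  shows "L2_norm M u \<le> L2_norm M v + L2_norm M (\<lambda>x. u x - v x)"
  using L2_norm_triangle[OF assms(2) L2_diff[OF assms]] by simp

lemma L2_norm_eq_0_AE:
  assumes "u \<in> L2 M" "L2_norm M u = 0"
  shows "AE x in M. u x = 0"
proof -
  have "(LINT x|M. (norm (u x))\<^sup>2) = 0"
    using assms(2) L2_norm_power2[of M u] by simp
  then show ?thesis
    using L2D(2)[OF assms(1)] by (simp add: integral_nonneg_eq_0_iff_AE)
qed

lemma L2_norm_0_AE:
  assumes "AE x in M. u x = 0" "u \<in> borel_measurable M"
  shows "L2_norm M u = 0"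
  using L2_norm_cong_AE[OF assms(2) _ assms(1)] by (simp add: L2_norm_def)

section \<open>The spaces \<open>H\<^sup>1\<close> and \<open>H\<^sup>1\<^sub>0\<close>\<close>

text \<open>Rests on the completeness of Lebesgue measure. It is what makes
  \<open>weak_gradient\<close>, known only up to null sets, measurable.\<close>

lemma borel_measurable_lebesgue_on_AE:
  fixes f g :: "'a::euclidean_space \<Rightarrow> 'b::euclidean_space"
  assumes "f \<in> borel_measurable (lebesgue_on S)" "AE x in lebesgue_on S. f x = g x" "S \<in> sets lebesgue"
  shows "g \<in> borel_measurable (lebesgue_on S)"
proof -
  obtain N where N: "N \<in> null_sets (lebesgue_on S)" "{x \<in> space (lebesgue_on S). f x \<noteq> g x} \<subseteq> N"
    using assms(2) unfolding eventually_ae_filter by auto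
  have "f \<in> borel_measurable (lebesgue_on (S - N))"
    using borel_measurable_diff_null[OF N(1) assms(3)] assms(1) by blast
  then have "g \<in> borel_measurable (lebesgue_on (S - N))"
    by (rule measurable_cong[THEN iffD1, rotated]) (use N(2) in auto)
  then show ?thesis
    using borel_measurable_diff_null[OF N(1) assms(3)] by blast
qed

lemma L2_cong_AE:
  assumes "u \<in> L2 (lebesgue_on S)" "AE x in lebesgue_on S. u x = v x" "S \<in> sets lebesgue"
  shows "v \<in> L2 (lebesgue_on S)"
  by (rule L2_bound[OF borel_measurable_lebesgue_on_AE[OF L2D(1)[OF assms(1)] assms(2,3)] L2D(2)[OF assms(1)]])
    (use assms(2) in \<open>auto elim!: eventually_mono\<close>)

lemma is_weak_gradient_weak_gradient:
  assumes "u \<in> H1 S"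
  shows "is_weak_gradient S u (weak_gradient S u)"
  using assms someI_ex[of "is_weak_gradient S u"] unfolding H1_def weak_gradient_def by blast

lemma weak_gradient_eq_AE:
  assumes "open S" "is_weak_gradient S u w"
  shows "AE x in lebesgue_on S. weak_gradient S u x = w x"
proof -
  have "is_weak_gradient S u (weak_gradient S u)"
    unfolding weak_gradient_def using someI[of "is_weak_gradient S u", OF assms(2)] .
  then show ?thesis
    by (rule is_weak_gradient_unique[OF assms(1) _ assms(2)])
qed

text \<open>\<open>weak_gradient\<close> chooses some weak gradient, which need not be the square
  integrable one that membership in \<open>H1\<close> provides; uniqueness almost everywhere closes
  the gap.\<close>

lemma H1_L2:
  assumes "open S" "u \<in> H1 S"
  shows "u \<in> L2 (lebesgue_on S)" "weak_gradient S u \<in> L2 (lebesgue_on S)"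
proof -
  show "u \<in> L2 (lebesgue_on S)"
    using assms(2) by (simp add: H1_def)
  obtain w where w: "w \<in> L2 (lebesgue_on S)" "is_weak_gradient S u w"
    using assms(2) by (auto simp: H1_def)
  then show "weak_gradient S u \<in> L2 (lebesgue_on S)"
    using weak_gradient_eq_AE[OF assms(1) w(2)] assms(1)
    by (intro L2_cong_AE[OF w(1)]) (auto elim!: eventually_mono)
qed

lemma H1_lincomb:
  assumes "open S" "u \<in> H1 S" "v \<in> H1 S"
  shows "(\<lambda>x. u x + c * v x) \<in> H1 S"
    and "AE x in lebesgue_on S. weak_gradient S (\<lambda>x. u x + c * v x) x
      = weak_gradient S u x + c *\<^sub>R weak_gradient S v x"
proof -
  have g: "is_weak_gradient S (\<lambda>x. u x + c * v x) (\<lambda>x. weak_gradient S u x + c *\<^sub>R weak_gradient S v x)"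
    by (rule is_weak_gradient_add[OF assms(1) is_weak_gradient_weak_gradient[OF assms(2)]
          is_weak_gradient_cmult[OF is_weak_gradient_weak_gradient[OF assms(3)]]])
  moreover have "(\<lambda>x. u x + c * v x) \<in> L2 (lebesgue_on S)"
      "(\<lambda>x. weak_gradient S u x + c *\<^sub>R weak_gradient S v x) \<in> L2 (lebesgue_on S)"
    by (rule L2_add[OF H1_L2(1)[OF assms(1,2)] L2_cmult[OF H1_L2(1)[OF assms(1,3)]]]
        L2_add[OF H1_L2(2)[OF assms(1,2)] L2_scaleR[OF H1_L2(2)[OF assms(1,3)]]])+
  ultimately show "(\<lambda>x. u x + c * v x) \<in> H1 S"
    unfolding H1_def by blast
  show "AE x in lebesgue_on S. weak_gradient S (\<lambda>x. u x + c * v x) x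
      = weak_gradient S u x + c *\<^sub>R weak_gradient S v x"
    by (rule weak_gradient_eq_AE[OF assms(1) g])
qed

lemma H1_diff:
  assumes "open S" "u \<in> H1 S" "v \<in> H1 S"
  shows "(\<lambda>x. u x - v x) \<in> H1 S"
    and "AE x in lebesgue_on S. weak_gradient S (\<lambda>x. u x - v x) x = weak_gradient S u x - weak_gradient S v x"
  using H1_lincomb[OF assms, of "- 1"] by simp_all

lemma L2_norm_le_H1_norm:
  "L2_norm (lebesgue_on S) u \<le> H1_norm S u"
  "L2_norm (lebesgue_on S) (weak_gradient S u) \<le> H1_norm S u"
  unfolding H1_norm_def by (simp_all add: real_le_rsqrt)

section \<open>Test functions in the Sobolev spaces and approximation in \<open>H10\<close>\<close>

lemma L2_continuous_compact_support:
  fixes h :: "'a::euclidean_space \<Rightarrow> 'b::euclidean_space"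
  assumes "continuous_on UNIV h" "compact K" "\<And>x. x \<notin> K \<Longrightarrow> h x = 0" "K \<subseteq> S" "S \<in> sets lebesgue"
  shows "h \<in> L2 (lebesgue_on S)"
proof -
  have "(\<lambda>x. (norm (h x))\<^sup>2) absolutely_integrable_on K"
    using assms(1,2) by (intro continuous_absolutely_integrable_compact continuous_intros)
      (auto intro: continuous_on_subset)
  then have "integrable lebesgue (\<lambda>x. indicator K x *\<^sub>R (norm (h x))\<^sup>2)"
    unfolding set_integrable_def .
  moreover have "(\<lambda>x. indicator K x *\<^sub>R (norm (h x))\<^sup>2) = (\<lambda>x. indicator S x *\<^sub>R (norm (h x))\<^sup>2)"
    using assms(3,4) by (auto simp: fun_eq_iff indicator_def)
  ultimately have "integrable (lebesgue_on S) (\<lambda>x. (norm (h x))\<^sup>2)"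
    using assms(5) by (simp add: integrable_restrict_space)
  moreover have "h \<in> borel_measurable (lebesgue_on S)"
    using assms(1) by (intro measurable_restrict_space1 measurable_completion)
      (simp add: borel_measurable_continuous_onI)
  ultimately show ?thesis
    by (simp add: L2_def)
qed

lemma test_function_L2:
  assumes "open S" "\<psi> \<in> test_functions S"
  shows "\<psi> \<in> L2 (lebesgue_on S)" "grad \<psi> \<in> L2 (lebesgue_on S)"
proof -
  have *: "\<phi> \<in> L2 (lebesgue_on S)" if \<phi>: "\<phi> \<in> test_functions S" for \<phi>
  proof -
    obtain K where K: "compact K" "K \<subseteq> S" "\<And>x. x \<notin> K \<Longrightarrow> \<phi> x = 0"
      using test_functionE[OF \<phi>] by blast
    show ?thesis
      using assms(1) by (intro L2_continuous_compact_support[OF test_function_continuous[OF \<phi>] K(1,3,2)]) auto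
  qed
  show "\<psi> \<in> L2 (lebesgue_on S)"
    by (rule * [OF assms(2)])
  \<comment> \<open>Stated for partial sums over a subset of the basis, so that induction can use
    the two-term rule \<open>L2_add\<close>.\<close>
  have "(\<lambda>x. \<Sum>b\<in>B. frechet_derivative \<psi> (at x) b *\<^sub>R b) \<in> L2 (lebesgue_on S)"
    if "finite B" "B \<subseteq> Basis" for B
    using that
  proof (induction B rule: finite_induct)
    case empty
    show ?case by (simp add: L2_def)
  next
    case (insert b B)
    have p: "(\<lambda>x. frechet_derivative \<psi> (at x) b) \<in> L2 (lebesgue_on S)"
      by (rule *[OF test_function_partial[OF assms(2)]]) (use insert in auto)
    then have "(\<lambda>x. frechet_derivative \<psi> (at x) b *\<^sub>R b) \<in> L2 (lebesgue_on S)"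
      by (intro L2_bound[OF _ L2D(2)[OF p]]) (use insert L2D(1)[OF p] in auto)
    then show ?case
      using insert by (simp add: L2_add)
  qed
  from this[OF finite_Basis order_refl] show "grad \<psi> \<in> L2 (lebesgue_on S)"
    unfolding grad_def[abs_def] .
qed

lemma test_function_H1:
  assumes "open S" "\<psi> \<in> test_functions S"
  shows "\<psi> \<in> H1 S" "AE x in lebesgue_on S. weak_gradient S \<psi> x = grad \<psi> x"
  using assms is_weak_gradient_test_function[OF assms] test_function_L2[OF assms]
  by (auto simp: H1_def intro: weak_gradient_eq_AE)

lemma H10_H1: "u \<in> H10 S \<Longrightarrow> u \<in> H1 S"
  by (simp add: H10_def)

lemma H1_norm_diff_test_function:
  assumes "open S" "u \<in> H1 S" "\<psi> \<in> test_functions S"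
  shows "H1_norm S (\<lambda>x. u x - \<psi> x) = sqrt ((L2_norm (lebesgue_on S) (\<lambda>x. u x - \<psi> x))\<^sup>2
      + (L2_norm (lebesgue_on S) (\<lambda>x. weak_gradient S u x - grad \<psi> x))\<^sup>2)"
proof -
  note \<psi> = test_function_H1[OF assms(1,3)]
  have "AE x in lebesgue_on S. weak_gradient S (\<lambda>x. u x - \<psi> x) x = weak_gradient S u x - grad \<psi> x"
    using H1_diff(2)[OF assms(1,2) \<psi>(1)] \<psi>(2) by eventually_elim simp
  then show ?thesis
    unfolding H1_norm_def using assms \<psi>(1)
    by (subst L2_norm_cong_AE[of "weak_gradient S (\<lambda>x. u x - \<psi> x)"])
      (auto intro!: L2D(1) L2_diff H1_L2 H1_diff test_function_L2)
qed

text \<open>The norm in \<open>H10\<close> contains the chosen gradient of a difference. Replacing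
  it by \<open>weak_gradient S u - grad (\<psi> k)\<close> and separating the two parts of the norm
  gives limits that can be computed with.\<close>

lemma H10_iff:
  assumes "open S"
  shows "u \<in> H10 S \<longleftrightarrow> u \<in> H1 S \<and> (\<exists>\<psi>. (\<forall>k::nat. \<psi> k \<in> test_functions S) \<and>
      (\<lambda>k. L2_norm (lebesgue_on S) (\<lambda>x. u x - \<psi> k x)) \<longlonglongrightarrow> 0 \<and>
      (\<lambda>k. L2_norm (lebesgue_on S) (\<lambda>x. weak_gradient S u x - grad (\<psi> k) x)) \<longlonglongrightarrow> 0)"
    (is "_ \<longleftrightarrow> _ \<and> (\<exists>\<psi>. ?T \<psi> \<and> (\<lambda>k. ?a \<psi> k) \<longlonglongrightarrow> 0 \<and> (\<lambda>k. ?b \<psi> k) \<longlonglongrightarrow> 0)")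
proof -
  have "(\<lambda>k. H1_norm S (\<lambda>x. u x - \<psi> k x)) \<longlonglongrightarrow> 0 \<longleftrightarrow> (\<lambda>k. ?a \<psi> k) \<longlonglongrightarrow> 0 \<and> (\<lambda>k. ?b \<psi> k) \<longlonglongrightarrow> 0"
    if "u \<in> H1 S" "?T \<psi>" for \<psi>
  proof -
    have eq: "H1_norm S (\<lambda>x. u x - \<psi> k x) = sqrt ((?a \<psi> k)\<^sup>2 + (?b \<psi> k)\<^sup>2)" for k
      using H1_norm_diff_test_function[OF assms that(1)] that(2) by blast
    show ?thesis
    proof
      assume H: "(\<lambda>k. H1_norm S (\<lambda>x. u x - \<psi> k x)) \<longlonglongrightarrow> 0"
      have "?a \<psi> k \<le> H1_norm S (\<lambda>x. u x - \<psi> k x)" "?b \<psi> k \<le> H1_norm S (\<lambda>x. u x - \<psi> k x)" for k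
        unfolding eq by (simp_all add: real_le_rsqrt)
      then show "(\<lambda>k. ?a \<psi> k) \<longlonglongrightarrow> 0 \<and> (\<lambda>k. ?b \<psi> k) \<longlonglongrightarrow> 0"
        by (auto intro!: tendsto_sandwich[OF _ _ tendsto_const H] simp: L2_norm_nonneg)
    next
      assume "(\<lambda>k. ?a \<psi> k) \<longlonglongrightarrow> 0 \<and> (\<lambda>k. ?b \<psi> k) \<longlonglongrightarrow> 0"
      then have "(\<lambda>k. sqrt ((?a \<psi> k)\<^sup>2 + (?b \<psi> k)\<^sup>2)) \<longlonglongrightarrow> sqrt (0\<^sup>2 + 0\<^sup>2)"
        by (intro tendsto_intros) auto
      then show "(\<lambda>k. H1_norm S (\<lambda>x. u x - \<psi> k x)) \<longlonglongrightarrow> 0"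
        by (simp add: eq)
    qed
  qed
  then show ?thesis
    unfolding H10_def mem_Collect_eq by blast
qed

lemma grad_add_cmult:
  assumes "\<phi> \<in> test_functions S" "\<psi> \<in> test_functions S"
  shows "grad (\<lambda>x. \<phi> x + c * \<psi> x) x = grad \<phi> x + c *\<^sub>R grad \<psi> x"
proof -
  have "((\<lambda>x. \<phi> x + c * \<psi> x) has_derivative
      (\<lambda>h. frechet_derivative \<phi> (at x) h + c * frechet_derivative \<psi> (at x) h)) (at x)"
    by (intro has_derivative_add has_derivative_mult_right test_function_has_derivative[OF assms(1)]
        test_function_has_derivative[OF assms(2)])
  then show ?thesis
    unfolding grad_def
    by (simp add: frechet_derivative_at[symmetric] scaleR_add_left sum.distrib scaleR_sum_right)
qed

lemma H10_lincomb:
  assumes S: "open S" and u: "u \<in> H10 S" and v: "v \<in> H10 S"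
  shows "(\<lambda>x. u x + c * v x) \<in> H10 S"
proof -
  let ?N = "L2_norm (lebesgue_on S)"
  obtain \<psi> where \<psi>: "\<And>k::nat. \<psi> k \<in> test_functions S" "(\<lambda>k. ?N (\<lambda>x. u x - \<psi> k x)) \<longlonglongrightarrow> 0"
      "(\<lambda>k. ?N (\<lambda>x. weak_gradient S u x - grad (\<psi> k) x)) \<longlonglongrightarrow> 0"
    using u unfolding H10_iff[OF S] by blast
  obtain \<eta> where \<eta>: "\<And>k::nat. \<eta> k \<in> test_functions S" "(\<lambda>k. ?N (\<lambda>x. v x - \<eta> k x)) \<longlonglongrightarrow> 0"
      "(\<lambda>k. ?N (\<lambda>x. weak_gradient S v x - grad (\<eta> k) x)) \<longlonglongrightarrow> 0"
    using v unfolding H10_iff[OF S] by blast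
  note uv = H10_H1[OF u] H10_H1[OF v]
  let ?\<xi> = "\<lambda>k x. \<psi> k x + c * \<eta> k x"
  have T: "?\<xi> k \<in> test_functions S" for k
    by (intro test_function_add test_function_cmult \<psi> \<eta>)
  note L2s = H1_L2[OF S uv(1)] H1_L2[OF S uv(2)] test_function_L2[OF S \<psi>(1)] test_function_L2[OF S \<eta>(1)]
  have "(\<lambda>k. ?N (\<lambda>x. (u x + c * v x) - ?\<xi> k x)) \<longlonglongrightarrow> 0"
  proof (rule tendsto_sandwich[OF _ _ tendsto_const])
    have "?N (\<lambda>x. (u x + c * v x) - ?\<xi> k x) \<le> ?N (\<lambda>x. u x - \<psi> k x) + \<bar>c\<bar> * ?N (\<lambda>x. v x - \<eta> k x)" for k
      using L2_norm_triangle[OF L2_diff[OF L2s(1) L2s(5)] L2_scaleR[OF L2_diff[OF L2s(3) L2s(7)]], of k c k]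
      unfolding L2_norm_scaleR by (simp add: algebra_simps)
    then show "\<forall>\<^sub>F k in sequentially. ?N (\<lambda>x. (u x + c * v x) - ?\<xi> k x)
        \<le> ?N (\<lambda>x. u x - \<psi> k x) + \<bar>c\<bar> * ?N (\<lambda>x. v x - \<eta> k x)"
      by simp
    show "(\<lambda>k. ?N (\<lambda>x. u x - \<psi> k x) + \<bar>c\<bar> * ?N (\<lambda>x. v x - \<eta> k x)) \<longlonglongrightarrow> 0"
      using tendsto_add[OF \<psi>(2) tendsto_mult[OF tendsto_const \<eta>(2)]] by simp
  qed (simp add: L2_norm_nonneg)
  moreover have "(\<lambda>k. ?N (\<lambda>x. weak_gradient S (\<lambda>x. u x + c * v x) x - grad (?\<xi> k) x)) \<longlonglongrightarrow> 0"
  proof (rule tendsto_sandwich[OF _ _ tendsto_const])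
    have "?N (\<lambda>x. weak_gradient S (\<lambda>x. u x + c * v x) x - grad (?\<xi> k) x)
        \<le> ?N (\<lambda>x. weak_gradient S u x - grad (\<psi> k) x) + \<bar>c\<bar> * ?N (\<lambda>x. weak_gradient S v x - grad (\<eta> k) x)" for k
    proof -
      have "?N (\<lambda>x. weak_gradient S (\<lambda>x. u x + c * v x) x - grad (?\<xi> k) x)
          = ?N (\<lambda>x. (weak_gradient S u x - grad (\<psi> k) x) + c *\<^sub>R (weak_gradient S v x - grad (\<eta> k) x))"
      proof (rule L2_norm_cong_AE)
        show "(\<lambda>x. weak_gradient S (\<lambda>x. u x + c * v x) x - grad (?\<xi> k) x) \<in> borel_measurable (lebesgue_on S)"
          by (intro L2D(1) L2_diff H1_L2(2) test_function_L2(2) S T H1_lincomb(1) uv)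
        show "(\<lambda>x. (weak_gradient S u x - grad (\<psi> k) x) + c *\<^sub>R (weak_gradient S v x - grad (\<eta> k) x))
            \<in> borel_measurable (lebesgue_on S)"
          by (intro L2D(1) L2_diff L2_add L2_scaleR L2s)
        show "AE x in lebesgue_on S. weak_gradient S (\<lambda>x. u x + c * v x) x - grad (?\<xi> k) x
            = (weak_gradient S u x - grad (\<psi> k) x) + c *\<^sub>R (weak_gradient S v x - grad (\<eta> k) x)"
          using H1_lincomb(2)[OF S uv, of c]
          by eventually_elim (simp add: grad_add_cmult[OF \<psi>(1) \<eta>(1)] algebra_simps)
      qed
      also have "\<dots> \<le> ?N (\<lambda>x. weak_gradient S u x - grad (\<psi> k) x)
          + \<bar>c\<bar> * ?N (\<lambda>x. weak_gradient S v x - grad (\<eta> k) x)"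
        using L2_norm_triangle[OF L2_diff[OF L2s(2) L2s(6)] L2_scaleR[OF L2_diff[OF L2s(4) L2s(8)]], of k c k]
        unfolding L2_norm_scaleR .
      finally show ?thesis .
    qed
    then show "\<forall>\<^sub>F k in sequentially. ?N (\<lambda>x. weak_gradient S (\<lambda>x. u x + c * v x) x - grad (?\<xi> k) x)
        \<le> ?N (\<lambda>x. weak_gradient S u x - grad (\<psi> k) x) + \<bar>c\<bar> * ?N (\<lambda>x. weak_gradient S v x - grad (\<eta> k) x)"
      by simp
    show "(\<lambda>k. ?N (\<lambda>x. weak_gradient S u x - grad (\<psi> k) x)
        + \<bar>c\<bar> * ?N (\<lambda>x. weak_gradient S v x - grad (\<eta> k) x)) \<longlonglongrightarrow> 0"
      using tendsto_add[OF \<psi>(3) tendsto_mult[OF tendsto_const \<eta>(3)]] by simp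
  qed (simp add: L2_norm_nonneg)
  ultimately show ?thesis
    unfolding H10_iff[OF S] using T by (intro conjI H1_lincomb(1)[OF S uv] exI[of _ ?\<xi>]) auto
qed

lemma H10_diff: "open S \<Longrightarrow> u \<in> H10 S \<Longrightarrow> v \<in> H10 S \<Longrightarrow> (\<lambda>x. u x - v x) \<in> H10 S"
  using H10_lincomb[of S u v "- 1"] by simp

lemma test_function_H10:
  assumes "open S" "\<psi> \<in> test_functions S"
  shows "\<psi> \<in> H10 S"
  unfolding H10_iff[OF assms(1)]
proof (intro conjI exI[of _ "\<lambda>k. \<psi>"])
  show "(\<lambda>k::nat. L2_norm (lebesgue_on S) (\<lambda>x. weak_gradient S \<psi> x - grad \<psi> x)) \<longlonglongrightarrow> 0"
    using test_function_H1(2)[OF assms] test_function_H1(1)[OF assms] assms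
    by (subst L2_norm_0_AE) (auto intro!: L2D(1) L2_diff H1_L2 test_function_L2 elim!: eventually_mono)
qed (use assms test_function_H1 in \<open>auto simp: L2_norm_def\<close>)

text \<open>Integrate \<open>\<partial>\<^sub>b ((x \<bullet> b) \<psi>\<^sup>2) = \<psi>\<^sup>2 + 2 (x \<bullet> b) \<psi> \<partial>\<^sub>b \<psi>\<close>.\<close>

lemma Poincare_test_function:
  fixes S :: "'a::euclidean_space set"
  assumes S: "open S" "S \<subseteq> cball 0 R" "R \<ge> 0" and \<psi>: "\<psi> \<in> test_functions S"
  shows "L2_norm (lebesgue_on S) \<psi> \<le> 2 * R * L2_norm (lebesgue_on S) (grad \<psi>)"
proof -
  let ?N = "L2_norm (lebesgue_on S)"
  \<comment> \<open>One direction suffices: the weight \<open>x \<bullet> b\<close> is at most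
    \<open>R\<close> in modulus, and a single partial derivative is dominated by the full gradient.
    The factor 2 in the constant comes from differentiating the square.\<close>
  obtain b :: 'a where b: "b \<in> Basis"
    using nonempty_Basis by blast
  define D where "D x = frechet_derivative \<psi> (at x) b" for x
  define F where "F x = (x \<bullet> b) * (\<psi> x * \<psi> x)" for x
  define P where "P x = \<psi> x * \<psi> x" for x
  define Q where "Q x = (x \<bullet> b) * (\<psi> x * D x)" for x
  have P: "P \<in> test_functions S" and Q: "Q \<in> test_functions S" and F: "F \<in> test_functions S"
    unfolding P_def Q_def D_def F_def
    by (intro test_function_mult[OF cont_diff_inner_right] test_function_mult[OF test_function_cont_diff[OF \<psi>]]
        \<psi> test_function_partial b)+
  have "frechet_derivative F (at x) b = P x + 2 * Q x" for x
  proof -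
    have "(F has_derivative (\<lambda>h. (x \<bullet> b) * (\<psi> x * frechet_derivative \<psi> (at x) h
        + frechet_derivative \<psi> (at x) h * \<psi> x) + (h \<bullet> b) * (\<psi> x * \<psi> x))) (at x)"
      unfolding F_def[abs_def]
      by (intro has_derivative_mult has_derivative_inner_left has_derivative_ident
          test_function_has_derivative[OF \<psi>])
    from frechet_derivative_at[OF this, symmetric] show ?thesis
      using b by (simp add: P_def Q_def D_def algebra_simps)
  qed
  then have "(LINT x|lborel. P x + 2 * Q x) = 0"
    using integral_partial_test_function[OF _ b, of F] F test_functions_mono[of S UNIV] by auto
  then have PQ: "(LINT x|lborel. P x) = - (2 * (LINT x|lborel. Q x))"
    using P Q by (simp add: test_function_integrable)
  note L2s = test_function_L2[OF S(1) \<psi>]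
  have "(?N \<psi>)\<^sup>2 = (LINT x|lebesgue_on S. P x)"
    unfolding L2_norm_power2 by (simp add: P_def power2_eq_square)
  also have "\<dots> = - (2 * (LINT x|lebesgue_on S. Q x))"
    using PQ by (simp add: integral_test_function_lebesgue_on[OF S(1)] P Q)
  also have "\<dots> \<le> 2 * \<bar>LINT x|lebesgue_on S. Q x\<bar>"
    by linarith
  also have "\<bar>LINT x|lebesgue_on S. Q x\<bar> \<le> (LINT x|lebesgue_on S. R * (norm (\<psi> x) * norm (grad \<psi> x)))"
  proof -
    have "norm (LINT x|lebesgue_on S. Q x) \<le> (LINT x|lebesgue_on S. R * (norm (\<psi> x) * norm (grad \<psi> x)))"
    proof (rule Bochner_Integration.integral_norm_bound_integral)
      show i: "integrable (lebesgue_on S) (\<lambda>x. R * (norm (\<psi> x) * norm (grad \<psi> x)))"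
        using L2_integrable_norm_mult[OF L2s] by simp
      have bd: "norm (Q x) \<le> R * (norm (\<psi> x) * norm (grad \<psi> x))" if "x \<in> S" for x
      proof -
        have "\<bar>x \<bullet> b\<bar> \<le> R"
          using that S(2) Basis_le_norm[OF b, of x] by (auto simp: subset_iff intro: order_trans)
        moreover have "\<bar>D x\<bar> \<le> norm (grad \<psi> x)"
          using Basis_le_norm[OF b, of "grad \<psi> x"] by (simp add: grad_inner[OF b] D_def)
        ultimately have "\<bar>x \<bullet> b\<bar> * (\<bar>\<psi> x\<bar> * \<bar>D x\<bar>) \<le> R * (\<bar>\<psi> x\<bar> * norm (grad \<psi> x))"
          using S(3) by (intro mult_mono mult_nonneg_nonneg) auto
        then show ?thesis
          by (simp add: Q_def abs_mult)
      qed
      show "\<And>x. x \<in> space (lebesgue_on S) \<Longrightarrow> norm (Q x) \<le> R * (norm (\<psi> x) * norm (grad \<psi> x))"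
        using bd by simp
      show "integrable (lebesgue_on S) Q"
        by (rule Bochner_Integration.integrable_bound[OF i L2D(1)[OF test_function_L2(1)[OF S(1) Q]]])
          (rule AE_I2, use order_trans[OF bd abs_ge_self] in simp)
    qed
    then show ?thesis by simp
  qed
  also have "\<dots> = R * (LINT x|lebesgue_on S. norm (\<psi> x) * norm (grad \<psi> x))"
    by simp
  also have "\<dots> \<le> R * (?N \<psi> * ?N (grad \<psi>))"
    by (intro mult_left_mono L2_Cauchy_Schwarz L2s S)
  finally have "?N \<psi> * ?N \<psi> \<le> ?N \<psi> * (2 * R * ?N (grad \<psi>))"
    by (simp add: power2_eq_square mult_ac)
  then show ?thesis
    using L2_norm_nonneg[of "lebesgue_on S" \<psi>] L2_norm_nonneg[of "lebesgue_on S" "grad \<psi>"] S(3)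
    by (cases "?N \<psi> = 0") auto
qed

text \<open>Both sides are continuous along an approximating sequence of test functions, so the
  inequality survives the limit with the same constant.\<close>

lemma Poincare_H10:
  assumes S: "open S" "S \<subseteq> cball 0 R" "R \<ge> 0" and u: "u \<in> H10 S"
  shows "L2_norm (lebesgue_on S) u \<le> 2 * R * L2_norm (lebesgue_on S) (weak_gradient S u)"
proof -
  let ?N = "L2_norm (lebesgue_on S)"
  obtain \<psi> where \<psi>: "\<And>k::nat. \<psi> k \<in> test_functions S" "(\<lambda>k. ?N (\<lambda>x. u x - \<psi> k x)) \<longlonglongrightarrow> 0"
      "(\<lambda>k. ?N (\<lambda>x. weak_gradient S u x - grad (\<psi> k) x)) \<longlonglongrightarrow> 0"
    using u unfolding H10_iff[OF S(1)] by blast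
  note L2s = H1_L2[OF S(1) H10_H1[OF u]] test_function_L2[OF S(1) \<psi>(1)]
  have le: "?N u \<le> 2 * R * (?N (weak_gradient S u) + ?N (\<lambda>x. weak_gradient S u x - grad (\<psi> k) x))
      + ?N (\<lambda>x. u x - \<psi> k x)" for k
  proof -
    have "?N u \<le> ?N (\<psi> k) + ?N (\<lambda>x. u x - \<psi> k x)"
      by (rule L2_norm_le_diff[OF L2s(1,3)])
    also have "?N (\<psi> k) \<le> 2 * R * ?N (grad (\<psi> k))"
      by (rule Poincare_test_function[OF S \<psi>(1)])
    also have "?N (grad (\<psi> k)) \<le> ?N (weak_gradient S u) + ?N (\<lambda>x. grad (\<psi> k) x - weak_gradient S u x)"
      by (rule L2_norm_le_diff[OF L2s(4,2)])
    finally show ?thesis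
      using S(3) by (simp add: L2_norm_minus_commute[of _ "grad (\<psi> k)"] mult_left_mono)
  qed
  have "(\<lambda>k. 2 * R * (?N (weak_gradient S u) + ?N (\<lambda>x. weak_gradient S u x - grad (\<psi> k) x))
      + ?N (\<lambda>x. u x - \<psi> k x)) \<longlonglongrightarrow> 2 * R * (?N (weak_gradient S u) + 0) + 0"
    by (intro tendsto_intros \<psi>)
  then show ?thesis
    using le by (intro tendsto_lowerbound[where F = sequentially]) auto
qed

section \<open>The weak maximum principle\<close>

text \<open>The radicand stays above \<open>\<delta>^2 > 0\<close>, which gives smoothness;
  subtracting \<open>\<delta>\<close> restores the compact support. The chain rule multiplies the
  gradient by \<open>\<psi> / sqrt (\<psi>^2 + \<delta>^2)\<close>, of modulus at most 1, so the
  Dirichlet energy does not grow.\<close>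

lemma smoothed_abs_test_function:
  fixes S :: "'a::euclidean_space set"
  assumes \<psi>: "\<psi> \<in> test_functions S" and \<delta>: "\<delta> > 0"
  defines "\<sigma> \<equiv> \<lambda>x. sqrt ((\<psi> x)\<^sup>2 + \<delta>\<^sup>2) - \<delta>"
  shows "\<sigma> \<in> test_functions S" "norm (grad \<sigma> x) \<le> norm (grad \<psi> x)" "\<bar>\<sigma> x - \<bar>\<psi> x\<bar>\<bar> \<le> \<delta>"
proof -
  have pos: "(\<psi> x)\<^sup>2 + \<delta>\<^sup>2 > 0" for x
    using \<delta> by (simp add: add_nonneg_pos)
  obtain K where K: "compact K" "K \<subseteq> S" "\<And>x. x \<notin> K \<Longrightarrow> \<psi> x = 0"
    using test_functionE[OF \<psi>] by blast
  show "\<sigma> \<in> test_functions S"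
  proof (rule test_functionI[OF _ K(1,2)])
    have "\<sigma> = (\<lambda>x. (\<psi> x * \<psi> x + \<delta>\<^sup>2) powr (1/2) + - \<delta>)"
      using pos by (simp add: \<sigma>_def fun_eq_iff powr_half_sqrt less_imp_le power2_eq_square)
    moreover have "cont_diff k (\<lambda>x. (\<psi> x * \<psi> x + \<delta>\<^sup>2) powr (1/2) + - \<delta>)" for k
      using pos by (intro cont_diff_add cont_diff_powr cont_diff_mult cont_diff_const
          test_function_cont_diff[OF \<psi>]) (simp add: power2_eq_square)
    ultimately show "cont_diff k \<sigma>" for k
      by simp
    show "\<sigma> x = 0" if "x \<notin> K" for x
      using K(3)[OF that] \<delta> by (simp add: \<sigma>_def)
  qed
  define c where "c = \<psi> x / sqrt ((\<psi> x)\<^sup>2 + \<delta>\<^sup>2)"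
  have "((\<lambda>y. sqrt (y\<^sup>2 + \<delta>\<^sup>2) - \<delta>) has_real_derivative c) (at (\<psi> x))"
    using pos[of x] by (auto intro!: derivative_eq_intros simp: c_def divide_simps)
  then have "(\<sigma> has_derivative (\<lambda>h. c * frechet_derivative \<psi> (at x) h)) (at x)"
    unfolding \<sigma>_def has_field_derivative_def
    by (rule has_derivative_compose[OF test_function_has_derivative[OF \<psi>]])
  from frechet_derivative_at[OF this, symmetric] have "grad \<sigma> x = c *\<^sub>R grad \<psi> x"
    by (simp add: grad_def scaleR_sum_right)
  moreover have "\<bar>c\<bar> \<le> 1"
  proof -
    have "\<bar>\<psi> x\<bar> \<le> sqrt ((\<psi> x)\<^sup>2 + \<delta>\<^sup>2)"
      by (rule real_le_rsqrt) simp
    then show ?thesis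
      using pos[of x] by (simp add: c_def abs_div)
  qed
  ultimately show "norm (grad \<sigma> x) \<le> norm (grad \<psi> x)"
    by (simp add: mult_left_le_one_le)
  have "\<bar>\<psi> x\<bar> \<le> sqrt ((\<psi> x)\<^sup>2 + \<delta>\<^sup>2)"
    by (rule real_le_rsqrt) simp
  moreover have "sqrt ((\<psi> x)\<^sup>2 + \<delta>\<^sup>2) \<le> \<bar>\<psi> x\<bar> + \<delta>"
    using sqrt_add_le_add_sqrt[of "(\<psi> x)\<^sup>2" "\<delta>\<^sup>2"] \<delta> by simp
  ultimately show "\<bar>\<sigma> x - \<bar>\<psi> x\<bar>\<bar> \<le> \<delta>"
    unfolding \<sigma>_def by linarith
qed

lemma L2_const:
  assumes "bounded S" "S \<in> sets lebesgue"
  shows "(\<lambda>x. c) \<in> L2 (lebesgue_on S)"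
proof -
  interpret finite_measure "lebesgue_on S"
    using assms by (intro finite_measure_lebesgue_on bounded_set_imp_lmeasurable)
  show ?thesis
    by (simp add: L2_def)
qed

text \<open>The solution \<open>\<phi>\<close> minimises the strictly convex energy
  \<open>w \<mapsto> \<integral> |\<nabla>w|\<^sup>2 / 2 - f w\<close>, and the smoothed absolute values of functions approximating
  \<open>\<phi>\<close> form a minimising sequence; it converges to \<open>\<bar>\<phi>\<bar>\<close>.\<close>

lemma weak_maximum_principle:
  fixes S :: "'a::euclidean_space set"
  assumes S: "open S" "S \<subseteq> cball 0 R" "R \<ge> 0" and \<phi>: "\<phi> \<in> H10 S"
    and f: "f \<in> L2 (lebesgue_on S)" "AE x in lebesgue_on S. 0 \<le> f x"
    and eq: "\<And>v. v \<in> H10 S \<Longrightarrow> (LINT x|lebesgue_on S. weak_gradient S \<phi> x \<bullet> weak_gradient S v x)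
      = (LINT x|lebesgue_on S. f x * v x)"
  shows "AE x in lebesgue_on S. 0 \<le> \<phi> x"
proof -
  let ?M = "lebesgue_on S"
  let ?N = "L2_norm ?M"
  let ?G = "weak_gradient S"
  obtain \<psi> where \<psi>: "\<And>k::nat. \<psi> k \<in> test_functions S" "(\<lambda>k. ?N (\<lambda>x. \<phi> x - \<psi> k x)) \<longlonglongrightarrow> 0"
      "(\<lambda>k. ?N (\<lambda>x. ?G \<phi> x - grad (\<psi> k) x)) \<longlonglongrightarrow> 0"
    using \<phi> unfolding H10_iff[OF S(1)] by blast
  define \<delta> where "\<delta> k = 1 / real (Suc k)" for k
  have \<delta>: "\<delta> k > 0" for k
    by (simp add: \<delta>_def)
  have \<delta>0: "\<delta> \<longlonglongrightarrow> 0"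
    unfolding \<delta>_def by (rule LIMSEQ_Suc[OF lim_1_over_n])
  define w where "w k x = sqrt ((\<psi> k x)\<^sup>2 + (\<delta> k)\<^sup>2) - \<delta> k" for k x
  have w: "w k \<in> test_functions S" "norm (grad (w k) x) \<le> norm (grad (\<psi> k) x)"
      "\<bar>w k x - \<bar>\<psi> k x\<bar>\<bar> \<le> \<delta> k" for k x
    using smoothed_abs_test_function[OF \<psi>(1)[of k] \<delta>[of k]] unfolding w_def[abs_def] by blast+
  have bS: "bounded S"
    using S(2) bounded_cball bounded_subset by blast
  note L\<phi> = H1_L2[OF S(1) H10_H1[OF \<phi>]]
  note L\<psi> = test_function_L2[OF S(1) \<psi>(1)]
  note Lw = test_function_L2[OF S(1) w(1)]
  have L1: "(\<lambda>x. c) \<in> L2 ?M" for c :: real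
    using bS S(1) by (intro L2_const) auto
  \<comment> \<open>Bounds the distance from \<open>w k\<close> to the absolute value of
    \<open>\<phi>\<close>: the first summand is the smoothing error, the second the approximation
    error.\<close>
  define n where "n k = \<delta> k * ?N (\<lambda>x. 1::real) + ?N (\<lambda>x. \<phi> x - \<psi> k x)" for k
  have n0: "n \<longlonglongrightarrow> 0"
    unfolding n_def using tendsto_add[OF tendsto_mult[OF \<delta>0 tendsto_const] \<psi>(2)] by simp
  have wn: "?N (\<lambda>x. w k x - \<bar>\<phi> x\<bar>) \<le> n k" for k
  proof -
    have "?N (\<lambda>x. w k x - \<bar>\<phi> x\<bar>) \<le> ?N (\<lambda>x. w k x - \<bar>\<psi> k x\<bar>) + ?N (\<lambda>x. \<bar>\<psi> k x\<bar> - \<bar>\<phi> x\<bar>)"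
      by (rule L2_norm_triangle_diff[OF Lw(1) L2_abs[OF L\<psi>(1)] L2_abs[OF L\<phi>(1)]])
    also have "?N (\<lambda>x. w k x - \<bar>\<psi> k x\<bar>) \<le> ?N (\<lambda>x. \<delta> k *\<^sub>R (1::real))"
      using w(3)[of k] \<delta>[of k]
      by (intro L2_norm_mono_AE L2D(1) L2_diff Lw L2_abs L\<psi> L2_scaleR L1) auto
    also have "\<dots> = \<delta> k * ?N (\<lambda>x. 1::real)"
      unfolding L2_norm_scaleR using \<delta>[of k] by simp
    also have "?N (\<lambda>x. \<bar>\<psi> k x\<bar> - \<bar>\<phi> x\<bar>) \<le> ?N (\<lambda>x. \<phi> x - \<psi> k x)"
      by (intro L2_norm_mono_AE L2D(1) L2_diff L2_abs L\<psi> L\<phi>) auto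
    finally show ?thesis
      by (simp add: n_def)
  qed
  have wH: "w k \<in> H10 S" for k
    by (rule test_function_H10[OF S(1) w(1)])
  define e where "e k = ?N (?G (\<lambda>x. w k x - \<phi> x))" for k
  have f\<phi>: "(?N (?G \<phi>))\<^sup>2 = (LINT x|?M. f x * \<phi> x)"
    unfolding L2_norm_power2 power2_norm_eq_inner by (rule eq[OF \<phi>])
  \<comment> \<open>Expand the squared norm of \<open>grad (w k) - \<nabla>\<phi>\<close>. The cross
    term becomes \<open>\<integral> f w\<close> by testing with \<open>w k\<close>, the square of
    \<open>\<nabla>\<phi>\<close> becomes \<open>\<integral> f \<phi>\<close> by testing with
    \<open>\<phi>\<close>, and the energy of \<open>w k\<close> is replaced by the larger one of
    \<open>\<psi> k\<close>, whose limit is known.\<close>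
  define D where "D k = (?N (grad (\<psi> k)))\<^sup>2 - 2 * (LINT x|?M. f x * w k x) + (LINT x|?M. f x * \<phi> x)" for k
  have eD: "(e k)\<^sup>2 \<le> D k" for k
  proof -
    have AEw: "AE x in ?M. ?G (w k) x = grad (w k) x"
      by (rule test_function_H1(2)[OF S(1) w(1)])
    have AEd: "AE x in ?M. ?G (\<lambda>x. w k x - \<phi> x) x = ?G (w k) x - ?G \<phi> x"
      by (rule H1_diff(2)[OF S(1) H10_H1[OF wH] H10_H1[OF \<phi>]])
    have "e k = ?N (\<lambda>x. grad (w k) x - ?G \<phi> x)"
      unfolding e_def
    proof (rule L2_norm_cong_AE)
      show "?G (\<lambda>x. w k x - \<phi> x) \<in> borel_measurable ?M"
        by (rule L2D(1)[OF H1_L2(2)[OF S(1) H10_H1[OF H10_diff[OF S(1) wH \<phi>]]]])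
      show "(\<lambda>x. grad (w k) x - ?G \<phi> x) \<in> borel_measurable ?M"
        by (rule L2D(1)[OF L2_diff[OF Lw(2) L\<phi>(2)]])
      show "AE x in ?M. ?G (\<lambda>x. w k x - \<phi> x) x = grad (w k) x - ?G \<phi> x"
        using AEw AEd by eventually_elim simp
    qed
    then have "(e k)\<^sup>2 = (LINT x|?M. (norm (grad (w k) x))\<^sup>2 - 2 * (?G \<phi> x \<bullet> grad (w k) x) + (norm (?G \<phi> x))\<^sup>2)"
      by (simp add: L2_norm_power2 power2_norm_eq_inner inner_diff_left inner_diff_right inner_commute
          algebra_simps)
    also have "\<dots> = (?N (grad (w k)))\<^sup>2 - 2 * (LINT x|?M. ?G \<phi> x \<bullet> grad (w k) x) + (?N (?G \<phi>))\<^sup>2"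
      using L2D(2)[OF Lw(2)] L2D(2)[OF L\<phi>(2)] L2_inner(1)[OF L\<phi>(2) Lw(2)] by (simp add: L2_norm_power2)
    also have "(LINT x|?M. ?G \<phi> x \<bullet> grad (w k) x) = (LINT x|?M. ?G \<phi> x \<bullet> ?G (w k) x)"
    proof (rule integral_cong_AE)
      show "(\<lambda>x. ?G \<phi> x \<bullet> grad (w k) x) \<in> borel_measurable ?M"
        by (rule borel_measurable_integrable[OF L2_inner(1)[OF L\<phi>(2) Lw(2)]])
      show "(\<lambda>x. ?G \<phi> x \<bullet> ?G (w k) x) \<in> borel_measurable ?M"
        by (rule borel_measurable_integrable[OF L2_inner(1)[OF L\<phi>(2) H1_L2(2)[OF S(1) H10_H1[OF wH]]]])
      show "AE x in ?M. ?G \<phi> x \<bullet> grad (w k) x = ?G \<phi> x \<bullet> ?G (w k) x"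
        using AEw by eventually_elim simp
    qed
    also have "\<dots> = (LINT x|?M. f x * w k x)"
      by (rule eq[OF wH])
    also have "(?N (grad (w k)))\<^sup>2 \<le> (?N (grad (\<psi> k)))\<^sup>2"
      using w(2)[of k] by (intro power_mono L2_norm_mono_AE L2D(1) Lw L\<psi> L2_norm_nonneg) auto
    finally show ?thesis
      by (simp add: D_def f\<phi>)
  qed
  have N\<psi>: "(\<lambda>k. ?N (grad (\<psi> k))) \<longlonglongrightarrow> ?N (?G \<phi>)"
  proof -
    have "(\<lambda>k. ?N (grad (\<psi> k)) - ?N (?G \<phi>)) \<longlonglongrightarrow> 0"
    proof (rule tendsto_rabs_zero_cancel, rule tendsto_sandwich[OF _ _ tendsto_const \<psi>(3)])
      have "\<bar>?N (grad (\<psi> k)) - ?N (?G \<phi>)\<bar> \<le> ?N (\<lambda>x. ?G \<phi> x - grad (\<psi> k) x)" for k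
        using L2_norm_le_diff[OF L\<phi>(2) L\<psi>(2), of k] L2_norm_le_diff[OF L\<psi>(2) L\<phi>(2), of k]
        unfolding L2_norm_minus_commute[of _ "grad (\<psi> k)"] by simp
      then show "\<forall>\<^sub>F k in sequentially. \<bar>?N (grad (\<psi> k)) - ?N (?G \<phi>)\<bar> \<le> ?N (\<lambda>x. ?G \<phi> x - grad (\<psi> k) x)"
        by simp
    qed simp
    then show ?thesis
      by (rule LIM_zero_cancel)
  qed
  have fw: "(\<lambda>k. LINT x|?M. f x * w k x) \<longlonglongrightarrow> (LINT x|?M. f x * \<bar>\<phi> x\<bar>)"
  proof -
    have "(\<lambda>k. (LINT x|?M. f x * w k x) - (LINT x|?M. f x * \<bar>\<phi> x\<bar>)) \<longlonglongrightarrow> 0"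
    proof (rule tendsto_rabs_zero_cancel, rule tendsto_sandwich[OF _ _ tendsto_const])
      have "\<bar>(LINT x|?M. f x * w k x) - (LINT x|?M. f x * \<bar>\<phi> x\<bar>)\<bar> \<le> ?N f * n k" for k
      proof -
        have "(LINT x|?M. f x * w k x) - (LINT x|?M. f x * \<bar>\<phi> x\<bar>) = (LINT x|?M. f x * (w k x - \<bar>\<phi> x\<bar>))"
          using L2_mult(1)[OF f(1) Lw(1)] L2_mult(1)[OF f(1) L2_abs[OF L\<phi>(1)]]
          by (simp add: right_diff_distrib)
        also have "\<bar>\<dots>\<bar> \<le> ?N f * ?N (\<lambda>x. w k x - \<bar>\<phi> x\<bar>)"
          by (rule L2_mult(2)[OF f(1) L2_diff[OF Lw(1) L2_abs[OF L\<phi>(1)]]])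
        also have "\<dots> \<le> ?N f * n k"
          by (intro mult_left_mono wn L2_norm_nonneg)
        finally show ?thesis .
      qed
      then show "\<forall>\<^sub>F k in sequentially. \<bar>(LINT x|?M. f x * w k x) - (LINT x|?M. f x * \<bar>\<phi> x\<bar>)\<bar> \<le> ?N f * n k"
        by simp
      show "(\<lambda>k. ?N f * n k) \<longlonglongrightarrow> 0"
        using tendsto_mult[OF tendsto_const n0] by simp
    qed simp
    then show ?thesis
      by (rule LIM_zero_cancel)
  qed
  define l where "l = 2 * (LINT x|?M. f x * \<phi> x) - 2 * (LINT x|?M. f x * \<bar>\<phi> x\<bar>)"
  have "D \<longlonglongrightarrow> (?N (?G \<phi>))\<^sup>2 - 2 * (LINT x|?M. f x * \<bar>\<phi> x\<bar>) + (LINT x|?M. f x * \<phi> x)"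
    unfolding D_def by (intro tendsto_intros N\<psi> fw)
  then have Dl: "D \<longlonglongrightarrow> l"
    by (simp add: l_def f\<phi>)
  have "(LINT x|?M. f x * \<phi> x) \<le> (LINT x|?M. f x * \<bar>\<phi> x\<bar>)"
  proof (rule integral_mono_AE)
    show "AE x in ?M. f x * \<phi> x \<le> f x * \<bar>\<phi> x\<bar>"
      using f(2) by eventually_elim (simp add: mult_left_mono)
  qed (rule L2_mult(1)[OF f(1) L\<phi>(1)] L2_mult(1)[OF f(1) L2_abs[OF L\<phi>(1)]])+
  then have l: "l \<le> 0"
    by (simp add: l_def)
  \<comment> \<open>The limit \<open>l\<close> of \<open>D\<close> is nonpositive because
    \<open>f \<ge> 0\<close>, hence \<open>(e k)^2 \<le> D k \<le> D k - l\<close>, and the last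
    expression tends to zero.\<close>
  have "(\<lambda>k. (e k)\<^sup>2) \<longlonglongrightarrow> 0"
  proof (rule tendsto_sandwich[OF _ _ tendsto_const])
    have "(e k)\<^sup>2 \<le> D k - l" for k
      using eD[of k] l by linarith
    then show "\<forall>\<^sub>F k in sequentially. (e k)\<^sup>2 \<le> D k - l"
      by simp
    show "(\<lambda>k. D k - l) \<longlonglongrightarrow> 0"
      using tendsto_diff[OF Dl tendsto_const[of l]] by simp
  qed simp
  then have "(\<lambda>k. sqrt ((e k)\<^sup>2)) \<longlonglongrightarrow> sqrt 0"
    by (rule tendsto_real_sqrt)
  then have e0: "e \<longlonglongrightarrow> 0"
    by (simp add: e_def[abs_def] L2_norm_nonneg)
  \<comment> \<open>The sequence \<open>w k\<close> approaches both \<open>\<phi>\<close> (through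
    the gradients and Poincare) and its absolute value (through \<open>n\<close>), so the two limits
    coincide.\<close>
  have "?N (\<lambda>x. \<phi> x - \<bar>\<phi> x\<bar>) \<le> 2 * R * e k + n k" for k
  proof -
    have "?N (\<lambda>x. \<phi> x - \<bar>\<phi> x\<bar>) \<le> ?N (\<lambda>x. \<phi> x - w k x) + ?N (\<lambda>x. w k x - \<bar>\<phi> x\<bar>)"
      by (rule L2_norm_triangle_diff[OF L\<phi>(1) Lw(1) L2_abs[OF L\<phi>(1)]])
    also have "?N (\<lambda>x. \<phi> x - w k x) = ?N (\<lambda>x. w k x - \<phi> x)"
      by (rule L2_norm_minus_commute)
    also have "\<dots> \<le> 2 * R * e k"
      unfolding e_def by (rule Poincare_H10[OF S H10_diff[OF S(1) wH \<phi>]])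
    finally show ?thesis
      using wn[of k] by linarith
  qed
  moreover have "(\<lambda>k. 2 * R * e k + n k) \<longlonglongrightarrow> 2 * R * 0 + 0"
    by (intro tendsto_intros e0 n0)
  ultimately have "?N (\<lambda>x. \<phi> x - \<bar>\<phi> x\<bar>) \<le> 0"
    by (intro tendsto_lowerbound[where F = sequentially]) auto
  then have "?N (\<lambda>x. \<phi> x - \<bar>\<phi> x\<bar>) = 0"
    using L2_norm_nonneg by (rule antisym)
  then have "AE x in ?M. \<phi> x - \<bar>\<phi> x\<bar> = 0"
    by (rule L2_norm_eq_0_AE[OF L2_diff[OF L\<phi>(1) L2_abs[OF L\<phi>(1)]]])
  then show ?thesis
    by eventually_elim simp
qed

section \<open>Lipschitz bounds in \<open>W\<^sup>1\<^sup>,\<^sup>\<infinity>\<close>\<close>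

text \<open>\<open>Linf_norm\<close> converts an extended real, and an infinite essential supremum
  would turn into 0. The bounded weak derivative granted by \<open>W1inf_real\<close> agrees almost
  everywhere with the chosen one and excludes this case.\<close>

lemma W1inf_weak_gradient_bound:
  assumes "a \<in> W1inf_real"
  shows "weak_gradient UNIV a \<in> borel_measurable lebesgue"
    and "AE x in lebesgue. x \<in> {lo..hi} \<longrightarrow>
      \<bar>weak_gradient UNIV a x\<bar> \<le> Linf_norm (lebesgue_on {lo..hi}) (weak_gradient UNIV a)"
    and "is_weak_gradient UNIV a (weak_gradient UNIV a)"
proof -
  obtain b where b: "b \<in> Linf (lebesgue_on UNIV)" "is_weak_gradient UNIV a b"
    using assms by (auto simp: W1inf_real_def)
  show "is_weak_gradient UNIV a (weak_gradient UNIV a)"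
    unfolding weak_gradient_def using someI[of "is_weak_gradient UNIV a", OF b(2)] .
  have AEb: "AE x in lebesgue_on UNIV. b x = weak_gradient UNIV a x"
    using weak_gradient_eq_AE[OF open_UNIV b(2)] by eventually_elim simp
  have bm: "b \<in> borel_measurable (lebesgue_on UNIV)"
    using b(1) by (simp add: Linf_def)
  have m: "weak_gradient UNIV a \<in> borel_measurable (lebesgue_on UNIV)"
    by (rule borel_measurable_lebesgue_on_AE[OF bm AEb]) simp
  then show m': "weak_gradient UNIV a \<in> borel_measurable lebesgue"
    by (simp add: lebesgue_on_UNIV_eq)
  let ?E = "esssup (lebesgue_on {lo..hi}) (\<lambda>x. ereal \<bar>weak_gradient UNIV a x\<bar>)"
  let ?B = "esssup (lebesgue_on UNIV) (\<lambda>x. ereal \<bar>b x\<bar>)"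
  have "AE x in lebesgue_on UNIV. ereal \<bar>weak_gradient UNIV a x\<bar> \<le> ?B"
    using esssup_AE[of "\<lambda>x. ereal \<bar>b x\<bar>" "lebesgue_on UNIV"] AEb by eventually_elim simp
  then have "AE x in lebesgue_on {lo..hi}. ereal \<bar>weak_gradient UNIV a x\<bar> \<le> ?B"
    by (auto simp: AE_restrict_space_iff elim!: eventually_mono)
  then have "?E \<le> ?B"
    using m' by (intro esssup_I) (auto intro!: measurable_restrict_space1)
  then have fin: "?E \<noteq> \<infinity>"
    using b(1) by (auto simp: Linf_def)
  have "AE x in lebesgue_on {lo..hi}. \<bar>weak_gradient UNIV a x\<bar> \<le> Linf_norm (lebesgue_on {lo..hi}) (weak_gradient UNIV a)"
    using esssup_AE[of "\<lambda>x. ereal \<bar>weak_gradient UNIV a x\<bar>" "lebesgue_on {lo..hi}"]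
    by eventually_elim (use fin in \<open>cases ?E; simp add: Linf_norm_def\<close>)
  then show "AE x in lebesgue. x \<in> {lo..hi} \<longrightarrow>
      \<bar>weak_gradient UNIV a x\<bar> \<le> Linf_norm (lebesgue_on {lo..hi}) (weak_gradient UNIV a)"
    by (simp add: AE_restrict_space_iff)
qed

text \<open>The test function is a smoothed multiple of the indicator of \<open>[s, t]\<close>, so that its
  derivative approximates a multiple of \<open>\<delta>\<^sub>s - \<delta>\<^sub>t\<close>.\<close>

lemma weak_derivative_lipschitz:
  fixes a b :: "real \<Rightarrow> real"
  assumes a: "continuous_on UNIV a" "is_weak_gradient UNIV a b" and b: "b \<in> borel_measurable lebesgue"
    and L: "AE x in lebesgue. x \<in> {lo..hi} \<longrightarrow> \<bar>b x\<bar> \<le> L"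
    and st: "lo < s" "s \<le> t" "t < hi"
  shows "\<bar>a t - a s\<bar> \<le> L * (t - s)"
proof -
  \<comment> \<open>Here \<open>\<delta>\<close> is the width of the smoothing and
    \<open>\<eta>\<close> the oscillation of \<open>a\<close> over that width. The smoothed
    endpoints must still lie in \<open>[lo, hi]\<close>, the only place where \<open>b\<close> is
    bounded.\<close>
  have approx: "\<bar>a t - a s\<bar> \<le> L * (t - s + 2 * \<delta>) + 2 * \<eta>"
    if \<delta>: "\<delta> > 0" "lo \<le> s - \<delta>" "t + \<delta> \<le> hi"
      and \<eta>: "\<And>x. \<bar>x - s\<bar> \<le> \<delta> \<Longrightarrow> \<bar>a x - a s\<bar> \<le> \<eta>" "\<And>x. \<bar>x - t\<bar> \<le> \<delta> \<Longrightarrow> \<bar>a x - a t\<bar> \<le> \<eta>" for \<delta> \<eta>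
  proof -
    \<comment> \<open>A smooth bump that is positive exactly on the interval from
      \<open>-\<delta>\<close> to \<open>\<delta>\<close>.\<close>
    define \<zeta> where "\<zeta> x = flat 1 (x + \<delta>) * flat 1 (\<delta> - x)" for x
    have \<zeta>0: "\<zeta> x \<ge> 0" for x
      unfolding \<zeta>_def by (intro mult_nonneg_nonneg flat_1_bounds)
    have \<zeta>out: "\<zeta> x = 0" if "\<bar>x\<bar> \<ge> \<delta>" for x
      using that by (auto simp: \<zeta>_def flat_def)
    have \<zeta>cd: "cont_diff k (\<lambda>x. \<zeta> (x - c))" for k c
    proof -
      have "(\<lambda>x. \<zeta> (x - c)) = (\<lambda>x. flat 1 (1 * (x \<bullet> 1) + (\<delta> - c)) * flat 1 ((- 1) * (x \<bullet> 1) + (\<delta> + c)))"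
        by (simp add: \<zeta>_def fun_eq_iff algebra_simps)
      then show ?thesis
        by (simp only:) (intro cont_diff_mult cont_diff_flat)
    qed
    have \<zeta>cont: "continuous_on A (\<lambda>x. \<zeta> (x - c))" for A c
      by (rule cont_diff_continuous[OF \<zeta>cd])
    \<comment> \<open>With an antiderivative \<open>X\<close> of the bump, the derivative of the
      test function built from it is known exactly. \<open>X\<close> is constant on either side of
      the bump.\<close>
    have "\<exists>X. \<forall>x :: real. -\<infinity> < ereal x \<longrightarrow> ereal x < \<infinity> \<longrightarrow> (X has_vector_derivative \<zeta> x) (at x)"
      by (rule einterval_antiderivative)
        (use \<zeta>cont[of UNIV 0] in \<open>auto simp: continuous_on_eq_continuous_at\<close>)
    then obtain X where X: "\<And>x. (X has_real_derivative \<zeta> x) (at x)"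
      by (auto simp: has_real_derivative_iff_has_vector_derivative)
    have dX: "((\<lambda>x. X (x - c)) has_real_derivative \<zeta> (x - c)) (at x)" for x c
    proof -
      have "((\<lambda>x. x - c) has_real_derivative 1) (at x)"
        by (auto intro!: derivative_eq_intros)
      from DERIV_chain2[OF X this] show ?thesis
        by simp
    qed
    \<comment> \<open>The mass of the bump. It is not normalised to 1: every estimate below carries
      a factor \<open>C\<close>, which is cancelled at the end because \<open>C > 0\<close>.\<close>
    define C where "C = X \<delta> - X (- \<delta>)"
    have Xmono: "X x \<le> X y" if "x \<le> y" for x y
      using X \<zeta>0 by (intro DERIV_nonneg_imp_nondecreasing[OF that]) blast
    have Xconst: "X x = X y" if "x \<le> y" "\<And>z. x \<le> z \<Longrightarrow> z \<le> y \<Longrightarrow> \<zeta> z = 0" for x y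
    proof -
      have "((\<lambda>z. 0) has_integral X y - X x) {x..y}"
      proof (rule fundamental_theorem_of_calculus[OF that(1)])
        fix z assume "z \<in> {x..y}"
        then show "(X has_vector_derivative 0) (at z within {x..y})"
          using X[of z] that(2)[of z]
          by (simp add: has_real_derivative_iff_has_vector_derivative has_vector_derivative_at_within)
      qed
      then show ?thesis
        using has_integral_unique[OF _ has_integral_0] by fastforce
    qed
    have Xlo: "X x = X (- \<delta>)" if "x \<le> - \<delta>" for x
      using that \<delta>(1) by (intro Xconst \<zeta>out) auto
    have Xhi: "X x = X \<delta>" if "\<delta> \<le> x" for x
      using that \<delta>(1) by (intro Xconst[symmetric] \<zeta>out) auto
    have Xb: "X (- \<delta>) \<le> X x" "X x \<le> X \<delta>" for x
      using Xmono[of "- \<delta>" x] Xmono[of x \<delta>] Xlo[of x] Xhi[of x] Xmono[of "- \<delta>" \<delta>] \<delta>(1) by linarith+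
    have C: "C > 0"
    proof -
      obtain z where z: "- \<delta> < z" "z < \<delta>" "X \<delta> - X (- \<delta>) = (\<delta> - - \<delta>) * \<zeta> z"
        using MVT2[of "- \<delta>" \<delta> X \<zeta>] X \<delta>(1) by auto
      moreover have "\<zeta> z > 0"
        using z(1,2) by (simp add: \<zeta>_def flat_def)
      ultimately show ?thesis
        using \<delta>(1) by (simp add: C_def)
    qed
    \<comment> \<open>Climbs from 0 to a height of at most \<open>C\<close> around \<open>s\<close>
      and returns to 0 around \<open>t\<close>; its derivative is the bump at \<open>s\<close> minus
      the bump at \<open>t\<close>.\<close>
    define \<psi> where "\<psi> x = X (x - s) - X (x - t)" for x
    define p q where "p = s - \<delta>" and "q = t + \<delta>"
    have pq: "p \<le> q"
      using st \<delta> by (simp add: p_def q_def)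
    have d\<psi>: "(\<psi> has_derivative (\<lambda>h. (\<zeta> (x - s) - \<zeta> (x - t)) * h)) (at x)" for x
    proof -
      have "(\<psi> has_real_derivative \<zeta> (x - s) - \<zeta> (x - t)) (at x)"
        unfolding \<psi>_def[abs_def] by (intro DERIV_diff dX)
      then show ?thesis
        by (simp add: has_field_derivative_def)
    qed
    have \<psi>T: "\<psi> \<in> test_functions UNIV"
    proof (rule test_functionI[where K = "{p..q}"])
      fix k
      have "cont_diff (Suc k) \<psi>"
      proof (rule cont_diff_SucI[OF d\<psi>])
        fix b :: real assume "b \<in> Basis"
        have "cont_diff k (\<lambda>x. (\<zeta> (x - s) + (- 1) * \<zeta> (x - t)) * b)"
          by (intro cont_diff_mult cont_diff_add cont_diff_const \<zeta>cd)
        then show "cont_diff k (\<lambda>x. (\<zeta> (x - s) - \<zeta> (x - t)) * b)"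
          by simp
      qed
      then show "cont_diff k \<psi>"
        by (rule cont_diff_SucD)
    next
      fix x assume "x \<notin> {p..q}"
      then have "x - s \<le> - \<delta> \<and> x - t \<le> - \<delta> \<or> \<delta> \<le> x - s \<and> \<delta> \<le> x - t"
        using st(2) by (auto simp: p_def q_def)
      then show "\<psi> x = 0"
        using Xlo[of "x - s"] Xlo[of "x - t"] Xhi[of "x - s"] Xhi[of "x - t"] by (auto simp: \<psi>_def)
    qed auto
    have fd: "frechet_derivative \<psi> (at x) 1 = \<zeta> (x - s) - \<zeta> (x - t)" for x
      using fun_cong[OF frechet_derivative_at[OF d\<psi>[of x]], of 1] by simp
    have \<zeta>sup: "\<zeta> (x - s) = 0" "\<zeta> (x - t) = 0" if "x \<notin> {p..q}" for x
      using that st(2) by (auto simp: p_def q_def intro!: \<zeta>out)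
    have weak: "(LINT x|lebesgue. a x * (\<zeta> (x - s) - \<zeta> (x - t))) = - (LINT x|lebesgue. b x * \<psi> x)"
      using a(2)[unfolded is_weak_gradient_def, THEN conjunct2, rule_format, OF \<psi>T, of 1]
      by (simp add: fd lebesgue_on_UNIV_eq)
    have I: "((\<lambda>x. \<zeta> (x - c)) has_integral C) {p..q}" if "c = s \<or> c = t" for c
    proof -
      have "((\<lambda>x. \<zeta> (x - c)) has_integral X (q - c) - X (p - c)) {p..q}"
      proof (rule fundamental_theorem_of_calculus[OF pq])
        show "((\<lambda>x. X (x - c)) has_vector_derivative \<zeta> (x - c)) (at x within {p..q})" for x
          using dX by (simp add: has_real_derivative_iff_has_vector_derivative has_vector_derivative_at_within)
      qed
      moreover have "X (q - c) = X \<delta>" "X (p - c) = X (- \<delta>)"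
        using that st(2) by (auto simp: p_def q_def intro!: Xhi Xlo)
      ultimately show ?thesis
        by (simp add: C_def)
    qed
    \<comment> \<open>Integrating against the bump at \<open>c\<close> is, up to the factor
      \<open>C\<close>, evaluation at \<open>c\<close>, with an error governed by the oscillation
      \<open>\<eta>\<close>.\<close>
    have near: "\<bar>integral {p..q} (\<lambda>x. a x * \<zeta> (x - c)) - a c * C\<bar> \<le> \<eta> * C"
      "(\<lambda>x. a x * \<zeta> (x - c)) integrable_on {p..q}"
      if c: "c = s \<or> c = t" for c
    proof -
      show i: "(\<lambda>x. a x * \<zeta> (x - c)) integrable_on {p..q}"
        by (intro integrable_continuous_real continuous_intros \<zeta>cont continuous_on_subset[OF a(1)]) auto
      have "\<bar>integral {p..q} (\<lambda>x. (a x - a c) * \<zeta> (x - c))\<bar> \<le> integral {p..q} (\<lambda>x. \<eta> * \<zeta> (x - c))"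
        unfolding real_norm_def[symmetric]
      proof (rule Henstock_Kurzweil_Integration.integral_norm_bound_integral)
        show "(\<lambda>x. (a x - a c) * \<zeta> (x - c)) integrable_on {p..q}"
          by (intro integrable_continuous_real continuous_intros \<zeta>cont continuous_on_subset[OF a(1)]) auto
        show "(\<lambda>x. \<eta> * \<zeta> (x - c)) integrable_on {p..q}"
          by (intro integrable_continuous_real continuous_intros \<zeta>cont)
        show "norm ((a x - a c) * \<zeta> (x - c)) \<le> \<eta> * \<zeta> (x - c)" for x
        proof (cases "\<bar>x - c\<bar> \<le> \<delta>")
          case True
          then have "\<bar>a x - a c\<bar> \<le> \<eta>"
            using \<eta> c by blast
          then show ?thesis
            using \<zeta>0[of "x - c"] by (simp add: abs_mult mult_right_mono)
        qed (simp add: \<zeta>out)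
      qed
      also have "integral {p..q} (\<lambda>x. \<eta> * \<zeta> (x - c)) = \<eta> * C"
        using integral_unique[OF I[OF c]] by simp
      also have "integral {p..q} (\<lambda>x. (a x - a c) * \<zeta> (x - c))
          = integral {p..q} (\<lambda>x. a x * \<zeta> (x - c)) - a c * C"
        using integral_unique[OF has_integral_diff[OF integrable_integral[OF i]
              has_integral_mult_right[OF I[OF c], of "a c"]]]
        by (simp add: left_diff_distrib)
      finally show "\<bar>integral {p..q} (\<lambda>x. a x * \<zeta> (x - c)) - a c * C\<bar> \<le> \<eta> * C" .
    qed
    have LHS: "(LINT x|lebesgue. a x * (\<zeta> (x - s) - \<zeta> (x - t)))
        = integral {p..q} (\<lambda>x. a x * \<zeta> (x - s)) - integral {p..q} (\<lambda>x. a x * \<zeta> (x - t))"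
    proof -
      let ?h = "\<lambda>x. a x * (\<zeta> (x - s) - \<zeta> (x - t))"
      have "?h x = indicator {p..q} x *\<^sub>R ?h x" for x
        using \<zeta>sup[of x] by (cases "x \<in> {p..q}") simp_all
      then have "(LINT x|lebesgue. ?h x) = (LINT x:{p..q}|lebesgue. ?h x)"
        unfolding set_lebesgue_integral_def by (rule Bochner_Integration.integral_cong[OF refl])
      also have "\<dots> = integral {p..q} ?h"
        by (intro set_lebesgue_integral_eq_integral(2) continuous_absolutely_integrable_compact
            continuous_intros \<zeta>cont continuous_on_subset[OF a(1)]) auto
      also have "\<dots> = integral {p..q} (\<lambda>x. a x * \<zeta> (x - s) - a x * \<zeta> (x - t))"
        by (simp add: right_diff_distrib)
      also have "\<dots> = integral {p..q} (\<lambda>x. a x * \<zeta> (x - s)) - integral {p..q} (\<lambda>x. a x * \<zeta> (x - t))"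
        by (intro Henstock_Kurzweil_Integration.integral_diff near(2)) auto
      finally show ?thesis .
    qed
    \<comment> \<open>The test function has values in \<open>[0, C]\<close> and lives on
      \<open>[p, q]\<close>, whose length is \<open>t - s + 2 \<delta>\<close>.\<close>
    have RHS: "\<bar>LINT x|lebesgue. b x * \<psi> x\<bar> \<le> L * C * (q - p)"
    proof -
      have \<psi>b: "0 \<le> \<psi> x \<and> \<psi> x \<le> C" for x
        using Xmono[of "x - t" "x - s"] Xb[of "x - s"] Xb[of "x - t"] st(2)
        unfolding \<psi>_def C_def by linarith
      have \<psi>0: "\<psi> x = 0" if "x \<notin> {p..q}" for x
      proof -
        have "x - s \<le> - \<delta> \<and> x - t \<le> - \<delta> \<or> \<delta> \<le> x - s \<and> \<delta> \<le> x - t"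
          using that st(2) by (auto simp: p_def q_def)
        then show ?thesis
          using Xlo[of "x - s"] Xlo[of "x - t"] Xhi[of "x - s"] Xhi[of "x - t"] by (auto simp: \<psi>_def)
      qed
      have "\<bar>LINT x|lebesgue. b x * \<psi> x\<bar> \<le> (LINT x|lebesgue. norm (b x * \<psi> x))"
        using integral_norm_bound[of lebesgue "\<lambda>x. b x * \<psi> x"] by simp
      also have "\<dots> \<le> (LINT x|lebesgue. L * C * indicator {p..q} x)"
      proof (rule integral_mono_AE')
        show "integrable lebesgue (\<lambda>x. L * C * indicator {p..q} x)"
          by (intro integrable_mult_right integrable_real_indicator) (auto simp: emeasure_lborel_Icc_eq)
        have le: "AE x in lebesgue. norm (b x * \<psi> x) \<le> L * C * indicator {p..q} x"
          using L
        proof eventually_elim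
          case (elim x)
          show ?case
          proof (cases "x \<in> {p..q}")
            case True
            then have "\<bar>b x\<bar> \<le> L"
              using elim \<delta> by (auto simp: p_def q_def)
            then have "\<bar>b x\<bar> * \<bar>\<psi> x\<bar> \<le> L * C"
              using \<psi>b[of x] by (intro mult_mono) auto
            then show ?thesis
              using True by (simp add: abs_mult)
          qed (simp add: \<psi>0)
        qed
        then show "AE x in lebesgue. norm (b x * \<psi> x) \<le> L * C * indicator {p..q} x" .
        show "AE x in lebesgue. 0 \<le> L * C * indicator {p..q} x"
          using le by eventually_elim (rule order_trans[OF norm_ge_zero])
      qed
      also have "\<dots> = L * C * (q - p)"
        using pq by simp
      finally show ?thesis .
    qed
    have "\<bar>a t * C - a s * C\<bar> \<le> L * C * (q - p) + 2 * (\<eta> * C)"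
      using near(1)[of s] near(1)[of t] RHS weak unfolding LHS by linarith
    also have "\<dots> = C * (L * (t - s + 2 * \<delta>) + 2 * \<eta>)"
      by (simp add: p_def q_def algebra_simps)
    also have "\<bar>a t * C - a s * C\<bar> = C * \<bar>a t - a s\<bar>"
      using C by (simp add: abs_mult flip: left_diff_distrib)
    finally show ?thesis
      using C by simp
  qed
  have "\<bar>a t - a s\<bar> \<le> L * (t - s) + \<epsilon>" if \<epsilon>: "\<epsilon> > 0" for \<epsilon>
  proof -
    define \<eta> where "\<eta> = \<epsilon> / 4"
    have \<eta>: "\<eta> > 0"
      using \<epsilon> by (simp add: \<eta>_def)
    obtain d1 where d1: "d1 > 0" "\<And>x. \<bar>x - s\<bar> < d1 \<Longrightarrow> \<bar>a x - a s\<bar> < \<eta>"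
      using a(1) \<eta> unfolding continuous_on_iff dist_real_def by (metis UNIV_I)
    obtain d2 where d2: "d2 > 0" "\<And>x. \<bar>x - t\<bar> < d2 \<Longrightarrow> \<bar>a x - a t\<bar> < \<eta>"
      using a(1) \<eta> unfolding continuous_on_iff dist_real_def by (metis UNIV_I)
    \<comment> \<open>The halves turn the strict inequalities from continuity into weak ones,
      \<open>s - lo\<close> and \<open>hi - t\<close> keep the smoothing inside the interval, and
      the last entry gives \<open>2 L \<delta> \<le> \<epsilon> / 2\<close>; the other half of
      \<open>\<epsilon>\<close> is \<open>2 \<eta>\<close>. Adding 1 to the modulus of
      \<open>L\<close> avoids a zero denominator.\<close>
    let ?A = "{d1 / 2, d2 / 2, s - lo, hi - t, \<epsilon> / (4 * (\<bar>L\<bar> + 1))}"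
    define \<delta> where "\<delta> = Min ?A"
    have "\<delta> > 0"
      unfolding \<delta>_def using d1 d2 st \<epsilon> by (subst Min_gr_iff) auto
    moreover have "\<delta> \<le> y" if "y \<in> ?A" for y
      unfolding \<delta>_def by (rule Min_le[OF _ that]) simp
    ultimately have \<delta>: "\<delta> > 0" "\<delta> \<le> d1 / 2" "\<delta> \<le> d2 / 2" "\<delta> \<le> s - lo" "\<delta> \<le> hi - t" "\<delta> \<le> \<epsilon> / (4 * (\<bar>L\<bar> + 1))"
      by blast+
    have "\<bar>a t - a s\<bar> \<le> L * (t - s + 2 * \<delta>) + 2 * \<eta>"
    proof (rule approx)
      show "\<bar>a x - a s\<bar> \<le> \<eta>" if "\<bar>x - s\<bar> \<le> \<delta>" for x
        using d1(2)[of x] that \<delta>(2) d1(1) by linarith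
      show "\<bar>a x - a t\<bar> \<le> \<eta>" if "\<bar>x - t\<bar> \<le> \<delta>" for x
        using d2(2)[of x] that \<delta>(3) d2(1) by linarith
    qed (use \<delta> in auto)
    moreover have "L * \<delta> \<le> \<epsilon> / 4"
    proof -
      have "L * \<delta> \<le> (\<bar>L\<bar> + 1) * \<delta>"
        using \<delta>(1) by (intro mult_right_mono) auto
      also have "\<dots> \<le> (\<bar>L\<bar> + 1) * (\<epsilon> / (4 * (\<bar>L\<bar> + 1)))"
        using \<delta>(6) by (intro mult_left_mono) auto
      also have "\<dots> = \<epsilon> / 4"
        by (simp add: field_simps)
      finally show ?thesis .
    qed
    ultimately show ?thesis
      by (simp add: \<eta>_def algebra_simps)
  qed
  then show ?thesis
    by (rule field_le_epsilon)
qed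

text \<open>The points lie strictly inside the interval to leave room for smoothing. Since
  \<open>l_r(u_r)\<close> may reach 0 and \<open>\<mu>d\<close>, this is one reason for the margin
  \<open>\<epsilon>\<close> in the smallness condition.\<close>

lemma W1inf_lipschitz:
  assumes "a \<in> W1inf_real" "s \<in> {lo<..<hi}" "t \<in> {lo<..<hi}"
  shows "\<bar>a t - a s\<bar> \<le> Linf_norm (lebesgue_on {lo..hi}) (weak_gradient UNIV a) * \<bar>t - s\<bar>"
proof -
  have *: "\<bar>a t - a s\<bar> \<le> Linf_norm (lebesgue_on {lo..hi}) (weak_gradient UNIV a) * (t - s)"
    if "lo < s" "s \<le> t" "t < hi" for s t
    using weak_derivative_lipschitz[OF _ W1inf_weak_gradient_bound(3,1,2)[OF assms(1)] that] assms(1)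
    by (simp add: W1inf_real_def)
  show ?thesis
  proof (cases "s \<le> t")
    case True
    then show ?thesis
      using *[of s t] assms(2,3) by simp
  next
    case False
    then show ?thesis
      using *[of t s] assms(2,3) by (simp add: abs_minus_commute[of "a t"])
  qed
qed

text \<open>Without a lower bound the real infimum says nothing about the values of
  \<open>a\<close>. If the continuous \<open>a\<close> exceeded its essential bound in modulus at
  one point, it would do so on a nonempty open set, which is not negligible.\<close>

lemma W1inf_bdd_below:
  assumes "a \<in> W1inf_real"
  shows "bdd_below (range a)"
proof -
  have a: "continuous_on UNIV a" "a \<in> Linf (lebesgue_on UNIV)"
    using assms by (auto simp: W1inf_real_def)
  define E where "E = esssup (lebesgue_on UNIV) (\<lambda>x. ereal \<bar>a x\<bar>)"
  have fin: "E < \<infinity>"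
    using a(2) by (simp add: Linf_def E_def)
  have "AE x in lebesgue. ereal \<bar>a x\<bar> \<le> E"
    unfolding E_def lebesgue_on_UNIV_eq by (rule esssup_AE)
  then have "AE x in lebesgue. \<bar>a x\<bar> \<le> real_of_ereal E"
    by eventually_elim (use fin in \<open>cases E; simp\<close>)
  then obtain N where N: "{x. \<not> \<bar>a x\<bar> \<le> real_of_ereal E} \<subseteq> N" "N \<in> null_sets lebesgue"
    by (auto simp: eventually_ae_filter)
  have "open {x. real_of_ereal E < \<bar>a x\<bar>}"
    using a(1) by (intro open_Collect_less continuous_intros)
  moreover have "negligible N"
    using N(2) by (simp add: negligible_iff_null_sets)
  then have "negligible {x. real_of_ereal E < \<bar>a x\<bar>}"
    by (rule negligible_subset) (use N(1) in auto)
  ultimately have "{x. real_of_ereal E < \<bar>a x\<bar>} = {}"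
    using open_not_negligible by blast
  then have E: "\<not> real_of_ereal E < \<bar>a x\<bar>" for x
    by blast
  have "- real_of_ereal E \<le> a x" for x
    using E[of x] by linarith
  then show ?thesis
    by (intro bdd_belowI[of _ "- real_of_ereal E"]) blast
qed

section \<open>The nonlocal term\<close>

text \<open>When centre and radius converge, the indicators of the balls converge off the limiting
  sphere, a null set; dominated convergence does the rest. Continuity in both variables jointly is
  what later yields uniformity in \<open>x\<close>.\<close>

lemma continuous_on_integral_cball:
  fixes h :: "'a::euclidean_space \<Rightarrow> real"
  assumes h: "integrable lebesgue h"
  shows "continuous_on UNIV (\<lambda>p. LINT y|lebesgue. indicator (cball (fst p) (snd p)) y * h y)"
proof (rule continuous_on_sequentiallyI)
  fix q :: "nat \<Rightarrow> 'a \<times> real" and p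
  assume q: "q \<longlonglongrightarrow> p"
  show "(\<lambda>n. LINT y|lebesgue. indicator (cball (fst (q n)) (snd (q n))) y * h y)
      \<longlonglongrightarrow> (LINT y|lebesgue. indicator (cball (fst p) (snd p)) y * h y)"
  proof (rule integral_dominated_convergence[where w = "\<lambda>y. norm (h y)"])
    show "integrable lebesgue (\<lambda>y. norm (h y))"
      using h by simp
    have "(\<lambda>y. indicator (cball c r) y * h y) \<in> borel_measurable lebesgue" for c r
      using borel_measurable_integrable[OF h] by (intro borel_measurable_times borel_measurable_indicator) auto
    then show "(\<lambda>y. indicator (cball (fst p) (snd p)) y * h y) \<in> borel_measurable lebesgue"
      "\<And>n. (\<lambda>y. indicator (cball (fst (q n)) (snd (q n))) y * h y) \<in> borel_measurable lebesgue"
      by blast+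
    show "AE y in lebesgue. norm (indicator (cball (fst (q n)) (snd (q n))) y * h y) \<le> norm (h y)" for n
      by (intro AE_I2) (simp add: indicator_def)
    have "sphere (fst p) (snd p) \<in> null_sets lebesgue"
      using negligible_sphere negligible_iff_null_sets by blast
    then have "AE y in lebesgue. y \<notin> sphere (fst p) (snd p)"
      by (rule AE_not_in)
    then show "AE y in lebesgue. (\<lambda>n. indicator (cball (fst (q n)) (snd (q n))) y * h y)
        \<longlonglongrightarrow> indicator (cball (fst p) (snd p)) y * h y"
    proof eventually_elim
      case (elim y)
      have lim: "(\<lambda>n. dist (fst (q n)) y - snd (q n)) \<longlonglongrightarrow> dist (fst p) y - snd p"
        by (intro tendsto_intros q)
      have "\<forall>\<^sub>F n in sequentially. indicator (cball (fst (q n)) (snd (q n))) y = (indicator (cball (fst p) (snd p)) y :: real)"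
      proof (cases "dist (fst p) y < snd p")
        case True
        then have "\<forall>\<^sub>F n in sequentially. dist (fst (q n)) y - snd (q n) < 0"
          by (intro order_tendstoD(2)[OF lim]) simp
        then show ?thesis
          by eventually_elim (use True in \<open>simp add: indicator_def\<close>)
      next
        case False
        then have gt: "dist (fst p) y > snd p"
          using elim by simp
        then have "\<forall>\<^sub>F n in sequentially. dist (fst (q n)) y - snd (q n) > 0"
          by (intro order_tendstoD(1)[OF lim]) simp
        then show ?thesis
          by eventually_elim (use gt in \<open>simp add: indicator_def\<close>)
      qed
      then show ?case
        by (intro tendsto_mult tendsto_const tendsto_eventually)
    qed
  qed
qed

context
  fixes S :: "'a::euclidean_space set"
  assumes S: "S \<in> sets lebesgue"
begin

text \<open>Moves the dependence on \<open>x\<close> and \<open>r\<close> from the measure into the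
  integrand, so that different balls can be compared under one integral.\<close>

lemma nonlocal_eq:
  "nonlocal S g r v x = (LINT y|lebesgue. indicator (cball x r) y * (indicator S y * (g y * v y)))"
  unfolding nonlocal_def using S
  by (subst integral_restrict_space)
    (auto simp: indicator_inter_arith mult_ac intro!: Bochner_Integration.integral_cong)

lemma integrable_nonlocal:
  fixes g v :: "'a \<Rightarrow> real"
  assumes "g \<in> L2 (lebesgue_on S)" "v \<in> L2 (lebesgue_on S)"
  shows "integrable lebesgue (\<lambda>y. indicator S y * (g y * v y))"
    and "integrable lebesgue (\<lambda>y. indicator (cball x r) y * (indicator S y * (g y * v y)))"
proof -
  have "integrable lebesgue (\<lambda>y. indicator S y *\<^sub>R (g y * v y))"
    using L2_mult(1)[OF assms] S by (subst (asm) integrable_restrict_space) auto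
  then show i: "integrable lebesgue (\<lambda>y. indicator S y * (g y * v y))"
    by simp
  show "integrable lebesgue (\<lambda>y. indicator (cball x r) y * (indicator S y * (g y * v y)))"
    using integrable_mult_indicator[OF _ i, of "cball x r"] by simp
qed

lemma continuous_on_nonlocal:
  assumes "g \<in> L2 (lebesgue_on S)" "v \<in> L2 (lebesgue_on S)"
  shows "continuous_on UNIV (\<lambda>p. nonlocal S g (snd p) v (fst p))"
  unfolding nonlocal_eq by (rule continuous_on_integral_cball[OF integrable_nonlocal(1)[OF assms]])

lemma nonlocal_diff:
  assumes "g \<in> L2 (lebesgue_on S)" "u \<in> L2 (lebesgue_on S)" "v \<in> L2 (lebesgue_on S)"
  shows "nonlocal S g r (\<lambda>x. u x - v x) x = nonlocal S g r u x - nonlocal S g r v x"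
  unfolding nonlocal_eq
  using integrable_nonlocal(2)[OF assms(1,2)] integrable_nonlocal(2)[OF assms(1,3)]
  by (simp add: right_diff_distrib)

lemma abs_nonlocal_le:
  assumes "g \<in> L2 (lebesgue_on S)" "v \<in> L2 (lebesgue_on S)"
  shows "\<bar>nonlocal S g r v x\<bar> \<le> L2_norm (lebesgue_on S) g * L2_norm (lebesgue_on S) v"
proof -
  have "\<bar>nonlocal S g r v x\<bar> \<le> (LINT y|lebesgue. norm (indicator (cball x r) y * (indicator S y * (g y * v y))))"
    unfolding nonlocal_eq real_norm_def[symmetric] by (rule integral_norm_bound)
  also have "\<dots> \<le> (LINT y|lebesgue. norm (indicator S y * (g y * v y)))"
    using integrable_nonlocal(1)[OF assms] integrable_nonlocal(2)[OF assms]
    by (intro integral_mono integrable_norm) (auto simp: indicator_def)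
  also have "\<dots> = (LINT y|lebesgue_on S. norm (g y) * norm (v y))"
    using S by (subst integral_restrict_space) (auto simp: abs_mult intro!: Bochner_Integration.integral_cong)
  also have "\<dots> \<le> L2_norm (lebesgue_on S) g * L2_norm (lebesgue_on S) v"
    by (rule L2_Cauchy_Schwarz[OF assms])
  finally show ?thesis .
qed

text \<open>Two comparisons at once: enlarging the function uses \<open>g \<ge> 0\<close>, enlarging
  the ball uses \<open>v \<ge> 0\<close>. No sign is imposed on \<open>u\<close>.\<close>

lemma nonlocal_mono:
  assumes "g \<in> L2 (lebesgue_on S)" "u \<in> L2 (lebesgue_on S)" "v \<in> L2 (lebesgue_on S)"
    and "AE x in lebesgue_on S. 0 \<le> g x" "AE x in lebesgue_on S. u x \<le> v x" "AE x in lebesgue_on S. 0 \<le> v x"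
    and "r \<le> s"
  shows "nonlocal S g r u x \<le> nonlocal S g s v x"
  unfolding nonlocal_eq
proof (rule integral_mono_AE[OF integrable_nonlocal(2)[OF assms(1,2)] integrable_nonlocal(2)[OF assms(1,3)]])
  have "AE y in lebesgue_on S. 0 \<le> g y \<and> u y \<le> v y \<and> 0 \<le> v y"
    using assms(4,5,6) by eventually_elim simp
  then have "AE y in lebesgue. y \<in> S \<longrightarrow> 0 \<le> g y \<and> u y \<le> v y \<and> 0 \<le> v y"
    using S by (subst (asm) AE_restrict_space_iff) auto
  then show "AE y in lebesgue. indicator (cball x r) y * (indicator S y * (g y * u y))
      \<le> indicator (cball x s) y * (indicator S y * (g y * v y))"
  proof eventually_elim
    case (elim y)
    show ?case
    proof (cases "y \<in> S \<and> dist x y \<le> r")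
      case True
      then show ?thesis
        using elim assms(7) by (simp add: mult_left_mono)
    next
      case False
      then have "indicator (cball x r) y * (indicator S y * (g y * u y)) = 0"
        by (auto simp: indicator_def)
      moreover have "0 \<le> indicator (cball x s) y * (indicator S y * (g y * v y))"
        using elim by (cases "y \<in> S") auto
      ultimately show ?thesis
        by (simp only:)
    qed
  qed
qed

text \<open>The ball degenerates to a point. Thus \<open>(P_0)\<close> is a Poisson problem with the
  constant coefficient \<open>a 0\<close>.\<close>

lemma nonlocal_0: "nonlocal S g 0 v x = 0"
proof -
  have "AE y in lebesgue. y \<notin> {x}"
    by (intro AE_not_in) simp
  then have "AE y in lebesgue. indicator (cball x 0) y * (indicator S y * (g y * v y)) = 0"
    by eventually_elim simp
  then show ?thesis
    unfolding nonlocal_eq by (rule integral_eq_zero_AE)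
qed

text \<open>Keeps coefficient times gradient in L2, so that the integrals in the weak formulation
  exist. For the bound, Cauchy-Schwarz confines the nonlocal term to a compact interval, on which
  \<open>a\<close> is bounded by continuity.\<close>

lemma nonlocal_coefficient:
  fixes a :: "real \<Rightarrow> real"
  assumes a: "continuous_on UNIV a" and g: "g \<in> L2 (lebesgue_on S)" and v: "v \<in> L2 (lebesgue_on S)"
  shows "(\<lambda>x. a (nonlocal S g r v x)) \<in> borel_measurable (lebesgue_on S)"
    and "\<exists>B. \<forall>x. \<bar>a (nonlocal S g r v x)\<bar> \<le> B"
proof -
  have "continuous_on UNIV ((\<lambda>p. nonlocal S g (snd p) v (fst p)) \<circ> (\<lambda>x. (x, r)))"
    by (intro continuous_on_compose continuous_intros continuous_on_subset[OF continuous_on_nonlocal[OF g v]]) auto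
  then have "continuous_on UNIV (\<lambda>x. nonlocal S g r v x)"
    by (simp add: o_def)
  then have "continuous_on UNIV (\<lambda>x. a (nonlocal S g r v x))"
    by (rule continuous_on_compose2[OF a]) simp
  then have "(\<lambda>x. a (nonlocal S g r v x)) \<in> borel_measurable borel"
    by (rule borel_measurable_continuous_onI)
  then show "(\<lambda>x. a (nonlocal S g r v x)) \<in> borel_measurable (lebesgue_on S)"
    by (intro measurable_restrict_space1 measurable_completion) simp
  define K where "K = L2_norm (lebesgue_on S) g * L2_norm (lebesgue_on S) v"
  have "bounded (a ` {- K..K})"
    by (intro compact_imp_bounded compact_continuous_image continuous_on_subset[OF a]) auto
  then obtain B where B: "\<forall>t\<in>{- K..K}. \<bar>a t\<bar> \<le> B"
    by (auto simp: bounded_iff)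
  have "nonlocal S g r v x \<in> {- K..K}" for x
    using abs_nonlocal_le[OF g v, of r x] unfolding K_def atLeastAtMost_iff by linarith
  with B have "\<bar>a (nonlocal S g r v x)\<bar> \<le> B" for x
    by blast
  then show "\<exists>B. \<forall>x. \<bar>a (nonlocal S g r v x)\<bar> \<le> B"
    by blast
qed

end

section \<open>Comparison of two solutions\<close>

text \<open>Test the equation with \<open>u\<close> itself; coercivity on the left, Cauchy-Schwarz
  and Poincare on the right, then cancel one factor of the gradient norm.\<close>

lemma solution_energy_bound:
  assumes S: "open S" "S \<subseteq> cball 0 R" "R \<ge> 0" and a: "continuous_on UNIV a"
    and f: "f \<in> L2 (lebesgue_on S)" and g: "g \<in> L2 (lebesgue_on S)"
    and u: "is_solution S a f g r u" and m: "m > 0" "\<And>x. x \<in> S \<Longrightarrow> m \<le> a (nonlocal S g r u x)"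
  shows "m * L2_norm (lebesgue_on S) (weak_gradient S u) \<le> 2 * R * L2_norm (lebesgue_on S) f"
proof -
  let ?M = "lebesgue_on S"
  let ?N = "L2_norm ?M"
  let ?G = "weak_gradient S u"
  have SL: "S \<in> sets lebesgue"
    using S(1) by auto
  have uH: "u \<in> H10 S"
    using u by (simp add: is_solution_def)
  note Lu = H1_L2[OF S(1) H10_H1[OF uH]]
  obtain B where B: "\<And>x. \<bar>a (nonlocal S g r u x)\<bar> \<le> B"
    using nonlocal_coefficient(2)[OF SL a g Lu(1)] by blast
  have LA: "(\<lambda>x. a (nonlocal S g r u x) *\<^sub>R ?G x) \<in> L2 ?M"
    using B by (intro L2_mult_bounded[OF Lu(2) nonlocal_coefficient(1)[OF SL a g Lu(1)]] AE_I2)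
  have "m * (?N ?G)\<^sup>2 = (LINT x|?M. m * (norm (?G x))\<^sup>2)"
    by (simp add: L2_norm_power2)
  also have "\<dots> \<le> (LINT x|?M. a (nonlocal S g r u x) * (?G x \<bullet> ?G x))"
  proof (rule integral_mono)
    show "integrable ?M (\<lambda>x. m * (norm (?G x))\<^sup>2)"
      using L2D(2)[OF Lu(2)] by simp
    show "integrable ?M (\<lambda>x. a (nonlocal S g r u x) * (?G x \<bullet> ?G x))"
      using L2_inner(1)[OF LA Lu(2)] by simp
    show "m * (norm (?G x))\<^sup>2 \<le> a (nonlocal S g r u x) * (?G x \<bullet> ?G x)" if "x \<in> space ?M" for x
      using that m(2) by (simp add: power2_norm_eq_inner mult_right_mono)
  qed
  also have "\<dots> = (LINT x|?M. f x * u x)"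
    using u uH by (simp add: is_solution_def)
  also have "\<dots> \<le> ?N f * ?N u"
    using L2_mult(2)[OF f Lu(1)] by linarith
  also have "\<dots> \<le> ?N f * (2 * R * ?N ?G)"
    by (intro mult_left_mono Poincare_H10 S uH L2_norm_nonneg)
  finally have "?N ?G * (m * ?N ?G) \<le> ?N ?G * (2 * R * ?N f)"
    by (simp add: power2_eq_square mult_ac)
  then show ?thesis
    using L2_norm_nonneg[of ?M ?G] L2_norm_nonneg[of ?M f] S(3) by (cases "?N ?G = 0") auto
qed

text \<open>With coefficients \<open>A\<close>, \<open>B\<close> and \<open>w = u - v\<close>, both
  equations have the same right-hand side \<open>\<integral> f w\<close>, which leaves
  \<open>\<integral> A |\<nabla>w|^2 = \<integral> (B - A) \<nabla>v \<bullet> \<nabla>w\<close>.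
  The radii may differ, since only the coefficients enter.\<close>

lemma solution_diff_bound:
  assumes S: "open S" and a: "continuous_on UNIV a" and g: "g \<in> L2 (lebesgue_on S)"
    and u: "is_solution S a f g r u" and v: "is_solution S a f g s v"
    and f: "f \<in> L2 (lebesgue_on S)"
    and m: "\<And>x. x \<in> S \<Longrightarrow> m \<le> a (nonlocal S g r u x)"
    and k: "\<And>x. x \<in> S \<Longrightarrow> \<bar>a (nonlocal S g r u x) - a (nonlocal S g s v x)\<bar> \<le> k" "k \<ge> 0"
  shows "m * L2_norm (lebesgue_on S) (weak_gradient S (\<lambda>x. u x - v x))
    \<le> k * L2_norm (lebesgue_on S) (weak_gradient S v)"
proof -
  let ?M = "lebesgue_on S"
  let ?N = "L2_norm ?M"
  define w where "w x = u x - v x" for x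
  let ?G = "weak_gradient S"
  let ?A = "\<lambda>x. a (nonlocal S g r u x)"
  let ?B = "\<lambda>x. a (nonlocal S g s v x)"
  have SL: "S \<in> sets lebesgue"
    using S(1) by auto
  have H: "u \<in> H10 S" "v \<in> H10 S"
    using u v by (simp_all add: is_solution_def)
  have wH: "w \<in> H10 S"
    unfolding w_def by (rule H10_diff[OF S H])
  note Lu = H1_L2[OF S H10_H1[OF H(1)]] and Lv = H1_L2[OF S H10_H1[OF H(2)]] and Lw = H1_L2[OF S H10_H1[OF wH]]
  obtain b1 where b1: "\<And>x. \<bar>?A x\<bar> \<le> b1"
    using nonlocal_coefficient(2)[OF SL a g Lu(1)] by blast
  obtain b2 where b2: "\<And>x. \<bar>?B x\<bar> \<le> b2"
    using nonlocal_coefficient(2)[OF SL a g Lv(1)] by blast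
  have LA: "(\<lambda>x. ?A x *\<^sub>R h x) \<in> L2 ?M" "(\<lambda>x. ?B x *\<^sub>R h x) \<in> L2 ?M"
    if "h \<in> L2 ?M" for h :: "'a \<Rightarrow> 'a"
    using b1 b2 that by (auto intro!: L2_mult_bounded AE_I2
        nonlocal_coefficient(1)[OF SL a g Lu(1)] nonlocal_coefficient(1)[OF SL a g Lv(1)])
  have iA: "integrable ?M (\<lambda>x. ?A x * (h x \<bullet> ?G w x))" "integrable ?M (\<lambda>x. ?B x * (h x \<bullet> ?G w x))"
    if "h \<in> L2 ?M" for h
    using L2_inner(1)[OF LA(1)[OF that] Lw(2)] L2_inner(1)[OF LA(2)[OF that] Lw(2)] by simp_all
  have "m * (?N (?G w))\<^sup>2 = (LINT x|?M. m * (norm (?G w x))\<^sup>2)"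
    by (simp add: L2_norm_power2)
  also have "\<dots> \<le> (LINT x|?M. ?A x * (?G w x \<bullet> ?G w x))"
  proof (rule integral_mono)
    show "integrable ?M (\<lambda>x. m * (norm (?G w x))\<^sup>2)"
      using L2D(2)[OF Lw(2)] by simp
    show "m * (norm (?G w x))\<^sup>2 \<le> ?A x * (?G w x \<bullet> ?G w x)" if "x \<in> space ?M" for x
      using that m by (simp add: power2_norm_eq_inner mult_right_mono)
  qed (rule iA(1)[OF Lw(2)])
  also have "\<dots> = (LINT x|?M. ?A x * (?G u x \<bullet> ?G w x) - ?A x * (?G v x \<bullet> ?G w x))"
  proof (rule integral_cong_AE)
    show "(\<lambda>x. ?A x * (?G w x \<bullet> ?G w x)) \<in> borel_measurable ?M"
      by (rule borel_measurable_integrable[OF iA(1)[OF Lw(2)]])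
    show "(\<lambda>x. ?A x * (?G u x \<bullet> ?G w x) - ?A x * (?G v x \<bullet> ?G w x)) \<in> borel_measurable ?M"
      by (intro borel_measurable_diff borel_measurable_integrable iA Lu Lv)
    show "AE x in ?M. ?A x * (?G w x \<bullet> ?G w x) = ?A x * (?G u x \<bullet> ?G w x) - ?A x * (?G v x \<bullet> ?G w x)"
      using H1_diff(2)[OF S H10_H1[OF H(1)] H10_H1[OF H(2)]]
      unfolding w_def[abs_def, symmetric]
      by eventually_elim (metis inner_diff_left right_diff_distrib)
  qed
  also have "\<dots> = (LINT x|?M. ?A x * (?G u x \<bullet> ?G w x)) - (LINT x|?M. ?A x * (?G v x \<bullet> ?G w x))"
    by (intro Bochner_Integration.integral_diff iA Lu Lv)
  also have "(LINT x|?M. ?A x * (?G u x \<bullet> ?G w x)) = (LINT x|?M. ?B x * (?G v x \<bullet> ?G w x))"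
    using u v wH by (simp add: is_solution_def)
  also have "\<dots> - (LINT x|?M. ?A x * (?G v x \<bullet> ?G w x))
      = (LINT x|?M. ?B x * (?G v x \<bullet> ?G w x) - ?A x * (?G v x \<bullet> ?G w x))"
    by (intro Bochner_Integration.integral_diff[symmetric] iA Lv)
  also have "\<dots> \<le> (LINT x|?M. k * (norm (?G v x) * norm (?G w x)))"
  proof (rule integral_mono)
    show "integrable ?M (\<lambda>x. ?B x * (?G v x \<bullet> ?G w x) - ?A x * (?G v x \<bullet> ?G w x))"
      by (intro Bochner_Integration.integrable_diff iA Lv)
    show "integrable ?M (\<lambda>x. k * (norm (?G v x) * norm (?G w x)))"
      by (intro integrable_mult_right L2_integrable_norm_mult Lv Lw)
    show "?B x * (?G v x \<bullet> ?G w x) - ?A x * (?G v x \<bullet> ?G w x) \<le> k * (norm (?G v x) * norm (?G w x))"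
      if "x \<in> space ?M" for x
    proof -
      have "?B x * (?G v x \<bullet> ?G w x) - ?A x * (?G v x \<bullet> ?G w x) = (?B x - ?A x) * (?G v x \<bullet> ?G w x)"
        by (simp add: left_diff_distrib)
      also have "\<dots> \<le> \<bar>?B x - ?A x\<bar> * \<bar>?G v x \<bullet> ?G w x\<bar>"
        by (metis abs_ge_self abs_mult)
      also have "\<dots> \<le> k * (norm (?G v x) * norm (?G w x))"
        using k(1)[of x] k(2) that by (intro mult_mono Cauchy_Schwarz_ineq2) (auto simp: abs_minus_commute)
      finally show ?thesis .
    qed
  qed
  also have "\<dots> = k * (LINT x|?M. norm (?G v x) * norm (?G w x))"
    by simp
  also have "\<dots> \<le> k * (?N (?G v) * ?N (?G w))"
    by (intro mult_left_mono L2_Cauchy_Schwarz Lv Lw k)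
  finally have "?N (?G w) * (m * ?N (?G w)) \<le> ?N (?G w) * (k * ?N (?G v))"
    by (simp add: power2_eq_square mult_ac)
  then have "m * ?N (?G w) \<le> k * ?N (?G v)"
    using L2_norm_nonneg[of ?M "?G w"] L2_norm_nonneg[of ?M "?G v"] k(2) by (cases "?N (?G w) = 0") auto
  then show ?thesis
    by (simp add: w_def[abs_def])
qed

text \<open>The difference of the nonlocal terms contains the gradient norm being estimated, so that
  part is absorbed on the left. The bounds \<open>m\<close> and \<open>m'\<close> are kept apart
  because a solution from another branch comes with a weaker one.\<close>

lemma solution_comparison:
  assumes S: "open S" "S \<subseteq> cball 0 R" "R \<ge> 0" and a: "continuous_on UNIV a"
    and f: "f \<in> L2 (lebesgue_on S)" and g: "g \<in> L2 (lebesgue_on S)"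
    and u: "is_solution S a f g r u" and v: "is_solution S a f g s v"
    and m: "m > 0" "\<And>x. x \<in> S \<Longrightarrow> m \<le> a (nonlocal S g r u x)"
    and m': "m' > 0" "\<And>x. x \<in> S \<Longrightarrow> m' \<le> a (nonlocal S g s v x)"
    and L: "L \<ge> 0" "\<And>x. x \<in> S \<Longrightarrow> \<bar>a (nonlocal S g r u x) - a (nonlocal S g s v x)\<bar>
      \<le> L * \<bar>nonlocal S g r u x - nonlocal S g s v x\<bar>"
    and w: "w \<ge> 0" "\<And>x. x \<in> S \<Longrightarrow> \<bar>nonlocal S g r v x - nonlocal S g s v x\<bar> \<le> w"
  shows "(m * m' - L * (2 * R)\<^sup>2 * L2_norm (lebesgue_on S) g * L2_norm (lebesgue_on S) f)
      * L2_norm (lebesgue_on S) (weak_gradient S (\<lambda>x. u x - v x))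
    \<le> L * (2 * R) * L2_norm (lebesgue_on S) f * w"
proof -
  let ?N = "L2_norm (lebesgue_on S)"
  let ?W = "?N (weak_gradient S (\<lambda>x. u x - v x))"
  have SL: "S \<in> sets lebesgue"
    using S(1) by auto
  have H: "u \<in> H10 S" "v \<in> H10 S"
    using u v by (simp_all add: is_solution_def)
  note Lu = H1_L2[OF S(1) H10_H1[OF H(1)]] and Lv = H1_L2[OF S(1) H10_H1[OF H(2)]]
  \<comment> \<open>From the splitting of \<open>l_r(u) - l_s(v)\<close> into
    \<open>l_r(u - v)\<close>, bounded by Cauchy-Schwarz and Poincare, and
    \<open>l_r(v) - l_s(v)\<close>, the effect of changing the radius, bounded by
    \<open>w\<close>.\<close>
  define k where "k = L * (?N g * (2 * R * ?W) + w)"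
  have k0: "k \<ge> 0"
    unfolding k_def using L(1) w(1) S(3) by (intro mult_nonneg_nonneg add_nonneg_nonneg L2_norm_nonneg) auto
  have k: "\<bar>a (nonlocal S g r u x) - a (nonlocal S g s v x)\<bar> \<le> k" if x: "x \<in> S" for x
  proof -
    have "\<bar>nonlocal S g r u x - nonlocal S g r v x\<bar> \<le> ?N g * ?N (\<lambda>x. u x - v x)"
      using abs_nonlocal_le[OF SL g L2_diff[OF Lu(1) Lv(1)]] nonlocal_diff[OF SL g Lu(1) Lv(1)] by metis
    also have "\<dots> \<le> ?N g * (2 * R * ?W)"
      by (intro mult_left_mono Poincare_H10 S H10_diff H L2_norm_nonneg)
    finally have "\<bar>nonlocal S g r u x - nonlocal S g s v x\<bar> \<le> ?N g * (2 * R * ?W) + w"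
      using w(2)[OF x] by linarith
    then have "L * \<bar>nonlocal S g r u x - nonlocal S g s v x\<bar> \<le> k"
      unfolding k_def using L(1) by (rule mult_left_mono)
    then show ?thesis
      using L(2)[OF x] by linarith
  qed
  have "m * m' * ?W = m' * (m * ?W)"
    by simp
  also have "\<dots> \<le> m' * (k * ?N (weak_gradient S v))"
    using m'(1) by (intro mult_left_mono solution_diff_bound[OF S(1) a g u v f m(2) k k0]) auto
  also have "\<dots> = k * (m' * ?N (weak_gradient S v))"
    by simp
  also have "\<dots> \<le> k * (2 * R * ?N f)"
    by (intro mult_left_mono k0 solution_energy_bound[OF S a f g v m'])
  finally show ?thesis
    by (simp add: k_def power2_eq_square algebra_simps)
qed

section \<open>Uniqueness of the global branch\<close>

theorem corollary3p8:
  fixes d :: real and \<Omega> :: "(real ^ 'n) set"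
  assumes "d > 0" and "\<Omega> = ball 0 (d/2)"
  shows "\<exists>C\<^sub>1>0. \<forall>(f :: real ^ 'n \<Rightarrow> real) (g :: real ^ 'n \<Rightarrow> real) (a :: real \<Rightarrow> real)
      (\<phi> :: real ^ 'n \<Rightarrow> real) (\<mu>d :: real) (u0 :: real ^ 'n \<Rightarrow> real) (ud :: real ^ 'n \<Rightarrow> real)
      (ud1 :: real ^ 'n \<Rightarrow> real) (u :: real \<Rightarrow> real ^ 'n \<Rightarrow> real).
    f \<in> L2_radial d \<and> g \<in> L2_radial d \<and>
    (AE x in lebesgue_on \<Omega>. 0 \<le> f x) \<and> (AE x in lebesgue_on \<Omega>. 0 \<le> g x) \<and>
    a \<in> W1inf_real \<and> (INF t. a t) > 0 \<and>
    is_poisson_solution \<Omega> f \<phi> \<and>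
    (\<forall>x\<in>\<Omega>. \<mu>d * a \<mu>d = nonlocal \<Omega> g d \<phi> x) \<and>
    (\<forall>t\<in>{0..\<mu>d}. a \<mu>d \<le> a t) \<and> (\<forall>t\<in>{0..\<mu>d}. a t \<le> a 0) \<and>
    is_smallest_solution \<Omega> a f g d ud1 \<and>
    (\<forall>x\<in>\<Omega>. 0 \<le> nonlocal \<Omega> g d ud1 x \<and> nonlocal \<Omega> g d ud1 x \<le> \<mu>d) \<and>
    (\<exists>\<epsilon>>0. C\<^sub>1 * L2_norm (lebesgue_on \<Omega>) g * L2_norm (lebesgue_on \<Omega>) f
        * Linf_norm (lebesgue_on {-\<epsilon>..\<mu>d+\<epsilon>}) (weak_gradient UNIV a) * (1 / (a \<mu>d)\<^sup>2) < 1) \<and>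
    is_solution \<Omega> a f g 0 u0 \<and>
    is_solution \<Omega> a f g d ud \<and> (\<forall>x\<in>\<Omega>. nonlocal \<Omega> g d ud x = \<mu>d) \<and>
    (\<forall>r\<in>{0..d}. is_solution \<Omega> a f g r (u r) \<and> u r \<in> L2_radial d \<and>
        (AE x in lebesgue_on \<Omega>. u0 x \<le> u r x \<and> u r x \<le> ud x))
    \<longrightarrow>
    is_global_branch \<Omega> d a f g u \<and> (AE x in lebesgue_on \<Omega>. u d x = ud1 x) \<and>
    (\<forall>v. is_global_branch \<Omega> d a f g v \<and> (AE x in lebesgue_on \<Omega>. v d x = ud1 x) \<longrightarrow>
         (\<forall>r\<in>{0..d}. AE x in lebesgue_on \<Omega>. v r x = u r x))"
proof (intro exI[of _ "d\<^sup>2"] conjI allI impI)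
  show "0 < d\<^sup>2"
    using assms(1) by simp
next
  fix f g :: "real ^ 'n \<Rightarrow> real" and a :: "real \<Rightarrow> real" and \<phi> :: "real ^ 'n \<Rightarrow> real" and \<mu> :: real
    and u0 ud ud1 :: "real ^ 'n \<Rightarrow> real" and u :: "real \<Rightarrow> real ^ 'n \<Rightarrow> real"
  let ?M = "lebesgue_on \<Omega>"
  let ?N = "L2_norm ?M"
  let ?l = "nonlocal \<Omega> g"
  let ?W = "\<lambda>v w. ?N (weak_gradient \<Omega> (\<lambda>x. v x - w x))"
  assume hyp: "f \<in> L2_radial d \<and> g \<in> L2_radial d \<and>
    (AE x in lebesgue_on \<Omega>. 0 \<le> f x) \<and> (AE x in lebesgue_on \<Omega>. 0 \<le> g x) \<and>
    a \<in> W1inf_real \<and> (INF t. a t) > 0 \<and>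
    is_poisson_solution \<Omega> f \<phi> \<and>
    (\<forall>x\<in>\<Omega>. \<mu> * a \<mu> = nonlocal \<Omega> g d \<phi> x) \<and>
    (\<forall>t\<in>{0..\<mu>}. a \<mu> \<le> a t) \<and> (\<forall>t\<in>{0..\<mu>}. a t \<le> a 0) \<and>
    is_smallest_solution \<Omega> a f g d ud1 \<and>
    (\<forall>x\<in>\<Omega>. 0 \<le> nonlocal \<Omega> g d ud1 x \<and> nonlocal \<Omega> g d ud1 x \<le> \<mu>) \<and>
    (\<exists>\<epsilon>>0. d\<^sup>2 * L2_norm (lebesgue_on \<Omega>) g * L2_norm (lebesgue_on \<Omega>) f
        * Linf_norm (lebesgue_on {-\<epsilon>..\<mu>+\<epsilon>}) (weak_gradient UNIV a) * (1 / (a \<mu>)\<^sup>2) < 1) \<and>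
    is_solution \<Omega> a f g 0 u0 \<and>
    is_solution \<Omega> a f g d ud \<and> (\<forall>x\<in>\<Omega>. nonlocal \<Omega> g d ud x = \<mu>) \<and>
    (\<forall>r\<in>{0..d}. is_solution \<Omega> a f g r (u r) \<and> u r \<in> L2_radial d \<and>
        (AE x in lebesgue_on \<Omega>. u0 x \<le> u r x \<and> u r x \<le> ud x))"
  have d: "d > 0" and S: "open \<Omega>" "\<Omega> \<subseteq> cball 0 (d/2)" "d/2 \<ge> 0"
    using assms by auto
  have SL: "\<Omega> \<in> sets lebesgue"
    using S(1) by auto
  have 0: "0 \<in> \<Omega>"
    using assms by simp
  have f: "f \<in> L2 ?M" "AE x in ?M. 0 \<le> f x" and g: "g \<in> L2 ?M" "AE x in ?M. 0 \<le> g x"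
    using hyp assms(2) by (auto simp: L2_radial_def)
  have aW: "a \<in> W1inf_real"
    using hyp by blast
  then have a: "continuous_on UNIV a"
    by (simp add: W1inf_real_def)
  have apos: "a t > 0" for t
  proof -
    have "(INF t. a t) \<le> a t"
      by (rule cINF_lower[OF W1inf_bdd_below[OF aW]]) simp
    moreover have "(INF t. a t) > 0"
      using hyp by blast
    ultimately show ?thesis
      by linarith
  qed
  have sol1: "is_solution \<Omega> a f g d ud1"
    using hyp by (simp add: is_smallest_solution_def)
  have l1: "\<And>x. x \<in> \<Omega> \<Longrightarrow> ?l d ud1 x \<in> {0..\<mu>}"
    using hyp by simp
  have \<mu>: "\<mu> \<ge> 0"
    using l1[OF 0] by simp
  define m where "m = a \<mu>"
  have m: "m > 0" "\<And>t. t \<in> {0..\<mu>} \<Longrightarrow> m \<le> a t"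
    using hyp apos by (auto simp: m_def)
  obtain \<epsilon> where \<epsilon>: "\<epsilon> > 0" "d\<^sup>2 * ?N g * ?N f
        * Linf_norm (lebesgue_on {-\<epsilon>..\<mu>+\<epsilon>}) (weak_gradient UNIV a) * (1 / (a \<mu>)\<^sup>2) < 1"
    using hyp by blast
  define L where "L = Linf_norm (lebesgue_on {-\<epsilon>..\<mu>+\<epsilon>}) (weak_gradient UNIV a)"
  have lip: "\<bar>a t - a s\<bar> \<le> L * \<bar>t - s\<bar>" if "s \<in> {-\<epsilon><..<\<mu>+\<epsilon>}" "t \<in> {-\<epsilon><..<\<mu>+\<epsilon>}" for s t
    unfolding L_def by (rule W1inf_lipschitz[OF aW that])
  \<comment> \<open>The sign is read off from the Lipschitz estimate at the two distinct points 0
    and \<open>\<epsilon> / 2\<close>.\<close>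
  have L: "L \<ge> 0"
  proof -
    have "0 \<le> L * \<bar>\<epsilon> / 2 - 0\<bar>"
      using lip[of 0 "\<epsilon> / 2"] \<epsilon>(1) \<mu> by (intro order_trans[OF abs_ge_zero]) auto
    then show ?thesis
      using \<epsilon>(1) by (simp add: zero_le_mult_iff)
  qed
  \<comment> \<open>In these terms the smallness condition reads \<open>K < m^2\<close>. The gap
    \<open>m^2 - K\<close> is the coercivity left over in the comparison estimate.\<close>
  define K where "K = L * d\<^sup>2 * ?N g * ?N f"
  have K0: "K \<ge> 0"
    unfolding K_def using L by (intro mult_nonneg_nonneg L2_norm_nonneg) auto
  have K: "K < m\<^sup>2"
  proof -
    have "K / m\<^sup>2 < 1"
      using \<epsilon>(2) by (simp add: K_def L_def m_def mult_ac)
    then show ?thesis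
      using m(1) by simp
  qed
  have su: "is_solution \<Omega> a f g r (u r)" "AE x in ?M. u0 x \<le> u r x \<and> u r x \<le> ud x"
    if "r \<in> {0..d}" for r
    using hyp that by blast+
  have sol0: "is_solution \<Omega> a f g 0 u0" and sold: "is_solution \<Omega> a f g d ud"
    and ld: "\<And>x. x \<in> \<Omega> \<Longrightarrow> ?l d ud x = \<mu>"
    using hyp by blast+
  have H: "w \<in> H10 \<Omega>" if "is_solution \<Omega> a f g r w" for r w
    using that by (simp add: is_solution_def)
  have L2s: "w \<in> L2 ?M" if "is_solution \<Omega> a f g r w" for r w
    by (rule H1_L2(1)[OF S(1) H10_H1[OF H[OF that]]])

  \<comment> \<open>At \<open>r = 0\<close> the coefficient is the constant \<open>a 0\<close>, so
    the maximum principle applies with right-hand side \<open>f / a 0\<close>.\<close>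
  have u0: "AE x in ?M. 0 \<le> u0 x"
  proof (rule weak_maximum_principle[OF S H[OF sol0] L2_cmult[OF f(1), of "1 / a 0"]])
    show "AE x in ?M. 0 \<le> 1 / a 0 * f x"
      using f(2) by eventually_elim (use apos[of 0] in simp)
    fix v assume v: "v \<in> H10 \<Omega>"
    have "(LINT x|?M. a 0 * (weak_gradient \<Omega> u0 x \<bullet> weak_gradient \<Omega> v x)) = (LINT x|?M. f x * v x)"
      using sol0 v by (simp add: is_solution_def nonlocal_0[OF SL])
    then show "(LINT x|?M. weak_gradient \<Omega> u0 x \<bullet> weak_gradient \<Omega> v x) = (LINT x|?M. 1 / a 0 * f x * v x)"
      using apos[of 0] by (simp add: field_simps)
  qed
  \<comment> \<open>From \<open>0 \<le> u0 \<le> u r \<le> ud\<close> and \<open>g \<ge> 0\<close>,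
    enlarging the ball to radius \<open>d\<close> can only increase the integral of
    \<open>g ud\<close>, and that integral is \<open>\<mu>\<close> at radius
    \<open>d\<close>.\<close>
  have lu: "?l r (u r) x \<in> {0..\<mu>}" if r: "r \<in> {0..d}" and x: "x \<in> \<Omega>" for r x
  proof -
    note Lu = L2s[OF su(1)[OF r]]
    have AE0: "AE x in ?M. 0 \<le> u r x" "AE x in ?M. u r x \<le> ud x" "AE x in ?M. 0 \<le> ud x"
      using u0 su(2)[OF r] by (eventually_elim; simp)+
    have "?l r (\<lambda>x. 0) x \<le> ?l r (u r) x"
      using AE0 g by (intro nonlocal_mono[OF SL g(1) _ Lu]) (auto simp: L2_def)
    then have "0 \<le> ?l r (u r) x"
      by (simp add: nonlocal_def)
    moreover have "?l r (u r) x \<le> ?l d ud x"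
      using AE0 g r by (intro nonlocal_mono[OF SL g(1) Lu L2s[OF sold]]) auto
    ultimately show ?thesis
      using ld[OF x] by simp
  qed

  have comparison: "(m' * m'' - K) * ?W v w \<le> L * d * ?N f * \<eta>"
    if v: "is_solution \<Omega> a f g r v" and w: "is_solution \<Omega> a f g s w"
      and m': "m' > 0" "\<And>x. x \<in> \<Omega> \<Longrightarrow> m' \<le> a (?l r v x)"
      and m'': "m'' > 0" "\<And>x. x \<in> \<Omega> \<Longrightarrow> m'' \<le> a (?l s w x)"
      and int: "\<And>x. x \<in> \<Omega> \<Longrightarrow> ?l r v x \<in> {-\<epsilon><..<\<mu>+\<epsilon>}" "\<And>x. x \<in> \<Omega> \<Longrightarrow> ?l s w x \<in> {-\<epsilon><..<\<mu>+\<epsilon>}"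
      and \<eta>: "\<eta> \<ge> 0" "\<And>x. x \<in> \<Omega> \<Longrightarrow> \<bar>?l r w x - ?l s w x\<bar> \<le> \<eta>"
    for r s v w m' m'' \<eta>
  proof -
    have "\<bar>a (?l r v x) - a (?l s w x)\<bar> \<le> L * \<bar>?l r v x - ?l s w x\<bar>" if "x \<in> \<Omega>" for x
      by (rule lip[OF int(2)[OF that] int(1)[OF that]])
    from solution_comparison[OF S a f(1) g(1) v w m' m'' L this \<eta>]
    show ?thesis
      by (simp add: K_def)
  qed
  have lu': "?l r (u r) x \<in> {-\<epsilon><..<\<mu>+\<epsilon>}" if "r \<in> {0..d}" "x \<in> \<Omega>" for r x
    using lu[OF that] \<epsilon>(1) by auto
  have mu: "m \<le> a (?l r (u r) x)" if "r \<in> {0..d}" "x \<in> \<Omega>" for r x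
    by (rule m(2)[OF lu[OF that]])

  \<comment> \<open>With equal radii the comparison has right-hand side 0, and
    \<open>K < m' * m\<close> makes the factor on the left positive. For \<open>v\<close> only a
    lower bound on its coefficient and the range of its nonlocal term are required.\<close>
  have unique: "?N (\<lambda>x. v x - u r x) = 0"
    if r: "r \<in> {0..d}" and v: "is_solution \<Omega> a f g r v"
      and m': "m' > 0" "\<And>x. x \<in> \<Omega> \<Longrightarrow> m' \<le> a (?l r v x)" "K < m' * m"
      and int: "\<And>x. x \<in> \<Omega> \<Longrightarrow> ?l r v x \<in> {-\<epsilon><..<\<mu>+\<epsilon>}" for r v m'
  proof -
    have "(m' * m - K) * ?W v (u r) \<le> L * d * ?N f * 0"
      by (rule comparison[OF v su(1)[OF r] m'(1,2) m(1) mu[OF r] int lu'[OF r]]) auto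
    then have "?W v (u r) \<le> 0"
      using m'(3) by (simp add: mult_le_0_iff)
    moreover have "?N (\<lambda>x. v x - u r x) \<le> 2 * (d/2) * ?W v (u r)"
      by (rule Poincare_H10[OF S H10_diff[OF S(1) H[OF v] H[OF su(1)[OF r]]]])
    ultimately show ?thesis
      using d L2_norm_nonneg[of ?M "\<lambda>x. v x - u r x"] L2_norm_nonneg[of ?M "weak_gradient \<Omega> (\<lambda>x. v x - u r x)"]
      by (simp add: antisym)
  qed
  have AE_eq: "AE x in ?M. v x = w x" if "v \<in> L2 ?M" "w \<in> L2 ?M" "?N (\<lambda>x. v x - w x) = 0" for v w :: "real ^ 'n \<Rightarrow> real"
    using L2_norm_eq_0_AE[OF L2_diff[OF that(1,2)] that(3)] by eventually_elim simp

  have dd: "d \<in> {0..d}"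
    using d by simp
  \<comment> \<open>The smallest solution has its nonlocal term in \<open>[0, \<mu>]\<close>, so the
    full bound \<open>m\<close> is available for it.\<close>
  have ud1: "?N (\<lambda>x. ud1 x - u d x) = 0"
    using l1 m K \<epsilon>(1) by (intro unique[OF dd sol1 m(1)]) (force simp: power2_eq_square)+
  show ud_eq: "AE x in ?M. u d x = ud1 x"
    using AE_eq[OF L2s[OF sol1] L2s[OF su(1)[OF dd]] ud1] by eventually_elim simp

  show "is_global_branch \<Omega> d a f g u"
    unfolding is_global_branch_def
  proof (intro conjI ballI)
    fix s assume s: "s \<in> {0..d}"
    \<comment> \<open>The fraction is the constant of the comparison estimate for the gradient; the
      factor \<open>d + 1\<close> passes to the \<open>H1\<close> norm by Poincare.\<close>
    define B where "B = L * d * ?N f / (m * m - K) * (d + 1)"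
    have mK: "m * m - K > 0"
      using K by (simp add: power2_eq_square)
    have B: "B \<ge> 0"
      unfolding B_def using mK L d by (intro mult_nonneg_nonneg divide_nonneg_pos L2_norm_nonneg) auto
    have est: "H1_norm \<Omega> (\<lambda>x. u r x - u s x) \<le> B * \<eta>"
      if r: "r \<in> {0..d}" and \<eta>: "\<eta> \<ge> 0" "\<And>x. x \<in> \<Omega> \<Longrightarrow> \<bar>?l r (u s) x - ?l s (u s) x\<bar> \<le> \<eta>" for r \<eta>
    proof -
      have "(m * m - K) * ?W (u r) (u s) \<le> L * d * ?N f * \<eta>"
        by (rule comparison[OF su(1)[OF r] su(1)[OF s] m(1) mu[OF r] m(1) mu[OF s] lu'[OF r] lu'[OF s] \<eta>])
      then have W: "?W (u r) (u s) \<le> L * d * ?N f / (m * m - K) * \<eta>"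
        using mK by (simp add: field_simps)
      have "H1_norm \<Omega> (\<lambda>x. u r x - u s x) \<le> \<bar>?N (\<lambda>x. u r x - u s x)\<bar> + \<bar>?W (u r) (u s)\<bar>"
        unfolding H1_norm_def by (rule sqrt_sum_squares_le_sum_abs)
      also have "\<dots> \<le> 2 * (d/2) * ?W (u r) (u s) + ?W (u r) (u s)"
        using Poincare_H10[OF S H10_diff[OF S(1) H[OF su(1)[OF r]] H[OF su(1)[OF s]]]]
        by (simp add: L2_norm_nonneg)
      also have "\<dots> = (d + 1) * ?W (u r) (u s)"
        by (simp add: algebra_simps)
      also have "\<dots> \<le> (d + 1) * (L * d * ?N f / (m * m - K) * \<eta>)"
        using d by (intro mult_left_mono W) auto
      also have "\<dots> = B * \<eta>"
        by (simp add: B_def)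
      finally show ?thesis .
    qed
    show "((\<lambda>r. H1_norm \<Omega> (\<lambda>x. u r x - u s x)) \<longlongrightarrow> 0) (at s within {0..d})"
    proof (rule tendstoI)
      fix e :: real assume e: "e > 0"
      define \<eta> where "\<eta> = e / (B + 1)"
      have \<eta>: "\<eta> > 0" "B * \<eta> < e"
        using e B by (auto simp: \<eta>_def field_simps)
      \<comment> \<open>Only compactness makes the modulus of continuity in \<open>r\<close>
        independent of \<open>x\<close>; hence the closed ball and the joint variable.\<close>
      have "uniformly_continuous_on (cball 0 (d/2) \<times> {0..d}) (\<lambda>p. nonlocal \<Omega> g (snd p) (u s) (fst p))"
        by (intro compact_uniformly_continuous compact_Times
            continuous_on_subset[OF continuous_on_nonlocal[OF SL g(1) L2s[OF su(1)[OF s]]]]) auto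
      then obtain \<delta> where \<delta>: "\<delta> > 0" "\<And>p q. p \<in> cball 0 (d/2) \<times> {0..d} \<Longrightarrow> q \<in> cball 0 (d/2) \<times> {0..d} \<Longrightarrow>
          dist q p < \<delta> \<Longrightarrow> dist (nonlocal \<Omega> g (snd q) (u s) (fst q)) (nonlocal \<Omega> g (snd p) (u s) (fst p)) < \<eta>"
        unfolding uniformly_continuous_on_def using \<eta>(1) by meson
      have "dist (H1_norm \<Omega> (\<lambda>x. u r x - u s x)) 0 < e" if r: "r \<in> {0..d}" "dist r s < \<delta>" for r
      proof -
        have "\<bar>?l r (u s) x - ?l s (u s) x\<bar> \<le> \<eta>" if "x \<in> \<Omega>" for x
          using \<delta>(2)[of "(x, s)" "(x, r)"] that r s S(2)
          by (auto simp: dist_Pair_Pair dist_real_def subset_iff less_imp_le)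
        then have "H1_norm \<Omega> (\<lambda>x. u r x - u s x) \<le> B * \<eta>"
          using \<eta>(1) by (intro est[OF r(1)]) auto
        moreover have "0 \<le> H1_norm \<Omega> (\<lambda>x. u r x - u s x)"
          by (simp add: H1_norm_def)
        ultimately show ?thesis
          using \<eta>(2) by simp
      qed
      then show "\<forall>\<^sub>F r in at s within {0..d}. dist (H1_norm \<Omega> (\<lambda>x. u r x - u s x)) 0 < e"
        unfolding eventually_at using \<delta>(1) by blast
    qed
  qed (rule su(1))

  show "\<forall>r\<in>{0..d}. AE x in ?M. v r x = u r x"
    if "is_global_branch \<Omega> d a f g v \<and> (AE x in lebesgue_on \<Omega>. v d x = ud1 x)" for v
  proof -
    have v: "\<And>r. r \<in> {0..d} \<Longrightarrow> is_solution \<Omega> a f g r (v r)"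
      "\<And>s. s \<in> {0..d} \<Longrightarrow> ((\<lambda>r. H1_norm \<Omega> (\<lambda>x. v r x - v s x)) \<longlongrightarrow> 0) (at s within {0..d})"
      "AE x in ?M. v d x = ud1 x"
      using that by (auto simp: is_global_branch_def)
    have uc: "((\<lambda>r. H1_norm \<Omega> (\<lambda>x. u r x - u s x)) \<longlongrightarrow> 0) (at s within {0..d})" if "s \<in> {0..d}" for s
      using \<open>is_global_branch \<Omega> d a f g u\<close> that by (simp add: is_global_branch_def)
    \<comment> \<open>The L2 distance is enough to watch: by Cauchy-Schwarz it controls the nonlocal
      terms uniformly in \<open>x\<close>.\<close>
    define D where "D r = ?N (\<lambda>x. v r x - u r x)" for r
    note Lv = L2s[OF v(1)] and Lu = L2s[OF su(1)]
    have Dcont: "continuous_on {0..d} D"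
      unfolding continuous_on_def
    proof
      fix s assume s: "s \<in> {0..d}"
      have le: "\<bar>D r - D s\<bar> \<le> H1_norm \<Omega> (\<lambda>x. v r x - v s x) + H1_norm \<Omega> (\<lambda>x. u r x - u s x)"
        if r: "r \<in> {0..d}" for r
      proof -
        have 1: "D p \<le> D q + (?N (\<lambda>x. v p x - v q x) + ?N (\<lambda>x. u p x - u q x))"
          if p: "p \<in> {0..d}" and q: "q \<in> {0..d}" for p q
          using L2_norm_triangle_diff[OF Lv[OF p] Lv[OF q] Lu[OF p]]
            L2_norm_triangle_diff[OF Lv[OF q] Lu[OF q] Lu[OF p]]
            L2_norm_minus_commute[of ?M "u p" "u q"]
          by (simp add: D_def)
        have "\<bar>D r - D s\<bar> \<le> ?N (\<lambda>x. v r x - v s x) + ?N (\<lambda>x. u r x - u s x)"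
          using 1[OF r s] 1[OF s r] L2_norm_minus_commute[of ?M "u s" "u r"] L2_norm_minus_commute[of ?M "v s" "v r"]
          by linarith
        then show ?thesis
          using L2_norm_le_H1_norm(1)[of \<Omega> "\<lambda>x. v r x - v s x"] L2_norm_le_H1_norm(1)[of \<Omega> "\<lambda>x. u r x - u s x"]
          by linarith
      qed
      have "((\<lambda>r. D r - D s) \<longlongrightarrow> 0) (at s within {0..d})"
      proof (rule tendsto_rabs_zero_cancel, rule tendsto_sandwich[OF _ _ tendsto_const])
        show "\<forall>\<^sub>F r in at s within {0..d}. \<bar>D r - D s\<bar>
            \<le> H1_norm \<Omega> (\<lambda>x. v r x - v s x) + H1_norm \<Omega> (\<lambda>x. u r x - u s x)"
          using le by (auto simp: eventually_at_filter)
        show "((\<lambda>r. H1_norm \<Omega> (\<lambda>x. v r x - v s x) + H1_norm \<Omega> (\<lambda>x. u r x - u s x)) \<longlongrightarrow> 0) (at s within {0..d})"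
          using tendsto_add[OF v(2)[OF s] uc[OF s]] by simp
      qed simp
      then show "(D \<longlongrightarrow> D s) (at s within {0..d})"
        by (rule LIM_zero_cancel)
    qed
    have Dd: "D d = 0"
      unfolding D_def
      by (rule L2_norm_0_AE)
        (use v(3) ud_eq L2D(1)[OF L2_diff[OF Lv[OF dd] Lu[OF dd]]] in \<open>auto elim!: eventually_elim2\<close>)
    \<comment> \<open>The first bound keeps values within \<open>\<delta>\<close> of
      \<open>[0, \<mu>]\<close> inside the Lipschitz interval. The second makes
      \<open>m L \<delta>\<close> at most half of \<open>m^2 - K\<close>, so that
      \<open>m - L \<delta>\<close> can replace one factor \<open>m\<close>; \<open>L + 1\<close>
      guards against \<open>L = 0\<close>.\<close>
    define \<delta> where "\<delta> = min (\<epsilon> / 2) ((m\<^sup>2 - K) / (2 * m * (L + 1)))"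
    have \<delta>: "\<delta> > 0" "\<delta> < \<epsilon>"
      using \<epsilon>(1) K m(1) L by (auto simp: \<delta>_def)
    have \<delta>m: "K < (m - L * \<delta>) * m"
    proof -
      have cancel: "m * (c * (y / (2 * m * c))) = y / 2" if "c > 0" for c y :: real
        using m(1) that by (simp add: field_simps)
      have "m * (L * \<delta>) \<le> m * ((L + 1) * ((m\<^sup>2 - K) / (2 * m * (L + 1))))"
        using m(1) L \<delta>(1) by (intro mult_left_mono mult_mono) (auto simp: \<delta>_def)
      also have "\<dots> = (m\<^sup>2 - K) / 2"
        using L by (intro cancel) simp
      also have "\<dots> < m\<^sup>2 - K"
        using K by simp
      finally show ?thesis
        by (simp add: power2_eq_square algebra_simps)
    qed
    \<comment> \<open>If the branches are this close, \<open>l_r(v_r)\<close> stays within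
      \<open>\<delta>\<close> of \<open>l_r(u_r)\<close>. By the Lipschitz bound its coefficient is
      then at least \<open>m - L * \<delta>\<close>, and \<open>unique\<close> applies.\<close>
    have gap: "D r = 0" if r: "r \<in> {0..d}" and small: "?N g * D r \<le> \<delta>" for r
      unfolding D_def
    proof (rule unique[OF r v(1)[OF r]])
      show "m - L * \<delta> > 0"
        using \<delta>m K0 m(1) by (metis le_less_trans mult_less_0_iff not_less_iff_gr_or_eq zero_less_mult_iff)
      have near: "\<bar>?l r (v r) x - ?l r (u r) x\<bar> \<le> \<delta>" for x
        using abs_nonlocal_le[OF SL g(1) L2_diff[OF Lv[OF r] Lu[OF r]], of r x] small
        unfolding D_def nonlocal_diff[OF SL g(1) Lv[OF r] Lu[OF r]] by linarith
      show int: "?l r (v r) x \<in> {-\<epsilon><..<\<mu>+\<epsilon>}" if "x \<in> \<Omega>" for x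
        using near[of x] lu[OF r that] \<delta>(2) by (auto simp: abs_le_iff)
      show "m - L * \<delta> \<le> a (?l r (v r) x)" if x: "x \<in> \<Omega>" for x
      proof -
        have "\<bar>a (?l r (v r) x) - a (?l r (u r) x)\<bar> \<le> L * \<bar>?l r (v r) x - ?l r (u r) x\<bar>"
          by (rule lip[OF lu'[OF r x] int[OF x]])
        also have "\<dots> \<le> L * \<delta>"
          by (intro mult_left_mono near L)
        finally show ?thesis
          using mu[OF r x] by linarith
      qed
    qed (rule \<delta>m)
    \<comment> \<open>Otherwise \<open>?N g * D\<close> exceeds \<open>\<delta>\<close> at
      \<open>r\<close> and is 0 at \<open>d\<close>, so it equals \<open>\<delta>\<close> somewhere
      between. There \<open>gap\<close> forces \<open>D\<close> to vanish, contradicting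
      \<open>\<delta> > 0\<close>.\<close>
    have "D r = 0" if r: "r \<in> {0..d}" for r
    proof (rule ccontr)
      assume "D r \<noteq> 0"
      then have "\<delta> < ?N g * D r"
        using gap[OF r] by force
      moreover have "continuous_on {r..d} (\<lambda>s. ?N g * D s)"
        using r by (intro continuous_intros continuous_on_subset[OF Dcont]) auto
      ultimately obtain s where s: "r \<le> s" "s \<le> d" "?N g * D s = \<delta>"
        using IVT2'[of "\<lambda>s. ?N g * D s" d \<delta> r] \<delta>(1) Dd r by auto
      then have "D s = 0"
        using r by (intro gap) auto
      then show False
        using s(3) \<delta>(1) by simp
    qed
    then show ?thesis
      using AE_eq[OF Lv Lu] unfolding D_def by blast
  qed
qed

end
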